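(* Given $f\in \mathcal C$, define $g\in \mathcal C$ to be the multiplicative function for which $F(s)G(s)=1$. Fix $A,C \geq 0$ and $\varepsilon > 0$. Let $x$ be large, let $2 \leq Q \leq x^{1/2}/(\log x)^{5A/2+C/4+7/2}$ and let $\Xi$ be a set of at most $(\log x)^C$ primitive Dirichlet characters. Suppose that the following properties hold for both $h=f$ and $h=g$: (i) If $(a,q)=1$ then $$\Delta_\Xi(h,X;q,a) \ll \frac{ X} {(\log x)^{14A+28}}$$ for all $X$ in the range $x^{0.4}\leq X\leq x$; (ii) The bound $$\sum_{q\leq Q} \max_{a:\ (a,q)=1} |\Delta_\Xi (h ,X;q,a)| \ll \frac X{(\log x)^{A+\varepsilon}}$$ holds for all $X$ in the range $x/(\log x)^{6A+C+10}\leq X\leq x$. Then $$\sum_{q\leq Q} \max_{a:\ (a,q)=1} | \Delta_\Xi(f\cdot 1_{\mathcal P},x;q,a) | \ll \frac x {(\log x)^{A}};$$ and the same holds with $f\cdot 1_{\mathcal P}$ replaced by $g\cdot 1_{\mathcal P}$.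
   Context: For an arithmetic function $h$ and a Dirichlet character $\chi$, put $S_h(X,\chi):=\sum_{n\le X}h(n)\overline{\chi}(n)$. For a finite set $\Xi$ of primitive Dirichlet characters (the trivial character of conductor $1$ counts as primitive), let $\Xi_q$ be the set of characters mod $q$ that are induced by the characters in $\Xi$. For $(a,q)=1$ define $$\Delta_\Xi(h,X;q,a):= \sum_{\substack{n\leq X \\ n\equiv a \pmod q}} h(n) - \frac 1{\varphi(q)} \sum_{\chi \in \Xi_q} \chi(a) S_h(X,\chi).$$ For a multiplicative function $f$ let $F(s)=\sum_{n\ge1} f(n)n^{-s}$ (and $G(s)=\sum_{n\geq 1} g(n)n^{-s}$), and define $\Lambda_f$ by $-F'(s)/F(s)=\sum_{n\ge2}\Lambda_f(n)n^{-s}$ for $\mathrm{Re}(s)>1$ (equivalently $f(n)\log n=\sum_{d\mid n}\Lambda_f(d)f(n/d)$ for all $n\geq 1$). $\mathcal C$ is the class of multiplicative functions $f$ with $|\Lambda_f(n)|\le\Lambda(n)$ for all $n\ge1$, where $\Lambda$ is the von Mangoldt function; if $f\in\mathcal C$ then its Dirichlet convolution inverse $g$ is also in $\mathcal C$. $\mathcal P$ is the set of primes, and $f\cdot 1_{\mathcal P}$ is the function equal to $f$ on primes and $0$ elsewhere. Convention: "$x$ large" means $x$ sufficiently large in terms of the fixed parameters; the implied constant in the conclusion depends only on the fixed parameters $A,C,\varepsilon$ and on the implied constants in the hypotheses, which are uniform in $X$, $q$, $a$. *)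

theory Defs
  imports "HOL-Analysis.Analysis" "HOL-Number_Theory.Number_Theory"
begin

text \<open>
  Arithmetic functions are functions \<^typ>\<open>nat \<Rightarrow> complex\<close>; the value at \<open>0\<close> is irrelevant
  throughout.
\<close>

definition multiplicative :: "(nat \<Rightarrow> complex) \<Rightarrow> bool" where
  "multiplicative f \<longleftrightarrow>
     f 1 = 1 \<and> (\<forall>m n. m > 0 \<longrightarrow> n > 0 \<longrightarrow> coprime m n \<longrightarrow> f (m * n) = f m * f n)"

definition dirichlet_series :: "(nat \<Rightarrow> complex) \<Rightarrow> complex \<Rightarrow> complex" where
  "dirichlet_series f s = (\<Sum>n. f (Suc n) / of_nat (Suc n) powr s)"

text \<open>
  \<open>Lambda_of f\<close> is the function $\Lambda_f$, the coefficient sequence of $-F'/F$.  It is given here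
  by solving the identity $f(n)\log n = \sum_{d\mid n} \Lambda_f(d) f(n/d)$ recursively for the
  term $d = n$, where $f(1) = 1$; see the two lemmas below.
\<close>

function Lambda_of :: "(nat \<Rightarrow> complex) \<Rightarrow> nat \<Rightarrow> complex" where
  "Lambda_of f n =
     f n * of_real (ln (real n)) - (\<Sum>d | d dvd n \<and> d < n. Lambda_of f d * f (n div d))"
  by auto
termination by (relation "Wellfounded.measure snd") auto

declare Lambda_of.simps [simp del]

lemma sum_dvd_split_top:
  fixes h :: "nat \<Rightarrow> complex"
  assumes "n > 0"
  shows "(\<Sum>d | d dvd n. h d) = h n + (\<Sum>d | d dvd n \<and> d < n. h d)"
proof -
  have "{d. d dvd n} = insert n {d. d dvd n \<and> d < n}"
    using assms by (auto dest: dvd_imp_le)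
  thus ?thesis by simp
qed

lemma Lambda_of_convolution:
  assumes "f 1 = 1" "n > 0"
  shows "f n * of_real (ln (real n)) = (\<Sum>d | d dvd n. Lambda_of f d * f (n div d))"
  using assms by (simp add: sum_dvd_split_top Lambda_of.simps[of f n])

lemma Lambda_of_unique:
  assumes "f 1 = 1"
    and "\<And>n. n > 0 \<Longrightarrow> f n * of_real (ln (real n)) = (\<Sum>d | d dvd n. L d * f (n div d))"
    and "n > 0"
  shows "L n = Lambda_of f n"
  using assms(3)
proof (induction n rule: less_induct)
  case (less n)
  have "(\<Sum>d | d dvd n \<and> d < n. L d * f (n div d)) =
        (\<Sum>d | d dvd n \<and> d < n. Lambda_of f d * f (n div d))"
    using less by (intro sum.cong) (auto intro!: Nat.gr0I)
  thus ?case
    using assms(1) assms(2)[OF less.prems] Lambda_of_convolution[of f n, OF assms(1) less.prems] less.prems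
    by (simp add: sum_dvd_split_top)
qed

definition class_C :: "(nat \<Rightarrow> complex) set" where
  "class_C = {f. multiplicative f \<and> (\<forall>n\<ge>1. norm (Lambda_of f n) \<le> mangoldt n)}"

definition dirichlet_char :: "nat \<Rightarrow> (nat \<Rightarrow> complex) \<Rightarrow> bool" where
  "dirichlet_char q \<eta> \<longleftrightarrow> q > 0 \<and> (\<forall>n. \<eta> (n mod q) = \<eta> n) \<and>
     (\<forall>m n. \<eta> (m * n) = \<eta> m * \<eta> n) \<and> (\<forall>n. \<eta> n \<noteq> 0 \<longleftrightarrow> coprime n q)"

text \<open>\<open>induced_by q \<eta> d \<psi>\<close>: the character \<open>\<eta>\<close> mod \<open>q\<close> is induced by the character \<open>\<psi>\<close> mod \<open>d\<close>.\<close>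

definition induced_by :: "nat \<Rightarrow> (nat \<Rightarrow> complex) \<Rightarrow> nat \<Rightarrow> (nat \<Rightarrow> complex) \<Rightarrow> bool" where
  "induced_by q \<eta> d \<psi> \<longleftrightarrow> dirichlet_char q \<eta> \<and> dirichlet_char d \<psi> \<and> d dvd q \<and>
     (\<forall>n. coprime n q \<longrightarrow> \<eta> n = \<psi> n)"

definition primitive_char :: "nat \<Rightarrow> (nat \<Rightarrow> complex) \<Rightarrow> bool" where
  "primitive_char q \<eta> \<longleftrightarrow> dirichlet_char q \<eta> \<and> (\<forall>d \<psi>. induced_by q \<eta> d \<psi> \<longrightarrow> d = q)"

lemma primitive_char_trivial: "primitive_char 1 (\<lambda>_. 1)"
  by (simp add: primitive_char_def induced_by_def dirichlet_char_def)

text \<open>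
  The set $\Xi_q$.  A primitive character, viewed as a function on the naturals, determines its
  conductor, so a set of primitive characters is represented by a set of functions.
\<close>

definition induced_chars :: "(nat \<Rightarrow> complex) set \<Rightarrow> nat \<Rightarrow> (nat \<Rightarrow> complex) set" where
  "induced_chars \<Xi> q = {\<eta>. \<exists>\<psi>\<in>\<Xi>. \<exists>d. primitive_char d \<psi> \<and> induced_by q \<eta> d \<psi>}"

definition char_sum :: "(nat \<Rightarrow> complex) \<Rightarrow> real \<Rightarrow> (nat \<Rightarrow> complex) \<Rightarrow> complex" where
  "char_sum h X \<eta> = (\<Sum>n | 1 \<le> n \<and> real n \<le> X. h n * cnj (\<eta> n))"

definition Delta ::
  "(nat \<Rightarrow> complex) set \<Rightarrow> (nat \<Rightarrow> complex) \<Rightarrow> real \<Rightarrow> nat \<Rightarrow> nat \<Rightarrow> complex" where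
  "Delta \<Xi> h X q a =
     (\<Sum>n | 1 \<le> n \<and> real n \<le> X \<and> [n = a] (mod q). h n) -
     1 / of_nat (totient q) * (\<Sum>\<eta>\<in>induced_chars \<Xi> q. \<eta> a * char_sum h X \<eta>)"

text \<open>
  The sum over $q \le Q$ of the maximum of $|\Delta_\Xi(h,X;q,a)|$ over $(a,q)=1$.  The quantity
  depends only on \<open>a\<close> mod \<open>q\<close>, so \<open>a\<close> ranges over the representatives in \<^term>\<open>totatives q\<close>.
\<close>

definition sum_max_Delta ::
  "(nat \<Rightarrow> complex) set \<Rightarrow> (nat \<Rightarrow> complex) \<Rightarrow> real \<Rightarrow> real \<Rightarrow> real" where
  "sum_max_Delta \<Xi> h X Q =
     (\<Sum>q | 1 \<le> q \<and> real q \<le> Q. Max ((\<lambda>a. norm (Delta \<Xi> h X q a)) ` totatives q))"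

definition on_primes :: "(nat \<Rightarrow> complex) \<Rightarrow> nat \<Rightarrow> complex" where
  "on_primes f n = (if prime n then f n else 0)"

end

theory Submission
  imports Defs "HOL-Real_Asymp.Real_Asymp"
begin

text \<open>
  Since $FG = 1$, the function $\Lambda_f(n) / \log n$, which agrees with $f$ on the primes, equals
  $\sum_{mk = n} g(m) f(k) \log k / \log n$. The terms with $m$ or $k$ at most $V = (\log x)^{5A+9}$
  are estimated by hypothesis (ii) after partial summation, a trivial bound being sufficient on the
  initial segment where (ii) says nothing. In the terms with $m, k > V$ the discrepancy is a sum over
  the characters mod $q$ outside $\Xi_q$, each induced by a primitive character of conductor $r$.
  For $r \le (\log x)^{A+4}$ hypothesis (i) gives cancellation in the longer of the two variables;
  coprimality to $q$ is imposed on it through the identity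
  $f 1_{(\cdot, s) = 1} = f * (g 1_{\cdot \mid s^\infty})$. For larger $r$ the large sieve applies,
  after the variables $m$ and $k$ have been separated at the cost of one logarithm. Finally
  $g(p) = -f(p)$, so the statement for $g$ is the one for $f$.
\<close>

section \<open>Dirichlet characters\<close>


text \<open>Write y for log x. The cutoff V = y^(5A+9) has to be so small that V times the trivial
  bound y^(C+1) x / y^(6A+C+10) stays below x / y^A, which is an exact fit, and so large that x /
  sqrt V survives the losses of the large sieve. These are one factor y each for the separation of
  variables, the dyadic splitting of \<open>m\<close>, the dyadic splitting of the conductor and the
  sum of 1/\<phi> over the cofactor of the conductor, y^4 in all; this dictates R = y^(A+4). A
  modulus has at most R^2 characters of conductor at most R, and passing from residue classes to a
  character costs another R; with the logarithms this makes y^(3A+15), which (i) repays. The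
  \<epsilon> in (ii) pays for the harmonic sum over m \<le> V, of size log log x. The maximum over
  \<open>a\<close> is harmless when one variable is short, since multiplication by a unit permutes
  the residue classes; in the bilinear part it disappears in the triangle inequality over
  characters.\<close>

definition chars :: "nat \<Rightarrow> (nat \<Rightarrow> complex) set" where
  "chars q = {\<eta>. dirichlet_char q \<eta>}"

lemma dirichlet_char_cong:
  assumes "dirichlet_char q \<eta>" "[m = n] (mod q)"
  shows "\<eta> m = \<eta> n"
proof -
  have "\<eta> (m mod q) = \<eta> m" "\<eta> (n mod q) = \<eta> n" using assms(1) by (auto simp: dirichlet_char_def)
  thus ?thesis using assms(2) by (simp add: cong_def)
qed

lemma dirichlet_char_mult: "dirichlet_char q \<eta> \<Longrightarrow> \<eta> (m * n) = \<eta> m * \<eta> n"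
  by (simp add: dirichlet_char_def)

lemma dirichlet_char_eq_0_iff: "dirichlet_char q \<eta> \<Longrightarrow> \<eta> n = 0 \<longleftrightarrow> \<not> coprime n q"
  by (auto simp: dirichlet_char_def)

lemma dirichlet_char_pos: "dirichlet_char q \<eta> \<Longrightarrow> q > 0"
  by (simp add: dirichlet_char_def)

lemma dirichlet_char_one:
  assumes "dirichlet_char q \<eta>"
  shows "\<eta> (Suc 0) = 1"
proof -
  have "\<eta> 1 = \<eta> 1 * \<eta> 1" using dirichlet_char_mult[OF assms, of 1 1] by simp
  moreover have "\<eta> 1 \<noteq> 0" using dirichlet_char_eq_0_iff[OF assms, of 1] by simp
  ultimately show ?thesis by simp
qed

lemma dirichlet_char_power: "dirichlet_char q \<eta> \<Longrightarrow> \<eta> (n ^ k) = \<eta> n ^ k"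
  by (induction k) (auto simp: dirichlet_char_one dirichlet_char_mult)

lemma dirichlet_char_power_totient:
  assumes "dirichlet_char q \<eta>" "coprime n q"
  shows "\<eta> n ^ totient q = 1"
proof -
  have "[n ^ totient q = 1] (mod q)" using assms(2) by (rule euler_theorem)
  hence "\<eta> (n ^ totient q) = \<eta> 1" by (rule dirichlet_char_cong[OF assms(1)])
  thus ?thesis using assms(1) by (simp add: dirichlet_char_power dirichlet_char_one)
qed

lemma norm_dirichlet_char:
  assumes "dirichlet_char q \<eta>" "coprime n q"
  shows "norm (\<eta> n) = 1"
proof -
  have "norm (\<eta> n) ^ totient q = 1"
    using dirichlet_char_power_totient[OF assms] by (metis norm_one norm_power)
  moreover have "totient q > 0" using dirichlet_char_pos[OF assms(1)] by simp
  ultimately show ?thesis using power_eq_1_iff[of "norm (\<eta> n)" "totient q"] by simp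
qed

lemma norm_dirichlet_char_le_1: "dirichlet_char q \<eta> \<Longrightarrow> norm (\<eta> n) \<le> 1"
  using norm_dirichlet_char[of q \<eta> n] dirichlet_char_eq_0_iff[of q \<eta> n] by (cases "coprime n q") auto

lemma dirichlet_char_mult_cnj:
  "dirichlet_char q \<eta> \<Longrightarrow> \<eta> n * cnj (\<eta> n) = (if coprime n q then 1 else 0)"
  using norm_dirichlet_char[of q \<eta> n] dirichlet_char_eq_0_iff[of q \<eta> n]
  by (auto simp: complex_norm_square[symmetric])

lemma dirichlet_char_times:
  "dirichlet_char q \<eta> \<Longrightarrow> dirichlet_char q \<psi> \<Longrightarrow> dirichlet_char q (\<lambda>n. \<eta> n * \<psi> n)"
  by (auto simp: dirichlet_char_def)

lemma dirichlet_char_cnj: "dirichlet_char q \<eta> \<Longrightarrow> dirichlet_char q (\<lambda>n. cnj (\<eta> n))"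
  by (auto simp: dirichlet_char_def)

definition principal_char :: "nat \<Rightarrow> nat \<Rightarrow> complex" where
  "principal_char q n = (if coprime n q then 1 else 0)"

lemma dirichlet_char_principal: "q > 0 \<Longrightarrow> dirichlet_char q (principal_char q)"
  by (auto simp: dirichlet_char_def principal_char_def)

text \<open>A character is determined by its values on the residues below \<open>q\<close>, and each
  of them is 0 or a root of unity of order dividing \<open>totient q\<close>.\<close>

lemma finite_chars: "finite (chars q)"
proof (cases "q = 0")
  case True
  thus ?thesis by (simp add: chars_def dirichlet_char_def)
next
  case False
  let ?Z = "insert 0 {z::complex. z ^ totient q = 1}"
  have "1 \<le> totient q" using False by (simp add: Suc_le_eq)
  hence fin: "finite ?Z" using finite_roots_unity[of "totient q", where 'a = complex] by simp
  have "inj_on (\<lambda>\<eta>. restrict \<eta> {..<q}) (chars q)"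
  proof (rule inj_onI, rule ext)
    fix \<eta> \<psi> n
    assume "\<eta> \<in> chars q" "\<psi> \<in> chars q" and eq: "restrict \<eta> {..<q} = restrict \<psi> {..<q}"
    hence "\<eta> n = \<eta> (n mod q)" "\<psi> n = \<psi> (n mod q)" by (auto simp: chars_def dirichlet_char_def)
    moreover have "n mod q < q" using False by simp
    ultimately show "\<eta> n = \<psi> n" using eq by (metis lessThan_iff restrict_apply')
  qed
  moreover have "(\<lambda>\<eta>. restrict \<eta> {..<q}) ` chars q \<subseteq> {..<q} \<rightarrow>\<^sub>E ?Z"
    unfolding image_subset_iff PiE_iff using dirichlet_char_eq_0_iff dirichlet_char_power_totient
    by (auto simp: chars_def)
  moreover have "finite ({..<q} \<rightarrow>\<^sub>E ?Z)" using fin by (intro finite_PiE) auto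
  ultimately show ?thesis by (meson finite_subset inj_on_finite)
qed

text \<open>
  Characters of the units mod \<open>q\<close> are obtained by extending partial ones. Domains are sets of naturals
  saturated under congruence, which avoids the quotient group; as the unit group is finite, a
  submonoid is automatically closed under inverses.
\<close>

definition partial_char :: "nat \<Rightarrow> nat set \<Rightarrow> (nat \<Rightarrow> complex) \<Rightarrow> bool" where
  "partial_char q H \<eta> \<longleftrightarrow> 1 \<in> H \<and> (\<forall>n\<in>H. coprime n q) \<and> (\<forall>m\<in>H. \<forall>n\<in>H. m * n \<in> H) \<and>
     (\<forall>m n. [m = n] (mod q) \<longrightarrow> m \<in> H \<longrightarrow> n \<in> H \<and> \<eta> m = \<eta> n) \<and>
     \<eta> 1 = 1 \<and> (\<forall>m\<in>H. \<forall>n\<in>H. \<eta> (m * n) = \<eta> m * \<eta> n)"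

lemma partial_char_power:
  assumes "partial_char q H \<eta>" "n \<in> H"
  shows "n ^ k \<in> H \<and> \<eta> (n ^ k) = \<eta> n ^ k"
  using assms by (induction k) (auto simp: partial_char_def)

lemma partial_char_nonzero:
  assumes "partial_char q H \<eta>" "n \<in> H" "q > 0"
  shows "\<eta> n \<noteq> 0"
proof
  assume 0: "\<eta> n = 0"
  have cop: "coprime n q" using assms by (auto simp: partial_char_def)
  have "[n ^ totient q = 1] (mod q)" using cop by (rule euler_theorem)
  hence "\<eta> (n ^ totient q) = \<eta> 1"
    using assms(1) partial_char_power[OF assms(1,2), of "totient q"] unfolding partial_char_def by metis
  hence "\<eta> n ^ totient q = 1"
    using partial_char_power[OF assms(1,2), of "totient q"] assms(1) by (simp add: partial_char_def)
  thus False using 0 assms(3) by (simp add: power_0_left)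
qed

text \<open>The power of \<open>u\<close> with exponent \<open>totient q - 1\<close> lies in
  \<open>H\<close> and inverts \<open>u\<close> mod \<open>q\<close>, so \<open>v\<close> is
  congruent to a product of elements of \<open>H\<close>.\<close>

lemma partial_char_cancel:
  assumes "partial_char q H \<eta>" "u \<in> H" "u * v \<in> H" "coprime v q" "q > 0"
  shows "v \<in> H \<and> \<eta> (u * v) = \<eta> u * \<eta> v"
proof -
  have cop: "coprime u q" using assms by (auto simp: partial_char_def)
  have "totient q > 0" using assms by simp
  then obtain t where t: "totient q = Suc t" by (cases "totient q") auto
  have "u ^ t * (u * v) \<in> H"
    using partial_char_power[OF assms(1,2), of t] assms by (auto simp: partial_char_def)
  moreover have "[u ^ t * (u * v) = v] (mod q)"
    using cong_mult[OF euler_theorem[OF cop] cong_refl[of v]] t by (simp add: mult_ac)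
  ultimately have "v \<in> H" using assms(1) unfolding partial_char_def by blast
  thus ?thesis using assms by (auto simp: partial_char_def)
qed

text \<open>Adjoining \<open>x\<close> to \<open>H\<close> gives the units \<open>y\<close> some
  multiple \<open>y * x ^ j\<close> of which lies in \<open>H\<close>, and the value at
  \<open>y\<close> is then forced to be \<open>\<eta> (y * x ^ j) / z ^ j\<close>. As
  \<open>k\<close> is the order of \<open>x\<close> modulo \<open>H\<close>, the only constraint on
  the prescribed value \<open>z\<close> at \<open>x\<close> is the one assumed. The freedom in
  \<open>z\<close> is used to separate points.\<close>

lemma partial_char_extend:
  assumes pc: "partial_char q H \<eta>" and q: "q > 0" and x: "coprime x q"
    and k: "k > 0" "x ^ k \<in> H" "\<And>j. 0 < j \<Longrightarrow> j < k \<Longrightarrow> x ^ j \<notin> H"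
    and z: "z ^ k = \<eta> (x ^ k)"
  obtains H' \<eta>' where "partial_char q H' \<eta>'" "H \<subseteq> H'" "x \<in> H'" "\<eta>' x = z"
    "\<And>n. n \<in> H \<Longrightarrow> \<eta>' n = \<eta> n"
proof -
  have z0: "z \<noteq> 0" using z k partial_char_nonzero[OF pc k(2) q] by (metis power_0_left less_numeral_extra(3))
  \<comment> \<open>If \<open>x ^ j\<close> lies in \<open>H\<close> then so does
    \<open>x ^ (j mod k)\<close>, by cancellation; minimality of \<open>k\<close> makes the
    remainder 0.\<close>
  have powH: "\<eta> (x ^ j) = z ^ j" if "x ^ j \<in> H" for j
  proof -
    have jk: "x ^ j = (x ^ k) ^ (j div k) * x ^ (j mod k)"
      by (simp flip: power_mult power_add)
    have "x ^ (j mod k) \<in> H \<and> \<eta> (x ^ j) = \<eta> ((x ^ k) ^ (j div k)) * \<eta> (x ^ (j mod k))"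
      using partial_char_cancel[OF pc, of "(x ^ k) ^ (j div k)" "x ^ (j mod k)"]
        partial_char_power[OF pc k(2)] that x q by (simp flip: jk)
    moreover from this have "j mod k = 0" using k by (metis gr0I mod_less_divisor)
    ultimately have "\<eta> (x ^ j) = (z ^ k) ^ (j div k)"
      using partial_char_power[OF pc k(2)] z pc by (simp add: partial_char_def)
    also have "\<dots> = z ^ j" using \<open>j mod k = 0\<close> by (metis dvd_mult_div_cancel mod_0_imp_dvd power_mult)
    finally show ?thesis .
  qed
  define P where "P = (\<lambda>y w. coprime y q \<and> (\<exists>j. y * x ^ j \<in> H \<and> w = \<eta> (y * x ^ j) / z ^ j))"
  \<comment> \<open>Independence of the exponent: for two admissible exponents the power
    \<open>x ^ (j - i)\<close> lies in \<open>H\<close> by cancellation, and \<open>powH\<close>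
    evaluates it.\<close>
  have uniq_le: "\<eta> (y * x ^ i) / z ^ i = \<eta> (y * x ^ j) / z ^ j"
    if "i \<le> j" "y * x ^ i \<in> H" "y * x ^ j \<in> H" for y i j
  proof -
    have e: "y * x ^ j = (y * x ^ i) * x ^ (j - i)" using that by (simp flip: power_add)
    have "x ^ (j - i) \<in> H \<and> \<eta> (y * x ^ j) = \<eta> (y * x ^ i) * \<eta> (x ^ (j - i))"
      using partial_char_cancel[OF pc that(2), of "x ^ (j - i)"] that x q by (simp flip: e)
    hence "\<eta> (y * x ^ j) = \<eta> (y * x ^ i) * z ^ (j - i)" using powH by simp
    moreover have "z ^ j = z ^ i * z ^ (j - i)" using that by (simp flip: power_add)
    ultimately show ?thesis using z0 by simp
  qed
  have uniq: "w = w'" if "P y w" "P y w'" for y w w'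
    using that uniq_le unfolding P_def by (metis nat_le_linear)
  define H' where "H' = {y. \<exists>w. P y w}"
  define \<eta>' where "\<eta>' = (\<lambda>y. THE w. P y w)"
  have chi': "\<eta>' y = w" if "P y w" for y w
    unfolding \<eta>'_def using that uniq by blast
  have PH: "P n (\<eta> n)" if "n \<in> H" for n
    using that pc unfolding P_def by (auto simp: partial_char_def intro!: exI[of _ 0])
  have Pmult: "P (m * n) (v * w)" if "P m v" "P n w" for m n v w
  proof -
    from that obtain i j where ij: "coprime m q" "coprime n q" "m * x ^ i \<in> H" "n * x ^ j \<in> H"
      "v = \<eta> (m * x ^ i) / z ^ i" "w = \<eta> (n * x ^ j) / z ^ j" unfolding P_def by blast
    have e: "m * n * x ^ (i + j) = (m * x ^ i) * (n * x ^ j)" by (simp add: power_add mult_ac)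
    have "m * n * x ^ (i + j) \<in> H \<and> \<eta> (m * n * x ^ (i + j)) = \<eta> (m * x ^ i) * \<eta> (n * x ^ j)"
      unfolding e using pc ij by (auto simp: partial_char_def)
    thus ?thesis unfolding P_def using ij by (auto simp: power_add intro!: exI[of _ "i + j"])
  qed
  have Pcong: "P n v" if "P m v" "[m = n] (mod q)" for m n v
  proof -
    from that obtain i where i: "coprime m q" "m * x ^ i \<in> H" "v = \<eta> (m * x ^ i) / z ^ i"
      unfolding P_def by blast
    have "[m * x ^ i = n * x ^ i] (mod q)" using that by (intro cong_mult) auto
    hence "n * x ^ i \<in> H \<and> \<eta> (m * x ^ i) = \<eta> (n * x ^ i)"
      using pc i unfolding partial_char_def by blast
    moreover have "coprime n q" using i that by (metis cong_imp_coprime)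
    ultimately show ?thesis unfolding P_def using i by auto
  qed
  have Px: "P x z"
  proof -
    obtain t where t: "k = Suc t" using k by (cases k) auto
    have "x * x ^ t \<in> H" "z = \<eta> (x * x ^ t) / z ^ t" using k z z0 t by (auto simp: field_simps)
    thus ?thesis unfolding P_def using x by blast
  qed
  show thesis
  proof
    show "partial_char q H' \<eta>'"
      unfolding partial_char_def
    proof (intro conjI ballI allI impI)
      show "1 \<in> H'" using PH[of 1] pc by (auto simp: H'_def partial_char_def)
      show "\<eta>' 1 = 1" using chi'[OF PH[of 1]] pc by (auto simp: partial_char_def)
    next
      fix n assume "n \<in> H'" thus "coprime n q" by (auto simp: H'_def P_def)
    next
      fix m n assume "m \<in> H'" "n \<in> H'"
      then obtain v w where "P m v" "P n w" by (auto simp: H'_def)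
      hence "P (m * n) (v * w)" "\<eta>' m = v" "\<eta>' n = w" using Pmult chi' by auto
      thus "m * n \<in> H'" "\<eta>' (m * n) = \<eta>' m * \<eta>' n" using chi' unfolding H'_def by blast+
    next
      fix m n assume "[m = n] (mod q)" "m \<in> H'"
      then obtain v where "P m v" "P n v" using Pcong by (auto simp: H'_def)
      thus "n \<in> H'" "\<eta>' m = \<eta>' n" using chi' unfolding H'_def by (blast, metis)
    qed
    show "H \<subseteq> H'" "x \<in> H'" using PH Px unfolding H'_def by blast+
    show "\<eta>' x = z" by (rule chi'[OF Px])
    show "\<eta>' n = \<eta> n" if "n \<in> H" for n by (rule chi'[OF PH[OF that]])
  qed
qed

text \<open>Induction on the number of units still outside the domain. The extension never gets
  stuck because every complex number has a \<open>k\<close>-th root. Once the domain consists of all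
  units, setting the function to 0 elsewhere yields a character.\<close>

lemma partial_char_total_extend:
  assumes "partial_char q H \<eta>" "q > 0"
  shows "\<exists>\<eta>'. dirichlet_char q \<eta>' \<and> (\<forall>n\<in>H. \<eta>' n = \<eta> n)"
  using assms
proof (induction "card ({n. n < q \<and> coprime n q} - H)" arbitrary: H \<eta> rule: less_induct)
  case less
  note pc = less.prems(1) and q = less.prems(2)
  show ?case
  proof (cases "\<exists>x. coprime x q \<and> x \<notin> H")
    case False
    hence H: "H = {x. coprime x q}" using pc by (auto simp: partial_char_def)
    define \<eta>' where "\<eta>' = (\<lambda>n. if coprime n q then \<eta> n else 0)"
    have "\<eta>' (n mod q) = \<eta>' n" for n
    proof (cases "coprime n q")
      case True
      have "[n = n mod q] (mod q)" by (simp add: cong_def)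
      moreover have "coprime (n mod q) q" using True q by simp
      ultimately have "\<eta> n = \<eta> (n mod q)" using True pc H unfolding partial_char_def by blast
      thus ?thesis using True q by (simp add: \<eta>'_def)
    qed (use q in \<open>auto simp: \<eta>'_def\<close>)
    moreover have "\<eta>' (m * n) = \<eta>' m * \<eta>' n" for m n
      using pc by (auto simp: \<eta>'_def partial_char_def H)
    moreover have "\<eta>' n \<noteq> 0 \<longleftrightarrow> coprime n q" for n
      using partial_char_nonzero[OF pc _ q] by (auto simp: \<eta>'_def H)
    ultimately have "dirichlet_char q \<eta>'" using q by (auto simp: dirichlet_char_def)
    thus ?thesis by (intro exI[of _ \<eta>']) (auto simp: \<eta>'_def H)
  next
    case True
    then obtain x where x: "coprime x q" "x \<notin> H" by blast
    have 1: "1 \<in> H" and c: "\<And>m n. [m = n] (mod q) \<Longrightarrow> m \<in> H \<Longrightarrow> n \<in> H"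
      using pc by (auto simp: partial_char_def)
    define k where "k = (LEAST k. 0 < k \<and> x ^ k \<in> H)"
    have "0 < totient q \<and> x ^ totient q \<in> H"
      using q 1 c[OF cong_sym[OF euler_theorem[OF x(1)]]] by simp
    hence k: "0 < k \<and> x ^ k \<in> H" unfolding k_def by (rule LeastI)
    have kmin: "x ^ j \<notin> H" if "0 < j" "j < k" for j using not_less_Least[of j] that unfolding k_def by blast
    define z where "z = (if \<eta> (x ^ k) = 0 then 0 else exp (Ln (\<eta> (x ^ k)) / of_nat k))"
    have "z ^ k = \<eta> (x ^ k)"
      using k by (auto simp: z_def exp_of_nat_mult[symmetric] power_0_left)
    from partial_char_extend[OF pc q x(1) _ _ kmin this] k obtain H' \<eta>' where H':
      "partial_char q H' \<eta>'" "H \<subseteq> H'" "x \<in> H'" "\<And>n. n \<in> H \<Longrightarrow> \<eta>' n = \<eta> n" by blast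
    have "{n. n < q \<and> coprime n q} - H' \<subset> {n. n < q \<and> coprime n q} - H"
    proof -
      have "[x = x mod q] (mod q)" by (simp add: cong_def)
      hence "x mod q \<notin> H" "x mod q \<in> H'"
        using x(2) c[of "x mod q" x] H' unfolding partial_char_def by (auto simp: cong_def)
      moreover have "x mod q < q" "coprime (x mod q) q" using q x by auto
      ultimately show ?thesis using H'(2) by blast
    qed
    hence "card ({n. n < q \<and> coprime n q} - H') < card ({n. n < q \<and> coprime n q} - H)"
      by (intro psubset_card_mono) auto
    from less.hyps[OF this H'(1) q] obtain \<eta>'' where
      "dirichlet_char q \<eta>''" "\<forall>n\<in>H'. \<eta>'' n = \<eta>' n" by blast
    thus ?thesis using H' by (intro exI[of _ \<eta>'']) (auto simp: subset_iff)
  qed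
qed

text \<open>Begin with the trivial character on the class of 1 and adjoin \<open>n\<close>, whose
  order \<open>k\<close> mod \<open>q\<close> exceeds 1; a primitive \<open>k\<close>-th root of
  unity may be prescribed as its value.\<close>

lemma dirichlet_char_separates:
  assumes "q > 0" "coprime n q" "\<not> [n = 1] (mod q)"
  obtains \<eta> where "dirichlet_char q \<eta>" "\<eta> n \<noteq> 1"
proof -
  define H where "H = {m. [m = 1] (mod q)}"
  have H: "partial_char q H (\<lambda>_. 1)"
    unfolding partial_char_def H_def
    using cong_mult[of _ 1 q _ 1] cong_imp_coprime[of 1 _ q] by (auto intro: cong_sym cong_trans)
  define k where "k = (LEAST k. 0 < k \<and> n ^ k \<in> H)"
  have "0 < totient q \<and> n ^ totient q \<in> H" using assms euler_theorem[of n q] by (simp add: H_def)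
  hence k: "0 < k \<and> n ^ k \<in> H" unfolding k_def by (rule LeastI)
  have kmin: "n ^ j \<notin> H" if "0 < j" "j < k" for j using not_less_Least[of j] that unfolding k_def by blast
  have "k \<noteq> 1" using k assms by (auto simp: H_def)
  define z where "z = cis (2 * pi / real k)"
  have zk: "z ^ k = 1" using k by (simp add: z_def Complex.DeMoivre)
  have "z \<noteq> 1"
  proof
    assume "z = 1"
    hence "cos (2 * pi / real k) = 1" by (simp add: z_def complex_eq_iff)
    then obtain i :: int where "2 * pi / real k = of_int i * 2 * pi" by (auto simp: cos_one_2pi_int)
    hence "1 = real_of_int i * real k" using k by (simp add: field_simps)
    hence "1 = i * int k" by (metis of_int_1 of_int_eq_iff of_int_mult of_int_of_nat_eq)
    hence "int k dvd 1" by (metis dvd_triv_right)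
    thus False using \<open>k \<noteq> 1\<close> by simp
  qed
  from partial_char_extend[OF H assms(1,2) _ _ kmin, where z = z] k zk
  obtain H' \<eta>' where H': "partial_char q H' \<eta>'" "n \<in> H'" "\<eta>' n = z" by blast
  from partial_char_total_extend[OF H'(1) assms(1)] H' \<open>z \<noteq> 1\<close> that show thesis by metis
qed

section \<open>Orthogonality relations for characters\<close>

lemma bij_betw_mult_coprime_residues:
  fixes q c :: nat
  assumes "q > 0" "coprime c q"
  shows "bij_betw (\<lambda>a. (c * a) mod q) {..<q} {..<q}"
proof -
  have "inj_on (\<lambda>a. (c * a) mod q) {..<q}"
  proof (rule inj_onI)
    fix a b assume "a \<in> {..<q}" "b \<in> {..<q}" "(c * a) mod q = (c * b) mod q"
    hence "[c * a = c * b] (mod q)" by (simp add: cong_def)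
    hence "[a = b] (mod q)" using assms cong_mult_lcancel_nat by blast
    thus "a = b" using \<open>a \<in> _\<close> \<open>b \<in> _\<close> by (simp add: cong_def)
  qed
  moreover have "(\<lambda>a. (c * a) mod q) ` {..<q} \<subseteq> {..<q}" using assms by auto
  ultimately show ?thesis by (simp add: bij_betw_def endo_inj_surj)
qed

lemma sum_mult_residues:
  fixes h :: "nat \<Rightarrow> 'b :: comm_monoid_add"
  assumes "q > 0" "coprime c q" "\<And>n. h (n mod q) = h n"
  shows "(\<Sum>a<q. h (c * a)) = (\<Sum>a<q. h a)"
  using sum.reindex_bij_betw[OF bij_betw_mult_coprime_residues[OF assms(1,2)], of h] assms(3) by simp

text \<open>Multiplication by a character \<open>\<psi>\<close> with
  \<open>\<psi> n \<noteq> 1\<close> permutes the characters mod \<open>q\<close>, so the sum equals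
  \<open>\<psi> n\<close> times itself. The number of characters is not yet known here and enters as
  a cardinality.\<close>

lemma sum_chars_at:
  assumes "q > 0"
  shows "(\<Sum>\<eta>\<in>chars q. \<eta> n) = (if [n = 1] (mod q) then of_nat (card (chars q)) else 0)"
proof -
  consider "[n = 1] (mod q)" | "\<not> coprime n q" "\<not> [n = 1] (mod q)" | "coprime n q" "\<not> [n = 1] (mod q)" by blast
  thus ?thesis
  proof cases
    case 1
    hence "(\<Sum>\<eta>\<in>chars q. \<eta> n) = (\<Sum>\<eta>\<in>chars q. 1)"
      using dirichlet_char_cong[OF _ 1] by (intro sum.cong) (auto simp: chars_def dirichlet_char_one)
    thus ?thesis using 1 by simp
  next
    case 2
    hence "(\<Sum>\<eta>\<in>chars q. \<eta> n) = 0"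
      by (intro sum.neutral) (auto simp: chars_def dirichlet_char_eq_0_iff)
    thus ?thesis using 2 by simp
  next
    case 3
    obtain \<psi> where \<psi>: "dirichlet_char q \<psi>" "\<psi> n \<noteq> 1" using dirichlet_char_separates[OF assms 3] by blast
    \<comment> \<open>Multiplication by the conjugate of \<open>\<psi>\<close> undoes multiplication
      by \<open>\<psi>\<close>: off the units, where \<open>\<psi>\<close> vanishes,
      \<open>\<eta>\<close> vanishes as well.\<close>
    have inj: "\<eta> = (\<lambda>n. cnj (\<psi> n) * (\<psi> n * \<eta> n))" if "\<eta> \<in> chars q" for \<eta>
    proof
      fix m show "\<eta> m = cnj (\<psi> m) * (\<psi> m * \<eta> m)"
        using dirichlet_char_mult_cnj[OF \<psi>(1), of m] that
        by (auto simp: chars_def dirichlet_char_eq_0_iff mult_ac split: if_splits)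
    qed
    have inj': "\<eta> = (\<lambda>n. \<psi> n * (cnj (\<psi> n) * \<eta> n))" if "\<eta> \<in> chars q" for \<eta>
      using inj[OF that] by (simp add: mult.left_commute)
    have "bij_betw (\<lambda>\<eta> n. \<psi> n * \<eta> n) (chars q) (chars q)"
    proof (rule bij_betwI[where g = "\<lambda>\<eta> n. cnj (\<psi> n) * \<eta> n"])
      show "(\<lambda>\<eta> n. \<psi> n * \<eta> n) \<in> chars q \<rightarrow> chars q"
        using \<psi> by (auto simp: chars_def intro: dirichlet_char_times)
      show "(\<lambda>\<eta> n. cnj (\<psi> n) * \<eta> n) \<in> chars q \<rightarrow> chars q"
        using \<psi> by (auto simp: chars_def intro: dirichlet_char_times dirichlet_char_cnj)
      show "(\<lambda>n. cnj (\<psi> n) * (\<psi> n * \<eta> n)) = \<eta>" if "\<eta> \<in> chars q" for \<eta>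
        by (rule inj[OF that, symmetric])
      show "(\<lambda>n. \<psi> n * (cnj (\<psi> n) * \<eta> n)) = \<eta>" if "\<eta> \<in> chars q" for \<eta>
        by (rule inj'[OF that, symmetric])
    qed
    from sum.reindex_bij_betw[OF this, of "\<lambda>\<eta>. \<eta> n"]
    have "\<psi> n * (\<Sum>\<eta>\<in>chars q. \<eta> n) = (\<Sum>\<eta>\<in>chars q. \<eta> n)" by (simp add: sum_distrib_left)
    hence "(\<psi> n - 1) * (\<Sum>\<eta>\<in>chars q. \<eta> n) = 0" by (simp add: algebra_simps)
    thus ?thesis using \<psi> 3 by simp
  qed
qed

lemma sum_residues_dirichlet_char:
  assumes "dirichlet_char q \<eta>"
  shows "(\<Sum>a<q. \<eta> a) = (if \<eta> = principal_char q then of_nat (totient q) else 0)"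
proof (cases "\<eta> = principal_char q")
  case True
  have q: "q > 0" using assms by (rule dirichlet_char_pos)
  have "(\<Sum>a<q. principal_char q a) = of_nat (card {a\<in>{..<q}. coprime a q})"
    by (simp add: principal_char_def sum.If_cases Int_def)
  also have "card {a\<in>{..<q}. coprime a q} = totient q"
  proof (cases "q = 1")
    case False
    have "a < q \<and> coprime a q \<longleftrightarrow> a \<in> totatives q" for a
      using False q by (cases "a = 0"; cases "a = q") (auto simp: totatives_def)
    hence "{a\<in>{..<q}. coprime a q} = totatives q" by auto
    thus ?thesis by (simp add: totient_def)
  qed (auto simp: lessThan_Suc)
  finally show ?thesis using True by simp
next
  case False
  have q: "q > 0" using assms by (rule dirichlet_char_pos)
  then obtain c where c: "coprime c q" "\<eta> c \<noteq> 1"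
    using False assms by (auto simp: principal_char_def fun_eq_iff dirichlet_char_eq_0_iff split: if_splits)
  have "(\<Sum>a<q. \<eta> (c * a)) = (\<Sum>a<q. \<eta> a)"
    using assms q c by (intro sum_mult_residues) (auto simp: dirichlet_char_def)
  hence "(\<eta> c - 1) * (\<Sum>a<q. \<eta> a) = 0"
    using assms by (simp add: dirichlet_char_mult left_diff_distrib flip: sum_distrib_left)
  thus ?thesis using c False by simp
qed

text \<open>Double counting of all values of all characters. Summing over characters first leaves
  the class of 1, summing over residues first leaves the principal character.\<close>

lemma card_chars:
  assumes "q > 0"
  shows "card (chars q) = totient q"
proof -
  \<comment> \<open>The residue is written \<open>1 mod q\<close> because for \<open>q = 1\<close>
    the class of 1 is represented by 0.\<close>
  have "(\<Sum>a<q. \<Sum>\<eta>\<in>chars q. \<eta> a) = (\<Sum>a<q. if a = 1 mod q then of_nat (card (chars q)) else 0)"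
    using assms by (intro sum.cong) (auto simp: sum_chars_at cong_def)
  also have "\<dots> = of_nat (card (chars q))" using assms by (simp add: sum.delta)
  finally have 1: "(\<Sum>a<q. \<Sum>\<eta>\<in>chars q. \<eta> a) = of_nat (card (chars q))" .
  have "(\<Sum>a<q. \<Sum>\<eta>\<in>chars q. \<eta> a) = (\<Sum>\<eta>\<in>chars q. \<Sum>a<q. \<eta> a)" by (rule sum.swap)
  also have "\<dots> = (\<Sum>\<eta>\<in>chars q. if \<eta> = principal_char q then of_nat (totient q) else 0)"
    by (intro sum.cong) (auto simp: chars_def sum_residues_dirichlet_char)
  also have "\<dots> = of_nat (totient q)"
    using dirichlet_char_principal[OF assms] finite_chars[of q] by (simp add: sum.delta' chars_def)
  finally show ?thesis using 1 by (metis of_nat_eq_iff)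
qed

lemma cong_inverse_nat:
  fixes a q :: nat
  assumes "coprime a q" "q > 0"
  obtains b where "coprime b q" "[a * b = 1] (mod q)"
proof -
  have e: "a * a ^ (totient q - 1) = a ^ totient q" using assms by (simp flip: power_Suc)
  have "[a * a ^ (totient q - 1) = 1] (mod q)" unfolding e by (rule euler_theorem[OF assms(1)])
  moreover have "coprime (a ^ (totient q - 1)) q" using assms by simp
  ultimately show thesis using that by blast
qed

lemma chars_orthogonality:
  assumes "q > 0" "coprime a q"
  shows "(\<Sum>\<eta>\<in>chars q. \<eta> a * cnj (\<eta> n)) = (if [n = a] (mod q) then of_nat (totient q) else 0)"
proof -
  obtain b where b: "coprime b q" "[a * b = 1] (mod q)" using cong_inverse_nat[OF assms(2,1)] by blast
  have "\<eta> a * cnj (\<eta> n) = cnj (\<eta> (n * b))" if "\<eta> \<in> chars q" for \<eta>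
  proof -
    have d: "dirichlet_char q \<eta>" using that by (simp add: chars_def)
    have "\<eta> a * \<eta> b = 1" using dirichlet_char_cong[OF d b(2)] d by (simp add: dirichlet_char_mult dirichlet_char_one)
    moreover have "cnj (\<eta> b) * \<eta> b = 1" using dirichlet_char_mult_cnj[OF d, of b] b by (simp add: mult.commute)
    ultimately have "cnj (\<eta> b) = \<eta> a" by (metis mult.assoc mult.commute mult.right_neutral)
    thus ?thesis using d by (simp add: dirichlet_char_mult)
  qed
  hence "(\<Sum>\<eta>\<in>chars q. \<eta> a * cnj (\<eta> n)) = cnj (\<Sum>\<eta>\<in>chars q. \<eta> (n * b))" by simp
  also have "\<dots> = (if [n * b = 1] (mod q) then of_nat (totient q) else 0)"
    using assms by (simp add: sum_chars_at card_chars)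
  also have "[n * b = 1] (mod q) \<longleftrightarrow> [n = a] (mod q)"
  proof -
    have "[n * b = 1] (mod q) \<longleftrightarrow> [n * b = a * b] (mod q)" using b(2) by (metis cong_sym cong_trans)
    also have "\<dots> \<longleftrightarrow> [n = a] (mod q)" using b(1) by (rule cong_mult_rcancel_nat)
    finally show ?thesis .
  qed
  finally show ?thesis .
qed

section \<open>The large sieve\<close>


text \<open>A weak form of the Jordan inequality. Up to \<open>pi / 3\<close> the derivative
  \<open>cos\<close> is at least 1/2; beyond, the sine is at least \<open>sqrt 3 / 2\<close>, which
  exceeds \<open>pi / 4\<close>.\<close>

lemma half_le_sin:
  assumes "0 \<le> x" "x \<le> pi / 2"
  shows "x / 2 \<le> sin x"
proof (cases "x \<le> pi / 3")
  case True
  have "sin 0 - 0 / 2 \<le> sin x - x / 2"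
  proof (rule DERIV_nonneg_imp_nondecreasing[of 0 x "\<lambda>x. sin x - x / 2"])
    fix y assume y: "0 \<le> y" "y \<le> x"
    have "cos (pi / 3) \<le> cos y" using y True by (intro cos_monotone_0_pi_le) auto
    hence "0 \<le> cos y - 1 / 2" by (simp add: cos_60)
    moreover have "((\<lambda>x. sin x - x / 2) has_real_derivative cos y - 1 / 2) (at y)"
      by (auto intro!: derivative_eq_intros)
    ultimately show "\<exists>z. ((\<lambda>x. sin x - x / 2) has_real_derivative z) (at y) \<and> 0 \<le> z" by blast
  qed (use assms in auto)
  thus ?thesis by simp
next
  case False
  have "sin (pi / 3) \<le> sin x" using assms False by (intro sin_monotone_2pi_le) auto
  moreover have "pi / 4 \<le> sqrt 3 / 2"
  proof -
    have "(16/10::real) \<le> sqrt 3" by (rule real_le_rsqrt) (simp add: power2_eq_square)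
    thus ?thesis using pi_less_4 pi_approx by simp
  qed
  ultimately show ?thesis using assms by (simp add: sin_60)
qed

text \<open>The hypothesis makes \<open>d\<close> a lower bound for the distance from
  \<open>\<theta>\<close> to the nearest integer. With \<open>t\<close> the signed distance, the
  norm is 2 sin(pi |t|), at least pi |t| by \<open>half_le_sin\<close>.\<close>

lemma norm_cis_minus_1_ge:
  fixes \<theta> d :: real
  assumes "\<And>k :: int. d \<le> \<bar>\<theta> - of_int k\<bar>"
  shows "2 * d \<le> norm (cis (2 * pi * \<theta>) - 1)"
proof -
  define t where "t = \<theta> - of_int (round \<theta>)"
  have t: "\<bar>t\<bar> \<le> 1 / 2" "d \<le> \<bar>t\<bar>"
    using of_int_round_abs_le[of \<theta>] assms[of "round \<theta>"] by (auto simp: t_def abs_minus_commute)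
  have "cis (2 * pi * \<theta>) = cis (2 * pi * t) * cis (2 * pi * of_int (round \<theta>))"
    unfolding cis_mult t_def by (simp add: algebra_simps)
  also have "cis (2 * pi * of_int (round \<theta>)) = 1"
    by (simp add: complex_eq_iff cos_int_2pin sin_int_2pin)
  finally have "cis (2 * pi * \<theta>) = cis (2 * pi * t)" by simp
  hence "(norm (cis (2 * pi * \<theta>) - 1))\<^sup>2 = (cos (2 * (pi * t)) - 1)\<^sup>2 + (sin (2 * (pi * t)))\<^sup>2"
    by (simp add: cmod_power2 mult.assoc)
  also have "\<dots> = 2 - 2 * cos (2 * (pi * t))"
    using sin_cos_squared_add[of "2 * (pi * t)"] by (simp add: power2_eq_square algebra_simps)
  also have "\<dots> = (2 * sin (pi * \<bar>t\<bar>))\<^sup>2"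
    by (simp add: cos_double_sin power2_eq_square abs_if)
  finally have "norm (cis (2 * pi * \<theta>) - 1) = \<bar>2 * sin (pi * \<bar>t\<bar>)\<bar>"
    by (metis norm_ge_zero real_sqrt_abs real_sqrt_unique)
  moreover have "pi * \<bar>t\<bar> / 2 \<le> sin (pi * \<bar>t\<bar>)" using t by (intro half_le_sin) auto
  moreover have "2 * \<bar>t\<bar> \<le> pi * \<bar>t\<bar>" using pi_gt3 by (intro mult_right_mono) auto
  ultimately show ?thesis using t by simp
qed

lemma norm_sum_cis_le:
  fixes \<theta> d :: real
  assumes "\<And>k :: int. d \<le> \<bar>\<theta> - of_int k\<bar>" "d > 0"
  shows "norm (\<Sum>j<n. cis (2 * pi * (of_nat j * \<theta>))) \<le> 1 / d"
proof -
  define z where "z = cis (2 * pi * \<theta>)"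
  have z: "2 * d \<le> norm (z - 1)" unfolding z_def by (rule norm_cis_minus_1_ge[OF assms(1)])
  hence "z \<noteq> 1" using assms by auto
  have "(\<Sum>j<n. cis (2 * pi * (of_nat j * \<theta>))) = (\<Sum>j<n. z ^ j)"
    unfolding z_def by (intro sum.cong) (auto simp: Complex.DeMoivre mult_ac)
  also have "\<dots> = (z ^ n - 1) / (z - 1)" using \<open>z \<noteq> 1\<close> by (rule geometric_sum)
  finally have "norm (\<Sum>j<n. cis (2 * pi * (of_nat j * \<theta>))) = norm (z ^ n - 1) / norm (z - 1)"
    by (simp add: norm_divide)
  also have "\<dots> \<le> 2 / (2 * d)"
  proof (rule frac_le)
    show "norm (z ^ n - 1) \<le> 2"
      using norm_triangle_ineq4[of "z ^ n" 1] by (simp add: z_def norm_power)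
  qed (use z assms in auto)
  finally show ?thesis by simp
qed

lemma sum_inverse_squares_le: "(\<Sum>b = 1..n. 1 / (real b)\<^sup>2) \<le> 2"
proof -
  have *: "(\<Sum>b = 1..Suc n. 1 / (real b)\<^sup>2) \<le> 2 - 1 / real (Suc n)" for n
  proof (induction n)
    case (Suc n)
    have "1 / (real (Suc (Suc n)))\<^sup>2 \<le> 1 / (real (Suc n) * real (Suc (Suc n)))"
      by (intro divide_left_mono) (auto simp: power2_eq_square)
    also have "\<dots> = 1 / real (Suc n) - 1 / real (Suc (Suc n))" by (simp add: field_simps)
    finally show ?case using Suc by simp
  qed auto
  show ?thesis
  proof (cases n)
    case (Suc m)
    thus ?thesis using *[of m] by (smt (verit) divide_nonneg_nonneg of_nat_0_le_iff)
  qed auto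
qed

definition dirichlet_kernel :: "nat \<Rightarrow> real \<Rightarrow> complex" where
  "dirichlet_kernel n \<theta> = (\<Sum>j<n. cis (2 * pi * (of_nat j * \<theta>)))"

lemma norm_dirichlet_kernel_le: "norm (dirichlet_kernel n \<theta>) \<le> real n"
  unfolding dirichlet_kernel_def by (rule order.trans[OF norm_sum]) simp

text \<open>Distances are taken on the circle R/Z, hence the quantification over all integer
  translates.\<close>

definition separated :: "'i set \<Rightarrow> ('i \<Rightarrow> real) \<Rightarrow> real \<Rightarrow> bool" where
  "separated I x \<delta> \<longleftrightarrow> (\<forall>i\<in>I. \<forall>j\<in>I. i \<noteq> j \<longrightarrow> (\<forall>k::int. \<delta> \<le> \<bar>x i - x j - of_int k\<bar>))"

lemma separatedD: "separated I x \<delta> \<Longrightarrow> i \<in> I \<Longrightarrow> j \<in> I \<Longrightarrow> i \<noteq> j \<Longrightarrow> \<delta> \<le> \<bar>x i - x j - of_int k\<bar>"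
  by (auto simp: separated_def)

text \<open>Let \<open>t j\<close> be the signed distance on the circle from \<open>x j\<close> to
  \<open>x i\<close>, and \<open>b j\<close> the number of whole steps \<delta> in it. Two points
  with the same sign and the same \<open>b\<close> would be closer than \<delta>, so each value of
  \<open>b\<close> occurs at most twice. The kernel is at most 1/(b \<delta>) there, and the sum of
  1/b^2 is at most 2; the diagonal contributes \<open>n\<close> squared.\<close>

lemma sum_kernel_separated_le:
  assumes "finite I" "separated I x \<delta>" "\<delta> > 0" "i \<in> I"
  shows "(\<Sum>j\<in>I. (norm (dirichlet_kernel n (x i - x j)))\<^sup>2) \<le> (real n)\<^sup>2 + 4 / \<delta>\<^sup>2"
proof -
  define t where "t = (\<lambda>j. x i - x j - of_int (round (x i - x j)))"
  define b where "b = (\<lambda>j. nat \<lfloor>\<bar>t j\<bar> / \<delta>\<rfloor>)"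
  let ?J = "I - {i}"
  have t: "\<delta> \<le> \<bar>t j\<bar>" if "j \<in> ?J" for j
    unfolding t_def using that assms by (intro separatedD) auto
  have b1: "1 \<le> b j" "real (b j) * \<delta> \<le> \<bar>t j\<bar>" "\<bar>t j\<bar> < (real (b j) + 1) * \<delta>" if "j \<in> ?J" for j
  proof -
    have "1 \<le> \<bar>t j\<bar> / \<delta>" using t[OF that] assms(3) by simp
    hence "1 \<le> \<lfloor>\<bar>t j\<bar> / \<delta>\<rfloor>" by simp
    thus "1 \<le> b j" unfolding b_def by linarith
    have e: "real (b j) = of_int \<lfloor>\<bar>t j\<bar> / \<delta>\<rfloor>" using \<open>1 \<le> \<lfloor>_\<rfloor>\<close> by (simp add: b_def)
    have "real (b j) \<le> \<bar>t j\<bar> / \<delta>" "\<bar>t j\<bar> / \<delta> < real (b j) + 1" unfolding e by linarith+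
    thus "real (b j) * \<delta> \<le> \<bar>t j\<bar>" "\<bar>t j\<bar> < (real (b j) + 1) * \<delta>"
      using assms(3) by (simp_all add: field_simps)
  qed
  have inj: "inj_on (\<lambda>j. (t j > 0, b j)) ?J"
  proof (rule inj_onI, rule ccontr)
    fix j j' assume j: "j \<in> ?J" "j' \<in> ?J" "(t j > 0, b j) = (t j' > 0, b j')" "j \<noteq> j'"
    have "\<bar>t j - t j'\<bar> < \<delta>"
      using b1[OF j(1)] b1[OF j(2)] j(3) by (auto simp: abs_if algebra_simps split: if_splits)
    moreover have "t j - t j' = x j' - x j - of_int (round (x i - x j) - round (x i - x j'))"
      by (simp add: t_def)
    moreover have "\<delta> \<le> \<bar>x j' - x j - of_int (round (x i - x j) - round (x i - x j'))\<bar>"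
      using j assms by (intro separatedD[OF assms(2)]) auto
    ultimately show False by simp
  qed
  have fJ: "finite ?J" using assms by simp
  then obtain B where B: "\<And>j. j \<in> ?J \<Longrightarrow> b j \<le> B" by (metis finite_imageI finite_nat_set_iff_bounded_le imageI)
  have "(\<Sum>j\<in>?J. (norm (dirichlet_kernel n (x i - x j)))\<^sup>2) \<le> (\<Sum>j\<in>?J. 1 / \<delta>\<^sup>2 * (1 / (real (b j))\<^sup>2))"
  proof (rule sum_mono)
    fix j assume j: "j \<in> ?J"
    have "\<bar>t j\<bar> \<le> \<bar>x i - x j - of_int k\<bar>" for k :: int
      unfolding t_def using round_diff_minimal[of "x i - x j" k] .
    moreover have "0 < \<bar>t j\<bar>" using t[OF j] assms(3) by linarith
    ultimately have "norm (dirichlet_kernel n (x i - x j)) \<le> 1 / \<bar>t j\<bar>"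
      unfolding dirichlet_kernel_def by (intro norm_sum_cis_le)
    also have "\<dots> \<le> 1 / (real (b j) * \<delta>)"
      using b1[OF j] assms(3) \<open>0 < \<bar>t j\<bar>\<close> by (intro divide_left_mono mult_pos_pos) auto
    finally have "(norm (dirichlet_kernel n (x i - x j)))\<^sup>2 \<le> (1 / (real (b j) * \<delta>))\<^sup>2"
      by (intro power_mono) auto
    thus "(norm (dirichlet_kernel n (x i - x j)))\<^sup>2 \<le> 1 / \<delta>\<^sup>2 * (1 / (real (b j))\<^sup>2)"
      by (simp add: power_mult_distrib power_divide mult.commute)
  qed
  also have "\<dots> = 1 / \<delta>\<^sup>2 * (\<Sum>z\<in>(\<lambda>j. (t j > 0, b j)) ` ?J. 1 / (real (snd z))\<^sup>2)"
    by (simp add: sum_distrib_left sum.reindex[OF inj])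
  also have "\<dots> \<le> 1 / \<delta>\<^sup>2 * (\<Sum>z\<in>(UNIV :: bool set) \<times> {1..B}. 1 / (real (snd z))\<^sup>2)"
  proof (rule mult_left_mono)
    have "(\<lambda>j. (t j > 0, b j)) ` ?J \<subseteq> UNIV \<times> {1..B}" using b1(1) B by force
    thus "(\<Sum>z\<in>(\<lambda>j. (t j > 0, b j)) ` ?J. 1 / (real (snd z))\<^sup>2)
        \<le> (\<Sum>z\<in>(UNIV :: bool set) \<times> {1..B}. 1 / (real (snd z))\<^sup>2)"
      by (intro sum_mono2) auto
  qed auto
  also have "(\<Sum>z\<in>(UNIV :: bool set) \<times> {1..B}. 1 / (real (snd z))\<^sup>2) = 2 * (\<Sum>b = 1..B. 1 / (real b)\<^sup>2)"
    unfolding sum.cartesian_product[symmetric, of "\<lambda>_ b. 1 / (real b)\<^sup>2", unfolded case_prod_beta] by simp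
  also have "1 / \<delta>\<^sup>2 * \<dots> \<le> 1 / \<delta>\<^sup>2 * (2 * 2)"
    using sum_inverse_squares_le[of B] by (intro mult_left_mono) auto
  finally have "(\<Sum>j\<in>?J. (norm (dirichlet_kernel n (x i - x j)))\<^sup>2) \<le> 4 / \<delta>\<^sup>2" by simp
  moreover have "(norm (dirichlet_kernel n (x i - x i)))\<^sup>2 \<le> (real n)\<^sup>2"
    using norm_dirichlet_kernel_le by (intro power_mono) auto
  ultimately show ?thesis unfolding sum.remove[OF assms(1,4)] by linarith
qed

text \<open>Schur's test: the arithmetic-geometric inequality distributes each product over its two
  factors, and by symmetry both halves are controlled by the row sums.\<close>

lemma norm_hermitian_form_le:
  fixes c :: "'i \<Rightarrow> complex" and K :: "'i \<Rightarrow> 'i \<Rightarrow> real"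
  assumes "finite I" "\<And>i j. i \<in> I \<Longrightarrow> j \<in> I \<Longrightarrow> K i j = K j i" "\<And>i j. K i j \<ge> 0"
    "\<And>i. i \<in> I \<Longrightarrow> (\<Sum>j\<in>I. K i j) \<le> M"
  shows "norm (\<Sum>i\<in>I. \<Sum>j\<in>I. c i * cnj (c j) * of_real (K i j)) \<le> M * (\<Sum>i\<in>I. (norm (c i))\<^sup>2)"
proof -
  have "norm (\<Sum>i\<in>I. \<Sum>j\<in>I. c i * cnj (c j) * of_real (K i j))
      \<le> (\<Sum>i\<in>I. \<Sum>j\<in>I. norm (c i) * norm (c j) * K i j)"
    by (intro order.trans[OF norm_sum] sum_mono order.trans[OF norm_sum])
       (simp add: norm_mult assms)
  also have "\<dots> \<le> (\<Sum>i\<in>I. \<Sum>j\<in>I. ((norm (c i))\<^sup>2 * K i j + (norm (c j))\<^sup>2 * K j i) / 2)"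
  proof (intro sum_mono)
    fix i j assume "i \<in> I" "j \<in> I"
    hence e: "K j i = K i j" using assms by auto
    have "norm (c i) * norm (c j) \<le> ((norm (c i))\<^sup>2 + (norm (c j))\<^sup>2) / 2"
      using sum_squares_bound[of "norm (c i)" "norm (c j)"] by simp
    hence "norm (c i) * norm (c j) * K i j \<le> ((norm (c i))\<^sup>2 + (norm (c j))\<^sup>2) / 2 * K i j"
      using assms by (intro mult_right_mono) auto
    thus "norm (c i) * norm (c j) * K i j \<le> ((norm (c i))\<^sup>2 * K i j + (norm (c j))\<^sup>2 * K j i) / 2"
      by (simp add: e algebra_simps)
  qed
  also have "\<dots> = (\<Sum>i\<in>I. \<Sum>j\<in>I. (norm (c i))\<^sup>2 * K i j)"
  proof -
    have "(\<Sum>i\<in>I. \<Sum>j\<in>I. (norm (c j))\<^sup>2 * K j i) = (\<Sum>i\<in>I. \<Sum>j\<in>I. (norm (c i))\<^sup>2 * K i j)"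
      by (rule sum.swap)
    thus ?thesis by (simp add: sum.distrib flip: sum_divide_distrib)
  qed
  also have "\<dots> \<le> (\<Sum>i\<in>I. (norm (c i))\<^sup>2 * M)"
    unfolding sum_distrib_left[symmetric] using assms by (intro sum_mono mult_left_mono) auto
  finally show ?thesis by (simp add: sum_distrib_left mult.commute)
qed

lemma sum_rotate: "(\<Sum>n\<in>N. \<Sum>a\<in>A. \<Sum>b\<in>B. h n a b) = (\<Sum>a\<in>A. \<Sum>b\<in>B. \<Sum>n\<in>N. h n a b)"
  by (subst sum.swap) (intro sum.cong refl sum.swap)

text \<open>
  The sum over \<open>n < N\<close> is majorized by one over the differences \<open>j - l\<close> with \<open>j, l < 2 H\<close>, in which each
  \<open>n < N\<close> occurs at least \<open>H\<close> times; this yields squares of Dirichlet kernels (a Fejer kernel).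
\<close>

lemma large_sieve_dual:
  fixes c :: "'i \<Rightarrow> complex"
  assumes "finite I" "separated I x \<delta>" "\<delta> > 0" "1 / \<delta> \<le> real H" "N \<le> H"
  shows "(\<Sum>n<N. (norm (\<Sum>i\<in>I. c i * cis (2 * pi * (of_nat n * x i))))\<^sup>2)
           \<le> 8 * real H * (\<Sum>i\<in>I. (norm (c i))\<^sup>2)"
proof -
  have H: "H > 0" using assms by (cases "H = 0") auto
  define P where "P = (\<lambda>u::real. \<Sum>i\<in>I. c i * cis (2 * pi * (u * x i)))"
  have "of_real (\<Sum>j<2*H. \<Sum>l<2*H. (norm (P (real j - real l)))\<^sup>2)
      = (\<Sum>j<2*H. \<Sum>l<2*H. \<Sum>i\<in>I. \<Sum>k\<in>I.
           c i * cnj (c k) * (cis (2 * pi * (of_nat j * (x i - x k))) * cnj (cis (2 * pi * (of_nat l * (x i - x k))))))"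
    unfolding of_real_sum
  proof (intro sum.cong refl)
    fix j l
    have "of_real ((norm (P (real j - real l)))\<^sup>2) = P (real j - real l) * cnj (P (real j - real l))"
      by (rule complex_norm_square)
    also have "\<dots> = (\<Sum>i\<in>I. \<Sum>k\<in>I. c i * cis (2 * pi * ((real j - real l) * x i)) *
        (cnj (c k) * cis (- (2 * pi * ((real j - real l) * x k)))))"
      by (simp add: P_def sum_product cis_cnj)
    also have "\<dots> = (\<Sum>i\<in>I. \<Sum>k\<in>I.
           c i * cnj (c k) * (cis (2 * pi * (of_nat j * (x i - x k))) * cnj (cis (2 * pi * (of_nat l * (x i - x k))))))"
    proof (intro sum.cong refl)
      fix i k
      have "cis (2 * pi * ((real j - real l) * x i)) * cis (- (2 * pi * ((real j - real l) * x k)))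
        = cis (2 * pi * (of_nat j * (x i - x k))) * cnj (cis (2 * pi * (of_nat l * (x i - x k))))"
        unfolding cis_cnj cis_mult by (simp add: algebra_simps)
      thus "c i * cis (2 * pi * ((real j - real l) * x i)) *
        (cnj (c k) * cis (- (2 * pi * ((real j - real l) * x k)))) =
        c i * cnj (c k) * (cis (2 * pi * (of_nat j * (x i - x k))) * cnj (cis (2 * pi * (of_nat l * (x i - x k)))))"
        by (simp add: mult_ac)
    qed
    finally show "of_real ((norm (P (real j - real l)))\<^sup>2) = \<dots>" .
  qed
  also have "\<dots> = (\<Sum>i\<in>I. \<Sum>k\<in>I. \<Sum>j<2*H. \<Sum>l<2*H.
           c i * cnj (c k) * (cis (2 * pi * (of_nat j * (x i - x k))) * cnj (cis (2 * pi * (of_nat l * (x i - x k))))))"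
    by (simp only: sum_rotate[where N = "{..<2*H}" and A = I and B = I])
  also have "\<dots> = (\<Sum>i\<in>I. \<Sum>k\<in>I. c i * cnj (c k) * of_real ((norm (dirichlet_kernel (2 * H) (x i - x k)))\<^sup>2))"
    unfolding complex_norm_square dirichlet_kernel_def cnj_sum sum_product by (simp add: sum_distrib_left)
  finally have eq: "of_real (\<Sum>j<2*H. \<Sum>l<2*H. (norm (P (real j - real l)))\<^sup>2) =
    (\<Sum>i\<in>I. \<Sum>k\<in>I. c i * cnj (c k) * of_real ((norm (dirichlet_kernel (2 * H) (x i - x k)))\<^sup>2))" .
  have sym: "norm (dirichlet_kernel (2 * H) (x i - x k)) = norm (dirichlet_kernel (2 * H) (x k - x i))" for i k
  proof -
    have "dirichlet_kernel (2 * H) (x i - x k) = cnj (dirichlet_kernel (2 * H) (x k - x i))"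
      unfolding dirichlet_kernel_def cnj_sum cis_cnj by (intro sum.cong) (auto simp: algebra_simps)
    thus ?thesis by simp
  qed
  have d: "1 / \<delta>\<^sup>2 \<le> (real H)\<^sup>2" using power_mono[OF assms(4), of 2] assms(3) by (simp add: power_divide)
  have "(\<Sum>j<2*H. \<Sum>l<2*H. (norm (P (real j - real l)))\<^sup>2)
      = norm (of_real (\<Sum>j<2*H. \<Sum>l<2*H. (norm (P (real j - real l)))\<^sup>2) :: complex)"
    unfolding norm_of_real by (intro abs_of_nonneg[symmetric] sum_nonneg) auto
  also have "\<dots> \<le> ((real (2 * H))\<^sup>2 + 4 / \<delta>\<^sup>2) * (\<Sum>i\<in>I. (norm (c i))\<^sup>2)"
    unfolding eq using assms sym by (intro norm_hermitian_form_le sum_kernel_separated_le) auto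
  also have "\<dots> \<le> (8 * (real H)\<^sup>2) * (\<Sum>i\<in>I. (norm (c i))\<^sup>2)"
    using d by (intro mult_right_mono sum_nonneg) (auto simp: power_mult_distrib)
  finally have upper: "(\<Sum>j<2*H. \<Sum>l<2*H. (norm (P (real j - real l)))\<^sup>2) \<le> 8 * (real H)\<^sup>2 * (\<Sum>i\<in>I. (norm (c i))\<^sup>2)" .
  have "real H * (\<Sum>n<N. (norm (P (real n)))\<^sup>2) = (\<Sum>l<H. \<Sum>n<N. (norm (P (real n)))\<^sup>2)" by simp
  also have "\<dots> = (\<Sum>(l, n)\<in>{..<H} \<times> {..<N}. (norm (P (real n)))\<^sup>2)"
    by (subst sum.cartesian_product[symmetric]) simp
  also have "\<dots> = (\<Sum>(j, l)\<in>(\<lambda>(l, n). (l + n, l)) ` ({..<H} \<times> {..<N}). (norm (P (real j - real l)))\<^sup>2)"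
    by (subst sum.reindex) (auto simp: inj_on_def intro!: sum.cong)
  also have "\<dots> \<le> (\<Sum>(j, l)\<in>{..<2*H} \<times> {..<2*H}. (norm (P (real j - real l)))\<^sup>2)"
    using assms(5) by (intro sum_mono2) auto
  also have "\<dots> = (\<Sum>j<2*H. \<Sum>l<2*H. (norm (P (real j - real l)))\<^sup>2)" by (simp add: sum.cartesian_product)
  finally have "real H * (\<Sum>n<N. (norm (P (real n)))\<^sup>2) \<le> real H * (8 * real H * (\<Sum>i\<in>I. (norm (c i))\<^sup>2))"
    using upper by (simp add: power2_eq_square mult_ac)
  hence "(\<Sum>n<N. (norm (P (real n)))\<^sup>2) \<le> 8 * real H * (\<Sum>i\<in>I. (norm (c i))\<^sup>2)"
    by (rule mult_left_le_imp_le) (use H in simp)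
  thus ?thesis by (simp add: P_def)
qed

lemma cauchy_schwarz_complex:
  fixes u v :: "'i \<Rightarrow> complex"
  shows "(norm (\<Sum>i\<in>I. u i * v i))\<^sup>2 \<le> (\<Sum>i\<in>I. (norm (u i))\<^sup>2) * (\<Sum>i\<in>I. (norm (v i))\<^sup>2)"
proof -
  have "norm (\<Sum>i\<in>I. u i * v i) \<le> (\<Sum>i\<in>I. \<bar>norm (u i)\<bar> * \<bar>norm (v i)\<bar>)"
    by (rule order.trans[OF norm_sum]) (simp add: norm_mult)
  also have "\<dots> \<le> L2_set (\<lambda>i. norm (u i)) I * L2_set (\<lambda>i. norm (v i)) I"
    by (rule L2_set_mult_ineq)
  finally have "(norm (\<Sum>i\<in>I. u i * v i))\<^sup>2 \<le> (L2_set (\<lambda>i. norm (u i)) I * L2_set (\<lambda>i. norm (v i)) I)\<^sup>2"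
    by (intro power_mono) auto
  thus ?thesis by (simp add: power_mult_distrib L2_set_def sum_nonneg)
qed

text \<open>Duality. The left side T is the pairing of \<open>b\<close> with the trigonometric sum
  whose coefficients are the conjugates of \<open>S i\<close>. Cauchy-Schwarz and
  \<open>large_sieve_dual\<close> then bound T^2 by a constant times T.\<close>

lemma additive_large_sieve:
  fixes b :: "nat \<Rightarrow> complex"
  assumes "finite I" "separated I x \<delta>" "\<delta> > 0" "1 / \<delta> \<le> real H" "N \<le> H"
  shows "(\<Sum>i\<in>I. (norm (\<Sum>n<N. b n * cis (2 * pi * (of_nat n * x i))))\<^sup>2)
           \<le> 8 * real H * (\<Sum>n<N. (norm (b n))\<^sup>2)"
proof -
  define S where "S = (\<lambda>i. \<Sum>n<N. b n * cis (2 * pi * (of_nat n * x i)))"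
  define T where "T = (\<Sum>i\<in>I. (norm (S i))\<^sup>2)"
  have T0: "T \<ge> 0" unfolding T_def by (intro sum_nonneg) auto
  have "of_real T = (\<Sum>i\<in>I. cnj (S i) * S i)"
    unfolding T_def of_real_sum complex_norm_square by (simp add: mult.commute)
  also have "\<dots> = (\<Sum>i\<in>I. \<Sum>n<N. b n * (cnj (S i) * cis (2 * pi * (of_nat n * x i))))"
    by (subst (2) S_def) (simp add: sum_distrib_left mult_ac)
  also have "\<dots> = (\<Sum>n<N. b n * (\<Sum>i\<in>I. cnj (S i) * cis (2 * pi * (of_nat n * x i))))"
    by (subst sum.swap) (simp add: sum_distrib_left)
  finally have eq: "of_real T = (\<Sum>n<N. b n * (\<Sum>i\<in>I. cnj (S i) * cis (2 * pi * (of_nat n * x i))))" .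
  have "T\<^sup>2 = (norm (of_real T :: complex))\<^sup>2" by simp
  also have "\<dots> \<le> (\<Sum>n<N. (norm (b n))\<^sup>2) * (\<Sum>n<N. (norm (\<Sum>i\<in>I. cnj (S i) * cis (2 * pi * (of_nat n * x i))))\<^sup>2)"
    unfolding eq by (rule cauchy_schwarz_complex)
  also have "\<dots> \<le> (\<Sum>n<N. (norm (b n))\<^sup>2) * (8 * real H * (\<Sum>i\<in>I. (norm (cnj (S i)))\<^sup>2))"
    by (intro mult_left_mono large_sieve_dual[OF assms] sum_nonneg) auto
  finally have "T * T \<le> (8 * real H * (\<Sum>n<N. (norm (b n))\<^sup>2)) * T"
    by (simp add: T_def power2_eq_square mult_ac)
  hence "T \<le> 8 * real H * (\<Sum>n<N. (norm (b n))\<^sup>2)"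
    using T0 by (cases "T = 0") (auto intro!: mult_nonneg_nonneg sum_nonneg)
  thus ?thesis by (simp add: T_def S_def)
qed


section \<open>Primitive characters, Gauss sums and the multiplicative large sieve\<close>

definition prim_chars :: "nat \<Rightarrow> (nat \<Rightarrow> complex) set" where
  "prim_chars r = {\<psi>. primitive_char r \<psi>}"

lemma prim_chars_subset: "prim_chars r \<subseteq> chars r"
  by (auto simp: prim_chars_def chars_def primitive_char_def)

lemma finite_prim_chars: "finite (prim_chars r)"
  using prim_chars_subset finite_chars by (rule finite_subset)

text \<open>Take \<open>m = n + d * t\<close> with \<open>t\<close> the product of the primes of
  \<open>r\<close> that do not divide \<open>n\<close>. Each prime of \<open>r\<close> then divides
  exactly one of the two summands.\<close>

lemma coprime_lift:
  fixes n d r :: nat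
  assumes "coprime n d" "r > 0"
  obtains m where "[m = n] (mod d)" "coprime m r"
proof -
  define t where "t = \<Prod>{p\<in>prime_factors r. \<not> p dvd n}"
  have "coprime (n + d * t) r"
  proof (rule ccontr)
    assume "\<not> coprime (n + d * t) r"
    then obtain p where p: "prime p" "p dvd n + d * t" "p dvd r"
      by (metis coprime_iff_gcd_eq_1 gcd_greatest_iff prime_factor_nat gcd_nat.bounded_iff)
    have t: "p dvd t \<longleftrightarrow> \<not> p dvd n"
    proof
      assume "p dvd t"
      then obtain p' where "p' \<in> prime_factors r" "\<not> p' dvd n" "p dvd p'"
        unfolding t_def using p(1) by (subst (asm) prime_dvd_prod_iff) auto
      thus "\<not> p dvd n" using p(1) by (metis in_prime_factors_iff primes_dvd_imp_eq)
    next
      assume "\<not> p dvd n"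
      thus "p dvd t" unfolding t_def using p assms by (intro dvd_prodI) (auto simp: in_prime_factors_iff)
    qed
    show False
    proof (cases "p dvd n")
      case True
      hence "p dvd d * t" using p(2) by (simp add: dvd_add_right_iff)
      hence "p dvd d" using t True p(1) by (simp add: prime_dvd_mult_iff)
      thus False using True assms(1) p(1) by (metis coprime_common_divisor not_prime_unit)
    next
      case False
      hence "p dvd d * t" using t by simp
      thus False using False p(2) by (simp add: dvd_add_left_iff)
    qed
  qed
  moreover have "[n + d * t = n] (mod d)" by (simp add: cong_def)
  ultimately show thesis using that by blast
qed

text \<open>If \<open>\<psi>\<close> were 1 at every unit congruent to 1 mod \<open>d\<close>, its
  value at a unit would depend only on the class mod \<open>d\<close>. Lifting classes mod
  \<open>d\<close> to units mod \<open>r\<close> would then define a character mod \<open>d\<close>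
  that induces \<open>\<psi>\<close>, against primitivity.\<close>

lemma primitive_char_witness:
  assumes "primitive_char r \<psi>" "d dvd r" "d \<noteq> r"
  obtains (wit) c where "coprime c r" "[c = 1] (mod d)" "\<psi> c \<noteq> 1"
proof (rule ccontr)
  assume no: "\<not> thesis"
  have triv: "\<psi> c = 1" if "coprime c r" "[c = 1] (mod d)" for c
    using that no wit by blast
  have dc: "dirichlet_char r \<psi>" using assms by (simp add: primitive_char_def)
  have r: "r > 0" using dc by (rule dirichlet_char_pos)
  have well: "\<psi> m = \<psi> n" if mn: "coprime m r" "coprime n r" "[m = n] (mod d)" for m n
  proof -
    obtain v where v: "coprime v r" "[n * v = 1] (mod r)" using cong_inverse_nat[OF mn(2) r] by blast
    have "[n * v = 1] (mod d)" using v(2) assms(2) by (rule cong_dvd_modulus_nat)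
    moreover have "[m * v = n * v] (mod d)" using mn by (intro cong_mult) auto
    ultimately have "[m * v = 1] (mod d)" by (metis cong_trans)
    hence "\<psi> m * \<psi> v = 1" using triv[of "m * v"] mn v dc by (simp add: dirichlet_char_mult)
    moreover have "\<psi> n * \<psi> v = 1"
      using dirichlet_char_cong[OF dc v(2)] dc by (simp add: dirichlet_char_mult dirichlet_char_one)
    ultimately show ?thesis by (metis mult_right_cancel mult_zero_right zero_neq_one)
  qed
  \<comment> \<open>A chosen lift of the class of \<open>n\<close> mod \<open>d\<close> to a unit
    mod \<open>r\<close>; by \<open>well\<close> the value of \<open>\<psi>\<close> is the same for
    every lift.\<close>
  define l where "l = (\<lambda>n. SOME m. [m = n] (mod d) \<and> coprime m r)"
  have l: "[l n = n] (mod d) \<and> coprime (l n) r" if "coprime n d" for n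
    unfolding l_def by (rule someI_ex) (use coprime_lift[OF that r] in metis)
  define \<phi> where "\<phi> = (\<lambda>n. if coprime n d then \<psi> (l n) else 0)"
  have phi: "\<phi> n = \<psi> m" if "coprime m r" "[m = n] (mod d)" "coprime n d" for m n
    unfolding \<phi>_def using that l[of n] well[of "l n" m] by (auto intro: cong_trans cong_sym)
  have d: "d > 0" using r assms(2) by (auto intro: Nat.gr0I)
  have "dirichlet_char d \<phi>"
    unfolding dirichlet_char_def
  proof (intro conjI allI)
    fix n
    show "\<phi> (n mod d) = \<phi> n"
    proof (cases "coprime n d")
      case True
      thus ?thesis using l[OF True] phi[of "l n" "n mod d"] phi[of "l n" n] d by (auto simp: cong_def)
    qed (use d in \<open>auto simp: \<phi>_def\<close>)
    show "\<phi> n \<noteq> 0 \<longleftrightarrow> coprime n d"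
      using l[of n] dc by (auto simp: \<phi>_def dirichlet_char_eq_0_iff)
    fix m
    show "\<phi> (m * n) = \<phi> m * \<phi> n"
    proof (cases "coprime m d \<and> coprime n d")
      case True
      have "\<phi> (m * n) = \<psi> (l m * l n)" using True l by (intro phi) (auto intro: cong_mult)
      thus ?thesis using True dc by (simp add: \<phi>_def dirichlet_char_mult)
    qed (auto simp: \<phi>_def)
  qed (use d in auto)
  moreover have "\<psi> n = \<phi> n" if "coprime n r" for n
    using phi[of n n] that assms(2) by (metis cong_refl coprime_divisors dvd_refl)
  ultimately have "induced_by r \<psi> d \<phi>" using dc assms(2) by (simp add: induced_by_def)
  thus False using assms by (auto simp: primitive_char_def)
qed

definition unit_root :: "nat \<Rightarrow> nat \<Rightarrow> complex" where
  "unit_root r n = cis (2 * pi * (real n / real r))"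

lemma unit_root_mod:
  assumes "r > 0"
  shows "unit_root r (n mod r) = unit_root r n"
proof -
  have "real n / real r = real (n div r) + real (n mod r) / real r"
    using assms by (simp add: field_simps flip: of_nat_mult of_nat_add)
  hence "unit_root r n = cis (2 * pi * real (n div r)) * unit_root r (n mod r)"
    unfolding unit_root_def cis_mult by (simp add: algebra_simps)
  also have "cis (2 * pi * real (n div r)) = 1" by (simp add: cis_multiple_2pi)
  finally show ?thesis by simp
qed

lemma unit_root_cong: "r > 0 \<Longrightarrow> [m = n] (mod r) \<Longrightarrow> unit_root r m = unit_root r n"
  by (metis unit_root_mod cong_def)

lemma norm_unit_root [simp]: "norm (unit_root r n) = 1"
  by (simp add: unit_root_def)

lemma unit_root_orthogonality:
  assumes "a < r" "b < r"
  shows "(\<Sum>k<r. unit_root r (k * a) * cnj (unit_root r (k * b))) = (if a = b then of_nat r else 0)"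
proof -
  have r: "r > 0" using assms by simp
  define z where "z = cis (2 * pi * ((real a - real b) / real r))"
  have "unit_root r (k * a) * cnj (unit_root r (k * b)) = z ^ k" for k
    unfolding unit_root_def z_def cis_cnj cis_mult Complex.DeMoivre
    by (simp add: diff_divide_distrib algebra_simps)
  hence eq: "(\<Sum>k<r. unit_root r (k * a) * cnj (unit_root r (k * b))) = (\<Sum>k<r. z ^ k)" by simp
  show ?thesis
  proof (cases "a = b")
    case False
    have "z \<noteq> 1"
    proof
      assume "z = 1"
      hence "cos (2 * pi * ((real a - real b) / real r)) = 1" by (simp add: z_def complex_eq_iff)
      then obtain i :: int where "2 * pi * ((real a - real b) / real r) = of_int i * 2 * pi"
        by (auto simp: cos_one_2pi_int)
      hence "(2 * pi) * ((real a - real b) / real r) = (2 * pi) * of_int i" by (simp add: mult_ac)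
      hence "(real a - real b) / real r = of_int i" by (subst (asm) mult_cancel_left) simp
      hence "real a - real b = of_int i * real r" using r by (simp add: field_simps)
      hence "real_of_int (int a - int b) = of_int (i * int r)" by simp
      hence "int a - int b = i * int r" by (simp only: of_int_eq_iff)
      hence "[int a = int b] (mod int r)" by (simp add: cong_iff_dvd_diff)
      hence "[a = b] (mod r)" by (simp add: cong_int_iff)
      thus False using assms False by (simp add: cong_def)
    qed
    moreover have "z ^ r = 1"
    proof -
      have "z ^ r = cis (2 * pi * of_int (int a - int b))"
        unfolding z_def Complex.DeMoivre using r by simp
      also have "\<dots> = 1" by (rule cis_multiple_2pi) auto
      finally show ?thesis .
    qed
    ultimately show ?thesis using False eq by (simp add: geometric_sum)
  qed (use eq in \<open>simp add: z_def\<close>)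
qed

definition gauss_sum :: "nat \<Rightarrow> (nat \<Rightarrow> complex) \<Rightarrow> complex" where
  "gauss_sum r \<psi> = (\<Sum>a<r. \<psi> a * unit_root r a)"

text \<open>For \<open>n\<close> coprime to \<open>r\<close> this is the substitution of
  \<open>n * a\<close> for \<open>a\<close>. For other \<open>n\<close> both sides vanish, and here
  primitivity is essential: a unit \<open>c\<close> with \<open>\<psi> c \<noteq> 1\<close> and n c
  \<equiv> n mod \<open>r\<close> shows that the sum equals \<open>\<psi> c\<close> times
  itself.\<close>

lemma gauss_sum_twist:
  assumes "primitive_char r \<psi>"
  shows "(\<Sum>a<r. \<psi> a * unit_root r (n * a)) = cnj (\<psi> n) * gauss_sum r \<psi>"
proof -
  have dc: "dirichlet_char r \<psi>" using assms by (simp add: primitive_char_def)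
  have r: "r > 0" using dc by (rule dirichlet_char_pos)
  have per: "\<psi> (a mod r) * unit_root r (m * (a mod r)) = \<psi> a * unit_root r (m * a)" for a m
  proof -
    have "[m * (a mod r) = m * a] (mod r)" by (simp add: cong_def mod_mult_right_eq)
    thus ?thesis using dc r unit_root_cong[of r "m * (a mod r)" "m * a"] by (simp add: dirichlet_char_def)
  qed
  show ?thesis
  proof (cases "coprime n r")
    case True
    have "gauss_sum r \<psi> = (\<Sum>a<r. \<psi> (n * a) * unit_root r (1 * (n * a)))"
      unfolding gauss_sum_def using per[of _ 1]
      by (subst sum_mult_residues[OF r True, of "\<lambda>a. \<psi> a * unit_root r (1 * a)"]) simp_all
    also have "\<dots> = \<psi> n * (\<Sum>a<r. \<psi> a * unit_root r (n * a))"
      using dc by (simp add: dirichlet_char_mult sum_distrib_left mult_ac)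
    finally have "cnj (\<psi> n) * gauss_sum r \<psi> = (\<psi> n * cnj (\<psi> n)) * (\<Sum>a<r. \<psi> a * unit_root r (n * a))"
      by (simp add: mult_ac)
    thus ?thesis using True dc by (simp add: dirichlet_char_mult_cnj)
  next
    case False
    \<comment> \<open>As a function of \<open>a\<close>, the additive character
      \<open>unit_root r (n * a)\<close> has period \<open>d = r div g\<close>, a proper divisor of
      \<open>r\<close>; the witness \<open>c\<close> is taken for this \<open>d\<close>.\<close>
    define g where "g = gcd n r"
    define d where "d = r div g"
    have g: "g > 1" using False r
      by (metis g_def coprime_iff_gcd_eq_1 gcd_pos_nat less_one nat_neq_iff not_gr_zero)
    have rdg: "r = d * g" by (simp add: d_def g_def)
    have "d dvd r" "d \<noteq> r" using rdg g r by auto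
    then obtain c where c: "coprime c r" "[c = 1] (mod d)" "\<psi> c \<noteq> 1"
      using primitive_char_witness[OF assms] by metis
    have "[n * c = n] (mod r)"
    proof -
      have "int d dvd int c - 1" using c(2) by (simp add: cong_iff_dvd_diff flip: cong_int_iff)
      moreover have "int g dvd int n" by (simp add: g_def)
      ultimately have "int d * int g dvd (int c - 1) * int n" by (rule mult_dvd_mono)
      hence "[int n * int c = int n] (mod int r)" by (simp add: cong_iff_dvd_diff rdg algebra_simps)
      thus ?thesis by (metis cong_int_iff of_nat_mult)
    qed
    hence nc: "unit_root r (n * (c * a)) = unit_root r (n * a)" for a
      using r by (intro unit_root_cong) (auto simp: mult.assoc[symmetric] intro: cong_mult)
    have "(\<Sum>a<r. \<psi> a * unit_root r (n * a)) = (\<Sum>a<r. \<psi> (c * a) * unit_root r (n * (c * a)))"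
      using per by (subst sum_mult_residues[OF r c(1), of "\<lambda>a. \<psi> a * unit_root r (n * a)"]) simp_all
    also have "\<dots> = \<psi> c * (\<Sum>a<r. \<psi> a * unit_root r (n * a))"
      using dc by (simp only: nc) (simp add: dirichlet_char_mult sum_distrib_left mult.assoc)
    finally have "(\<psi> c - 1) * (\<Sum>a<r. \<psi> a * unit_root r (n * a)) = 0" by (simp add: left_diff_distrib)
    thus ?thesis using c(3) False dc by (simp add: dirichlet_char_eq_0_iff)
  qed
qed

lemma parseval_residues:
  "(\<Sum>n<r. (norm (\<Sum>a<r. u a * unit_root r (n * a)))\<^sup>2) = real r * (\<Sum>a<r. (norm (u a))\<^sup>2)"
proof -
  have "complex_of_real (\<Sum>n<r. (norm (\<Sum>a<r. u a * unit_root r (n * a)))\<^sup>2)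
      = (\<Sum>n<r. \<Sum>a<r. \<Sum>b<r. u a * cnj (u b) * (unit_root r (n * a) * cnj (unit_root r (n * b))))"
    unfolding of_real_sum complex_norm_square cnj_sum sum_product by (simp add: mult_ac)
  also have "\<dots> = (\<Sum>a<r. \<Sum>b<r. u a * cnj (u b) * (\<Sum>n<r. unit_root r (n * a) * cnj (unit_root r (n * b))))"
    by (subst sum_rotate) (simp add: sum_distrib_left)
  also have "\<dots> = (\<Sum>a<r. \<Sum>b<r. if a = b then u a * cnj (u b) * of_nat r else 0)"
    by (intro sum.cong refl) (auto simp: unit_root_orthogonality)
  also have "\<dots> = (\<Sum>a<r. u a * cnj (u a) * of_nat r)" by (simp add: sum.delta)
  also have "\<dots> = complex_of_real (real r * (\<Sum>a<r. (norm (u a))\<^sup>2))"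
    by (simp add: complex_norm_square sum_distrib_left mult_ac del: of_real_power)
  finally show ?thesis by (simp only: of_real_eq_iff)
qed

lemma card_coprime_residues:
  assumes "r > 0"
  shows "card {a. a < r \<and> coprime a r} = totient r"
proof -
  have "complex_of_nat (totient r) = (\<Sum>a<r. principal_char r a)"
    using sum_residues_dirichlet_char[OF dirichlet_char_principal[OF assms]] by simp
  also have "\<dots> = of_nat (card ({..<r} \<inter> {a. coprime a r}))" by (simp add: principal_char_def sum.If_cases)
  also have "{..<r} \<inter> {a. coprime a r} = {a. a < r \<and> coprime a r}" by auto
  finally show ?thesis by (metis of_nat_eq_iff)
qed

text \<open>Parseval for the finite Fourier transform of \<open>\<psi>\<close>: by
  \<open>gauss_sum_twist\<close> every transform value at a unit has the modulus of the Gauss sum,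
  and the other values are 0.\<close>

lemma norm_gauss_sum:
  assumes "primitive_char r \<psi>"
  shows "(norm (gauss_sum r \<psi>))\<^sup>2 = real r"
proof -
  have dc: "dirichlet_char r \<psi>" using assms by (simp add: primitive_char_def)
  have r: "r > 0" using dc by (rule dirichlet_char_pos)
  have sq: "(\<Sum>a<r. (norm (\<psi> a))\<^sup>2) = real (totient r)"
  proof -
    have "(\<Sum>a<r. (norm (\<psi> a))\<^sup>2) = (\<Sum>a<r. if coprime a r then 1 else 0)"
      using norm_dirichlet_char[OF dc] dirichlet_char_eq_0_iff[OF dc] by (intro sum.cong) auto
    also have "\<dots> = real (card ({..<r} \<inter> {a. coprime a r}))" by (simp add: sum.If_cases)
    also have "{..<r} \<inter> {a. coprime a r} = {a. a < r \<and> coprime a r}" by auto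
    finally show ?thesis using r by (simp add: card_coprime_residues)
  qed
  have "real r * real (totient r) = (\<Sum>n<r. (norm (cnj (\<psi> n) * gauss_sum r \<psi>))\<^sup>2)"
    using parseval_residues[where r = r and u = \<psi>] sq unfolding gauss_sum_twist[OF assms] by simp
  also have "\<dots> = real (totient r) * (norm (gauss_sum r \<psi>))\<^sup>2"
    by (simp add: norm_mult power_mult_distrib flip: sum_distrib_right sq)
  finally show ?thesis using r by simp
qed

lemma parseval_chars:
  assumes "r > 0"
  shows "(\<Sum>\<psi>\<in>chars r. (norm (\<Sum>a<r. \<psi> a * u a))\<^sup>2) = real (totient r) * (\<Sum>a | a < r \<and> coprime a r. (norm (u a))\<^sup>2)"
proof -
  define A where "A = {a. a < r \<and> coprime a r}"
  have A: "finite A" by (simp add: A_def)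
  have restr: "(\<Sum>a<r. \<psi> a * u a) = (\<Sum>a\<in>A. \<psi> a * u a)" if "\<psi> \<in> chars r" for \<psi>
    using that by (intro sum.mono_neutral_right) (auto simp: A_def chars_def dirichlet_char_eq_0_iff)
  have "complex_of_real (\<Sum>\<psi>\<in>chars r. (norm (\<Sum>a<r. \<psi> a * u a))\<^sup>2)
      = (\<Sum>\<psi>\<in>chars r. \<Sum>a\<in>A. \<Sum>b\<in>A. u a * cnj (u b) * (\<psi> a * cnj (\<psi> b)))"
    unfolding of_real_sum by (intro sum.cong refl)
       (simp add: restr complex_norm_square sum_product mult_ac del: of_real_power)
  also have "\<dots> = (\<Sum>a\<in>A. \<Sum>b\<in>A. u a * cnj (u b) * (\<Sum>\<psi>\<in>chars r. \<psi> a * cnj (\<psi> b)))"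
    by (subst sum_rotate) (simp add: sum_distrib_left)
  also have "\<dots> = (\<Sum>a\<in>A. \<Sum>b\<in>A. if a = b then u a * cnj (u b) * of_nat (totient r) else 0)"
    using assms by (intro sum.cong refl) (auto simp: A_def chars_orthogonality cong_def)
  also have "\<dots> = (\<Sum>a\<in>A. u a * cnj (u a) * of_nat (totient r))" using A by (simp add: sum.delta)
  also have "\<dots> = complex_of_real (real (totient r) * (\<Sum>a\<in>A. (norm (u a))\<^sup>2))"
    by (simp add: complex_norm_square sum_distrib_left mult_ac del: of_real_power)
  finally show ?thesis unfolding A_def by (simp only: of_real_eq_iff)
qed

text \<open>Multiplying the twisted sum by the Gauss sum turns it into the pairing of
  \<open>\<psi>\<close> with the additive sums \<open>S a\<close>, and the Gauss sum has squared
  modulus \<open>r\<close>. The primitive characters are then enlarged to all characters mod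
  \<open>r\<close>, where Parseval is an equality.\<close>

lemma sum_prim_chars_le:
  assumes "r > 0"
  shows "real r / real (totient r) * (\<Sum>\<psi>\<in>prim_chars r. (norm (\<Sum>n<N. b n * cnj (\<psi> n)))\<^sup>2)
    \<le> (\<Sum>a | a < r \<and> coprime a r. (norm (\<Sum>n<N. b n * unit_root r (n * a)))\<^sup>2)"
proof -
  define S where "S = (\<lambda>a. \<Sum>n<N. b n * unit_root r (n * a))"
  have "real r * (\<Sum>\<psi>\<in>prim_chars r. (norm (\<Sum>n<N. b n * cnj (\<psi> n)))\<^sup>2)
      = (\<Sum>\<psi>\<in>prim_chars r. (norm (\<Sum>a<r. \<psi> a * S a))\<^sup>2)"
    unfolding sum_distrib_left
  proof (rule sum.cong[OF refl])
    fix \<psi> assume "\<psi> \<in> prim_chars r"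
    hence prim: "primitive_char r \<psi>" by (simp add: prim_chars_def)
    have "(\<Sum>a<r. \<psi> a * S a) = (\<Sum>n<N. b n * (\<Sum>a<r. \<psi> a * unit_root r (n * a)))"
      unfolding S_def sum_distrib_left by (subst sum.swap) (simp add: mult_ac)
    also have "\<dots> = (\<Sum>n<N. b n * cnj (\<psi> n)) * gauss_sum r \<psi>"
      unfolding gauss_sum_twist[OF prim] sum_distrib_right by (simp add: mult_ac)
    finally have "(norm (\<Sum>a<r. \<psi> a * S a))\<^sup>2 = (norm (\<Sum>n<N. b n * cnj (\<psi> n)))\<^sup>2 * real r"
      using norm_gauss_sum[OF prim] by (simp add: norm_mult power_mult_distrib)
    thus "real r * (norm (\<Sum>n<N. b n * cnj (\<psi> n)))\<^sup>2 = (norm (\<Sum>a<r. \<psi> a * S a))\<^sup>2" by simp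
  qed
  also have "\<dots> \<le> (\<Sum>\<psi>\<in>chars r. (norm (\<Sum>a<r. \<psi> a * S a))\<^sup>2)"
    using prim_chars_subset finite_chars by (intro sum_mono2) auto
  also have "\<dots> = real (totient r) * (\<Sum>a | a < r \<and> coprime a r. (norm (S a))\<^sup>2)"
    by (rule parseval_chars[OF assms])
  finally show ?thesis using assms by (simp add: S_def field_simps)
qed

text \<open>Modulo 1, the difference of two distinct reduced fractions is a nonzero integer divided
  by the product of the denominators.\<close>

lemma farey_separated:
  assumes "D > 0"
  shows "separated (SIGMA r:{1..D}. {a. a < r \<and> coprime a r}) (\<lambda>(r, a). real a / real r) (1 / (real D)\<^sup>2)"
  unfolding separated_def
proof (intro ballI impI allI)
  fix i j and k :: int
  assume i: "i \<in> (SIGMA r:{1..D}. {a. a < r \<and> coprime a r})"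
    and j: "j \<in> (SIGMA r:{1..D}. {a. a < r \<and> coprime a r})" and ij: "i \<noteq> j"
  obtain r a s b where e: "i = (r, a)" "j = (s, b)" by (cases i, cases j) auto
  note i = i[unfolded e] and j = j[unfolded e] and ij = ij[unfolded e]
  define m where "m = int a * int s - int b * int r - k * int r * int s"
  have rs: "r > 0" "s > 0" "r \<le> D" "s \<le> D" using i j by auto
  \<comment> \<open>If the numerator vanished, coprimality would make the denominators divide each
    other; they would be equal, and the numerators congruent and hence equal.\<close>
  have "m \<noteq> 0"
  proof
    assume "m = 0"
    hence m: "int a * int s = int r * (int b + k * int s)" "int b * int r = int s * (int a - k * int r)"
      by (simp_all add: m_def algebra_simps)
    have "int r dvd int a * int s" "int s dvd int b * int r" using m by (metis dvd_triv_left)+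
    hence "r dvd a * s" "s dvd b * r" by (simp_all flip: of_nat_mult)
    hence "r dvd s" "s dvd r" using i j by (auto simp: coprime_dvd_mult_right_iff coprime_commute)
    hence "r = s" by (rule dvd_antisym)
    hence "int a = int b + k * int r" using m(1) rs by simp
    hence "[int a = int b] (mod int r)" by (simp add: cong_iff_dvd_diff)
    hence "[a = b] (mod r)" by (simp add: cong_int_iff)
    hence "a = b" using i j \<open>r = s\<close> by (simp add: cong_def)
    thus False using ij \<open>r = s\<close> by simp
  qed
  hence "1 \<le> \<bar>m\<bar>" by simp
  hence "1 \<le> \<bar>real_of_int m\<bar>" by linarith
  have "real a / real r - real b / real s - of_int k = of_int m / (real r * real s)"
    using rs by (simp add: m_def field_simps)
  hence "\<bar>real a / real r - real b / real s - of_int k\<bar> = \<bar>real_of_int m\<bar> / (real r * real s)"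
    using rs by simp
  also have "\<dots> \<ge> 1 / (real r * real s)" using \<open>1 \<le> \<bar>real_of_int m\<bar>\<close> by (intro divide_right_mono) auto
  also have "1 / (real r * real s) \<ge> 1 / (real D)\<^sup>2"
    using rs by (auto simp: power2_eq_square intro!: divide_left_mono mult_mono)
  finally show "1 / (real D)\<^sup>2 \<le> \<bar>(case i of (r, a) \<Rightarrow> real a / real r) - (case j of (r, a) \<Rightarrow> real a / real r) - of_int k\<bar>"
    by (simp add: e)
qed

theorem multiplicative_large_sieve:
  fixes b :: "nat \<Rightarrow> complex"
  shows "(\<Sum>r = 1..D. real r / real (totient r) * (\<Sum>\<psi>\<in>prim_chars r. (norm (\<Sum>n<N. b n * cnj (\<psi> n)))\<^sup>2))
    \<le> 8 * (real N + (real D)\<^sup>2) * (\<Sum>n<N. (norm (b n))\<^sup>2)"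
proof (cases "D = 0")
  case False
  hence D: "D > 0" by simp
  let ?I = "SIGMA r:{1..D}. {a. a < r \<and> coprime a r}"
  have "(\<Sum>r = 1..D. real r / real (totient r) * (\<Sum>\<psi>\<in>prim_chars r. (norm (\<Sum>n<N. b n * cnj (\<psi> n)))\<^sup>2))
     \<le> (\<Sum>r = 1..D. \<Sum>a | a < r \<and> coprime a r. (norm (\<Sum>n<N. b n * unit_root r (n * a)))\<^sup>2)"
    by (intro sum_mono sum_prim_chars_le) auto
  also have "\<dots> = (\<Sum>i\<in>?I. (norm (\<Sum>n<N. b n * cis (2 * pi * (of_nat n * (case i of (r, a) \<Rightarrow> real a / real r)))))\<^sup>2)"
    by (subst sum.Sigma) (auto simp: unit_root_def intro!: sum.cong)
  \<comment> \<open>The choice H = N + D^2 meets both requirements, N \<le> H and 1/\<delta> = D^2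
    \<le> H.\<close>
  also have "\<dots> \<le> 8 * real (N + D\<^sup>2) * (\<Sum>n<N. (norm (b n))\<^sup>2)"
    by (intro additive_large_sieve[OF _ farey_separated[OF D]]) (use D in auto)
  finally show ?thesis by simp
qed (auto intro!: mult_nonneg_nonneg sum_nonneg)

section \<open>Totient sums, partial summation and Fourier separation\<close>


lemma harmonic_sum_le:
  assumes "N > 0"
  shows "(\<Sum>n = 1..N. 1 / real n) \<le> 1 + ln (real N)"
proof -
  have *: "(\<Sum>n = 1..Suc N. 1 / real n) \<le> 1 + ln (real (Suc N))" for N
  proof (induction N)
    case (Suc N)
    have "1 / real (Suc (Suc N)) \<le> ln (real (Suc (Suc N))) - ln (real (Suc N))"
    proof -
      have "ln (real (Suc N) / real (Suc (Suc N))) \<le> real (Suc N) / real (Suc (Suc N)) - 1"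
        by (rule ln_le_minus_one) simp
      also have "\<dots> = - 1 / real (Suc (Suc N))" by (simp add: field_simps)
      finally show ?thesis by (simp add: ln_div)
    qed
    thus ?case using Suc by simp
  qed auto
  show ?thesis using *[of "N - 1"] assms by simp
qed

text \<open>From \<phi>(a) \<phi>(b) gcd(a,b) = \<phi>(ab) \<phi>(gcd(a,b)) and \<phi>(gcd(a,b))
  \<le> gcd(a,b).\<close>

lemma totient_supermult: "totient a * totient b \<le> totient (a * b)"
proof (cases "a = 0 \<or> b = 0")
  case False
  hence g: "gcd a b > 0" by simp
  have "totient a * totient b * gcd a b = totient (a * b) * totient (gcd a b)"
    by (rule totient_gcd[symmetric])
  also have "\<dots> \<le> totient (a * b) * gcd a b" by (intro mult_left_mono totient_le) auto
  finally show ?thesis using g mult_le_cancel2 by blast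
qed auto

text \<open>A substitute for the identity expressing q/\<phi>(q) by the reciprocals of \<phi> at the
  squarefree divisors: \<open>q\<close> is the sum of \<phi>(q/d) over its divisors, and \<phi>(q/d)
  \<phi>(d) \<le> \<phi>(q).\<close>

lemma ratio_totient_le:
  assumes "q > 0"
  shows "real q / real (totient q) \<le> (\<Sum>d | d dvd q. 1 / real (totient d))"
proof -
  have "real q = (\<Sum>d | d dvd q. real (totient d))"
    using totient_divisor_sum[of q] by (metis of_nat_sum)
  also have "\<dots> = (\<Sum>d | d dvd q. real (totient (q div d)))"
    using assms by (intro sum.reindex_bij_witness[of _ "\<lambda>d. q div d" "\<lambda>d. q div d"]) (auto simp: div_div_eq_right)
  also have "\<dots> \<le> (\<Sum>d | d dvd q. real (totient q) / real (totient d))"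
  proof (rule sum_mono)
    fix d assume "d \<in> {d. d dvd q}"
    hence d: "d dvd q" "d > 0" using assms by (auto intro: Nat.gr0I)
    have "totient (q div d) * totient d \<le> totient q"
      using totient_supermult[of "q div d" d] d by simp
    hence "real (totient (q div d)) * real (totient d) \<le> real (totient q)"
      by (metis of_nat_le_iff of_nat_mult)
    thus "real (totient (q div d)) \<le> real (totient q) / real (totient d)"
      using d by (simp add: field_simps)
  qed
  also have "\<dots> = real (totient q) * (\<Sum>d | d dvd q. 1 / real (totient d))" by (simp add: sum_distrib_left)
  finally show ?thesis using assms by (simp add: field_simps)
qed

lemma sum_divisors_le:
  fixes w u :: "nat \<Rightarrow> real"
  assumes "\<And>n. w n \<ge> 0" "\<And>n. u n \<ge> 0"
  shows "(\<Sum>s = 1..N. w s * (\<Sum>d | d dvd s. u d)) \<le> (\<Sum>d = 1..N. \<Sum>k = 1..N. w (d * k) * u d)"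
proof -
  have "(\<Sum>s = 1..N. w s * (\<Sum>d | d dvd s. u d)) = (\<Sum>(s, d)\<in>(SIGMA s:{1..N}. {d. d dvd s}). w s * u d)"
    unfolding sum_distrib_left by (subst sum.Sigma) auto
  also have "\<dots> = (\<Sum>(d, k)\<in>(\<lambda>(s, d). (d, s div d)) ` (SIGMA s:{1..N}. {d. d dvd s}). w (d * k) * u d)"
  proof (subst sum.reindex)
    show "inj_on (\<lambda>(s, d). (d, s div d)) (SIGMA s:{1..N}. {d. d dvd s})"
      by (auto simp: inj_on_def elim!: dvdE)
  qed (auto intro!: sum.cong)
  also have "\<dots> \<le> (\<Sum>(d, k)\<in>{1..N} \<times> {1..N}. w (d * k) * u d)"
  proof (rule sum_mono2)
    show "(\<lambda>(s, d). (d, s div d)) ` (SIGMA s:{1..N}. {d. d dvd s}) \<subseteq> {1..N} \<times> {1..N}"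
    proof clarify
      fix s d assume "s \<in> {1..N}" "d dvd s"
      moreover from this have "d \<le> s" "d > 0" "s div d \<le> s" "s div d > 0"
        by (auto intro: dvd_imp_le Nat.gr0I simp: dvd_div_eq_0_iff)
      ultimately show "d \<in> {1..N} \<and> s div d \<in> {1..N}"
        by (auto intro: order.trans[OF div_le_dividend])
    qed
  qed (use assms in auto)
  also have "\<dots> = (\<Sum>d = 1..N. \<Sum>k = 1..N. w (d * k) * u d)" by (simp add: sum.cartesian_product)
  finally show ?thesis .
qed

text \<open>After s/\<phi>(s) is replaced by a divisor sum and s is written as d k, the double sum
  factors for the weights of interest. The weight 1/s gives a bounded sum; the weight 1 then needs
  that bound for the factor in \<open>d\<close> and leaves one logarithm from
  \<open>k\<close>.\<close>

lemma sum_inverse_totient_weighted: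
  assumes "\<And>n. w n \<ge> 0"
  shows "(\<Sum>s = 1..N. w s / real (totient s)) \<le> (\<Sum>d = 1..N. \<Sum>k = 1..N. w (d * k) / real (d * k) * (1 / real (totient d)))"
proof -
  have "(\<Sum>s = 1..N. w s / real (totient s)) \<le> (\<Sum>s = 1..N. w s / real s * (\<Sum>d | d dvd s. 1 / real (totient d)))"
  proof (rule sum_mono)
    fix s assume s: "s \<in> {1..N}"
    have "w s / real (totient s) = w s / real s * (real s / real (totient s))" using s by simp
    also have "\<dots> \<le> w s / real s * (\<Sum>d | d dvd s. 1 / real (totient d))"
      using s assms by (intro mult_left_mono ratio_totient_le) auto
    finally show "w s / real (totient s) \<le> \<dots>" .
  qed
  also have "\<dots> \<le> (\<Sum>d = 1..N. \<Sum>k = 1..N. w (d * k) / real (d * k) * (1 / real (totient d)))"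
    using assms by (intro sum_divisors_le) auto
  finally show ?thesis .
qed

lemma sum_inverse_mult_totient_le: "(\<Sum>s = 1..N. 1 / (real s * real (totient s))) \<le> 4"
proof -
  have "(\<Sum>s = 1..N. 1 / (real s * real (totient s))) = (\<Sum>s = 1..N. (1 / real s) / real (totient s))" by simp
  also have "\<dots> \<le> (\<Sum>d = 1..N. \<Sum>k = 1..N. (1 / real (d * k)) / real (d * k) * (1 / real (totient d)))"
    by (intro sum_inverse_totient_weighted) auto
  also have "\<dots> \<le> (\<Sum>d = 1..N. \<Sum>k = 1..N. (1 / (real d)\<^sup>2) * (1 / (real k)\<^sup>2))"
  proof (intro sum_mono)
    fix d k assume "d \<in> {1..N}" "k \<in> {1..N}"
    hence "(1 / real (d * k)) / real (d * k) * (1 / real (totient d)) \<le> (1 / real (d * k)) / real (d * k) * 1"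
      by (intro mult_left_mono) (auto simp: Suc_le_eq)
    thus "(1 / real (d * k)) / real (d * k) * (1 / real (totient d)) \<le> (1 / (real d)\<^sup>2) * (1 / (real k)\<^sup>2)"
      by (simp add: power2_eq_square mult_ac)
  qed
  also have "\<dots> = (\<Sum>d = 1..N. 1 / (real d)\<^sup>2) * (\<Sum>k = 1..N. 1 / (real k)\<^sup>2)"
    by (simp add: sum_product)
  also have "\<dots> \<le> 2 * 2" by (intro mult_mono sum_inverse_squares_le sum_nonneg) auto
  finally show ?thesis by simp
qed

lemma sum_inverse_totient_le:
  assumes "N > 0"
  shows "(\<Sum>s = 1..N. 1 / real (totient s)) \<le> 4 * (1 + ln (real N))"
proof -
  have "(\<Sum>s = 1..N. 1 / real (totient s)) \<le> (\<Sum>d = 1..N. \<Sum>k = 1..N. 1 / real (d * k) * (1 / real (totient d)))"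
    by (intro sum_inverse_totient_weighted) auto
  also have "\<dots> = (\<Sum>d = 1..N. 1 / (real d * real (totient d))) * (\<Sum>k = 1..N. 1 / real k)"
    unfolding sum_product by (simp add: mult_ac)
  also have "\<dots> \<le> 4 * (1 + ln (real N))"
    by (intro mult_mono sum_inverse_mult_totient_le harmonic_sum_le sum_nonneg) (use assms in auto)
  finally show ?thesis .
qed

text \<open>The coefficients \<open>c\<close> depend on the weight alone, so one choice serves all
  sequences \<open>u\<close>, in particular all moduli and residue classes at once. Their total size
  is the variation of the weight extended by 0, namely w(a+1) + |w(b) - w(a+1)| + w(b), twice the
  larger end value.\<close>

lemma monotone_abel_summation:
  fixes w :: "nat \<Rightarrow> real"
  assumes "mono_on {a<..b} w \<or> antimono_on {a<..b} w" "\<And>n. a < n \<Longrightarrow> n \<le> b \<Longrightarrow> 0 \<le> w n \<and> w n \<le> 1"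
  obtains c where "\<And>u :: nat \<Rightarrow> complex. (\<Sum>n\<in>{a<..b}. of_real (w n) * u n) = (\<Sum>k\<in>{a..b}. of_real (c k) * (\<Sum>n = 1..k. u n))"
    "(\<Sum>k\<in>{a..b}. \<bar>c k\<bar>) \<le> 2"
proof (cases "a < b")
  case False
  have "(\<Sum>n\<in>{a<..b}. of_real (w n) * u n) = (\<Sum>k\<in>{a..b}. of_real 0 * (\<Sum>n = 1..k. u n))"
    for u :: "nat \<Rightarrow> complex" using False by simp
  moreover have "(\<Sum>k\<in>{a..b}. \<bar>0::real\<bar>) \<le> 2" by simp
  ultimately show thesis by (rule that)
next
  case True
  \<comment> \<open>With zeros at both ends the differences of \<open>v\<close> add up to 0; this is
    why the partial sums may start at 1 instead of a + 1.\<close>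
  define v where "v = (\<lambda>n. if a < n \<and> n \<le> b then w n else 0)"
  have tele: "(\<Sum>k\<in>{a..b}. of_real (v k - v (Suc k)) * (\<Sum>n = 1..k. u n)) = (\<Sum>n\<in>{a<..b}. of_real (w n) * u n)"
    for u :: "nat \<Rightarrow> complex"
  proof -
    have "(\<Sum>k\<in>{a..m}. of_real (v k - v (Suc k)) * (\<Sum>n = 1..k. u n))
        = (\<Sum>n\<in>{a<..m}. of_real (v n) * u n) - of_real (v (Suc m)) * (\<Sum>n = 1..m. u n)" if "a \<le> m" for m
      using that
    proof (induction m rule: dec_induct)
      case base
      show ?case by (simp add: v_def)
    next
      case (step m)
      have "{a..Suc m} = insert (Suc m) {a..m}" "{a<..Suc m} = insert (Suc m) {a<..m}" using step by auto
      thus ?case using step by (simp add: algebra_simps)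
    qed
    from this[of b] True have "(\<Sum>k\<in>{a..b}. of_real (v k - v (Suc k)) * (\<Sum>n = 1..k. u n)) = (\<Sum>n\<in>{a<..b}. of_real (v n) * u n)"
      by (simp add: v_def)
    also have "(\<Sum>n\<in>{a<..b}. of_real (v n) * u n) = (\<Sum>n\<in>{a<..b}. of_real (w n) * u n)"
      by (intro sum.cong) (auto simp: v_def)
    finally show ?thesis .
  qed
  have split: "(\<Sum>k\<in>{a..b}. \<bar>v k - v (Suc k)\<bar>) = \<bar>w (Suc a)\<bar> + (\<Sum>k\<in>{Suc a..<b}. \<bar>w k - w (Suc k)\<bar>) + \<bar>w b\<bar>"
  proof -
    have "{a..b} = insert a (insert b {Suc a..<b})" using True by auto
    thus ?thesis using True by (simp add: v_def)
  qed
  have "(\<Sum>k\<in>{Suc a..<b}. \<bar>w k - w (Suc k)\<bar>) = \<bar>w b - w (Suc a)\<bar>"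
  proof (cases "mono_on {a<..b} w")
    case mono: True
    have "(\<Sum>k\<in>{Suc a..<b}. \<bar>w k - w (Suc k)\<bar>) = (\<Sum>k\<in>{Suc a..<b}. w (Suc k) - w k)"
      using mono_onD[OF mono] by (intro sum.cong refl) fastforce
    also have "\<dots> = w b - w (Suc a)" using True by (intro sum_Suc_diff') auto
    finally show ?thesis using mono_onD[OF mono, of "Suc a" b] True by simp
  next
    case False
    hence anti: "antimono_on {a<..b} w" using assms(1) by blast
    have "(\<Sum>k\<in>{Suc a..<b}. \<bar>w k - w (Suc k)\<bar>) = (\<Sum>k\<in>{Suc a..<b}. - (w (Suc k) - w k))"
      using monotone_onD[OF anti] by (intro sum.cong refl) fastforce
    also have "\<dots> = - (w b - w (Suc a))" unfolding sum_negf using True by (subst sum_Suc_diff') auto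
    finally show ?thesis using monotone_onD[OF anti, of "Suc a" b] True by simp
  qed
  hence "(\<Sum>k\<in>{a..b}. \<bar>v k - v (Suc k)\<bar>) \<le> 2"
    unfolding split using assms(2)[of b] assms(2)[of "Suc a"] True by (auto simp: abs_if)
  thus thesis using tele[symmetric] by (rule that[rotated])
qed

text \<open>A bound for the \<open>k\<close>-th Fourier coefficient mod \<open>M\<close> of a
  cut-off monotone weight with values between 0 and 1. The two reciprocals stem from the geometric
  sums, of size \<open>M\<close> over the distance of \<open>k\<close> to the nearest multiple of
  \<open>M\<close>, and the factor 2 from the variation of the weight. The total over
  \<open>k\<close> is logarithmic.\<close>

definition fourier_majorant :: "nat \<Rightarrow> nat \<Rightarrow> real" where
  "fourier_majorant M k = (if k = 0 then 2 else 2 / real k + 2 / real (M - k))"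

lemma fourier_majorant_nonneg: "fourier_majorant M k \<ge> 0"
  by (simp add: fourier_majorant_def)

lemma sum_fourier_majorant_le:
  assumes "M > 0"
  shows "(\<Sum>k<M. fourier_majorant M k) \<le> 6 + 4 * ln (real M)"
proof -
  have M: "{..<M} = insert 0 {1..<M}" using assms by auto
  have "(\<Sum>k\<in>{1..<M}. 2 / real (M - k)) = (\<Sum>k\<in>{1..<M}. 2 / real k)"
    by (intro sum.reindex_bij_witness[of _ "\<lambda>k. M - k" "\<lambda>k. M - k"]) auto
  moreover have "(\<Sum>k\<in>{1..<M}. 2 / real k) \<le> 2 * (1 + ln (real M))"
  proof -
    have "(\<Sum>k\<in>{1..<M}. 2 / real k) \<le> (\<Sum>k\<in>{1..M}. 2 / real k)" by (intro sum_mono2) auto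
    also have "\<dots> = 2 * (\<Sum>k\<in>{1..M}. 1 / real k)" by (simp add: sum_distrib_left)
    also have "\<dots> \<le> 2 * (1 + ln (real M))" using harmonic_sum_le[OF assms] by (intro mult_left_mono) auto
    finally show ?thesis .
  qed
  ultimately show ?thesis unfolding M by (simp add: fourier_majorant_def sum.distrib)
qed

lemma norm_sum_unit_root_le:
  assumes "0 < k" "k < M"
  shows "norm (\<Sum>n = 1..j. unit_root M (k * n)) \<le> real M * (1 / real k + 1 / real (M - k))"
proof -
  define \<theta> where "\<theta> = real k / real M"
  define d where "d = min (real k) (real (M - k)) / real M"
  have d: "d > 0" using assms by (simp add: d_def)
  have dist: "d \<le> \<bar>\<theta> - of_int i\<bar>" for i :: int
  proof (cases "i \<le> 0")
    case True
    have "d \<le> \<theta>" unfolding d_def \<theta>_def by (intro divide_right_mono) auto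
    moreover have "real_of_int i \<le> 0" using True by simp
    ultimately show ?thesis using d by (simp add: abs_if)
  next
    case False
    have "d \<le> 1 - \<theta>" unfolding d_def \<theta>_def using assms by (simp add: field_simps of_nat_diff)
    moreover have "real_of_int i \<ge> 1" using False by simp
    ultimately show ?thesis using d by (simp add: abs_if)
  qed
  have "(\<Sum>n = 1..j. unit_root M (k * n)) = (\<Sum>n<j. unit_root M (k * Suc n))"
    by (rule sum.reindex_bij_witness[of _ Suc "\<lambda>n. n - 1"]) auto
  also have "\<dots> = cis (2 * pi * \<theta>) * (\<Sum>n<j. cis (2 * pi * (of_nat n * \<theta>)))"
    unfolding sum_distrib_left cis_mult unit_root_def \<theta>_def
    by (intro sum.cong refl arg_cong[of _ _ cis]) (simp add: algebra_simps add_divide_distrib)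
  finally have "norm (\<Sum>n = 1..j. unit_root M (k * n)) = norm (\<Sum>n<j. cis (2 * pi * (of_nat n * \<theta>)))"
    by (simp add: norm_mult)
  also have "\<dots> \<le> 1 / d" by (rule norm_sum_cis_le[OF dist d])
  also have "1 / d \<le> real M * (1 / real k + 1 / real (M - k))"
    unfolding d_def using assms by (cases "real k \<le> real (M - k)") (auto simp: min_def distrib_left)
  finally show ?thesis .
qed

text \<open>Fourier inversion mod \<open>M\<close>, the condition \<open>b < M\<close> keeping the
  support inside one period. The coefficients are estimated by partial summation against geometric
  sums.\<close>

lemma fourier_separation:
  fixes w :: "nat \<Rightarrow> real"
  assumes "mono_on {a<..b} w \<or> antimono_on {a<..b} w" "\<And>n. a < n \<Longrightarrow> n \<le> b \<Longrightarrow> 0 \<le> w n \<and> w n \<le> 1" "b < M"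
  obtains h where "\<And>n. n < M \<Longrightarrow> (if a < n \<and> n \<le> b then of_real (w n) else 0) = (\<Sum>k<M. h k * unit_root M (k * n))"
    "\<And>k. k < M \<Longrightarrow> norm (h k) \<le> fourier_majorant M k"
proof -
  define W where "W = (\<lambda>n. if a < n \<and> n \<le> b then complex_of_real (w n) else 0)"
  define h where "h = (\<lambda>k. 1 / of_nat M * (\<Sum>n\<in>{a<..b}. of_real (w n) * cnj (unit_root M (k * n))))"
  have M: "M > 0" using assms by simp
  obtain c where c: "\<And>u :: nat \<Rightarrow> complex. (\<Sum>n\<in>{a<..b}. of_real (w n) * u n) = (\<Sum>k\<in>{a..b}. of_real (c k) * (\<Sum>n = 1..k. u n))"
    "(\<Sum>k\<in>{a..b}. \<bar>c k\<bar>) \<le> 2" using monotone_abel_summation[OF assms(1,2)] by blast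
  have h_alt: "h k = 1 / of_nat M * (\<Sum>m<M. W m * cnj (unit_root M (k * m)))" for k
    unfolding h_def W_def by (intro arg_cong2[of _ _ _ _ "(*)"] sum.mono_neutral_cong_left refl) (use assms in auto)
  have "W n = (\<Sum>k<M. h k * unit_root M (k * n))" if n: "n < M" for n
  proof -
    have "(\<Sum>k<M. h k * unit_root M (k * n)) = (\<Sum>k<M. \<Sum>m<M. 1 / of_nat M * W m * (unit_root M (k * n) * cnj (unit_root M (k * m))))"
      unfolding h_alt sum_distrib_left sum_distrib_right by (simp add: mult_ac)
    also have "\<dots> = (\<Sum>m<M. 1 / of_nat M * W m * (\<Sum>k<M. unit_root M (k * n) * cnj (unit_root M (k * m))))"
      by (subst sum.swap) (simp add: sum_distrib_left)
    also have "\<dots> = (\<Sum>m<M. if m = n then W m else 0)"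
      using n M by (intro sum.cong refl) (auto simp: unit_root_orthogonality)
    finally show ?thesis using n by simp
  qed
  moreover have "norm (h k) \<le> fourier_majorant M k" if k: "k < M" for k
  proof -
    define B where "B = real M * (fourier_majorant M k / 2)"
    have part: "norm (\<Sum>n = 1..j. cnj (unit_root M (k * n))) \<le> B" if "j \<le> b" for j
    proof (cases "k = 0")
      case True
      have "norm (\<Sum>n = 1..j. cnj (unit_root M (k * n))) \<le> real j"
        by (rule order.trans[OF norm_sum]) simp
      thus ?thesis using True that assms(3) by (simp add: B_def fourier_majorant_def)
    next
      case False
      have "norm (\<Sum>n = 1..j. cnj (unit_root M (k * n))) = norm (cnj (\<Sum>n = 1..j. unit_root M (k * n)))"
        by (simp only: cnj_sum)
      also have "\<dots> \<le> real M * (1 / real k + 1 / real (M - k))"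
        unfolding complex_mod_cnj using False k by (intro norm_sum_unit_root_le) auto
      also have "\<dots> = B" using False by (simp add: B_def fourier_majorant_def add_divide_distrib)
      finally show ?thesis .
    qed
    have B: "B \<ge> 0" by (simp add: B_def fourier_majorant_nonneg)
    have "norm (\<Sum>n\<in>{a<..b}. of_real (w n) * cnj (unit_root M (k * n))) \<le> (\<Sum>j\<in>{a..b}. \<bar>c j\<bar> * B)"
      unfolding c(1)
      by (intro order.trans[OF norm_sum] sum_mono) (simp add: norm_mult, rule mult_left_mono, use part in auto)
    also have "\<dots> \<le> 2 * B" unfolding sum_distrib_right[symmetric] using c(2) B by (intro mult_right_mono)
    finally show ?thesis unfolding h_def using M
      by (simp add: norm_mult norm_divide B_def field_simps)
  qed
  ultimately show thesis using that unfolding W_def by blast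
qed

section \<open>Smooth integers and the number of prime factors\<close>

text \<open>Adjoin a prime \<open>p\<close> to \<open>P\<close>. The multiples of \<open>p\<close>,
  divided by \<open>p\<close>, fall back into the same set, so the new sum T satisfies T \<le> (old
  sum) + T / sqrt p. As 1/sqrt p \<le> 3/4 and T is finite, the last term is absorbed at the cost of
  a factor 4.\<close>

lemma sum_smooth_le:
  assumes "finite P" "\<And>p. p \<in> P \<Longrightarrow> prime p"
  shows "(\<Sum>d | d \<in> {1..N} \<and> prime_factors d \<subseteq> P. 1 / sqrt (real d)) \<le> 4 ^ card P"
  using assms
proof (induction P rule: finite_induct)
  case empty
  have "{d. d \<in> {1..N} \<and> prime_factors d \<subseteq> {}} \<subseteq> {1}"
    by (auto simp: prime_factorization_empty_iff)
  hence "(\<Sum>d | d \<in> {1..N} \<and> prime_factors d \<subseteq> {}. 1 / sqrt (real d)) \<le> (\<Sum>d\<in>{1}. 1 / sqrt (real d))"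
    by (intro sum_mono2) auto
  thus ?case by simp
next
  case (insert p P)
  let ?T = "\<lambda>P. \<Sum>d | d \<in> {1..N} \<and> prime_factors d \<subseteq> P. 1 / sqrt (real d)"
  let ?S = "{d. d \<in> {1..N} \<and> prime_factors d \<subseteq> insert p P}"
  have p: "prime p" using insert by simp
  have "?S = {d\<in>?S. \<not> p dvd d} \<union> {d\<in>?S. p dvd d}" by auto
  hence "?T (insert p P) = (\<Sum>d | d \<in> ?S \<and> \<not> p dvd d. 1 / sqrt (real d)) + (\<Sum>d | d \<in> ?S \<and> p dvd d. 1 / sqrt (real d))"
    by (subst (1) \<open>?S = _\<close>, intro sum.union_disjoint) auto
  also have "(\<Sum>d | d \<in> ?S \<and> \<not> p dvd d. 1 / sqrt (real d)) \<le> ?T P"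
    by (intro sum_mono2) (auto simp: in_prime_factors_iff)
  also have "(\<Sum>d | d \<in> ?S \<and> p dvd d. 1 / sqrt (real d)) = (\<Sum>e\<in>(\<lambda>d. d div p) ` {d \<in> ?S. p dvd d}. 1 / sqrt (real p) * (1 / sqrt (real e)))"
  proof (subst sum.reindex)
    show "inj_on (\<lambda>d. d div p) {d \<in> ?S. p dvd d}" by (rule inj_onI) (metis (mono_tags, lifting) dvd_div_eq_cancel mem_Collect_eq)
    show "(\<Sum>d | d \<in> ?S \<and> p dvd d. 1 / sqrt (real d)) = sum ((\<lambda>e. 1 / sqrt (real p) * (1 / sqrt (real e))) \<circ> (\<lambda>d. d div p)) {d \<in> ?S. p dvd d}"
    proof (rule sum.cong)
      fix d assume "d \<in> {d \<in> ?S. p dvd d}"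
      hence "real d = real p * real (d div p)" by (metis (mono_tags, lifting) dvd_mult_div_cancel mem_Collect_eq of_nat_mult)
      thus "1 / sqrt (real d) = ((\<lambda>e. 1 / sqrt (real p) * (1 / sqrt (real e))) \<circ> (\<lambda>d. d div p)) d"
        by (simp add: real_sqrt_mult)
    qed auto
  qed
  also have "\<dots> \<le> (\<Sum>e\<in>?S. 1 / sqrt (real p) * (1 / sqrt (real e)))"
  proof (rule sum_mono2)
    show "(\<lambda>d. d div p) ` {d \<in> ?S. p dvd d} \<subseteq> ?S"
    proof clarify
      fix d assume d: "d \<in> {1..N}" "prime_factors d \<subseteq> insert p P" "p dvd d"
      then obtain e where e: "d = p * e" by blast
      hence "e \<noteq> 0" "d div p = e" using d p by auto
      moreover have "prime_factors e \<subseteq> prime_factors d" using d e by (intro dvd_prime_factors) auto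
      moreover have "e \<le> d" using e prime_gt_0_nat[OF p] by simp
      ultimately show "d div p \<in> {1..N} \<and> prime_factors (d div p) \<subseteq> insert p P" using d by auto
    qed
  qed auto
  also have "\<dots> = 1 / sqrt (real p) * ?T (insert p P)" by (simp add: sum_distrib_left)
  also have "\<dots> \<le> 3 / 4 * ?T (insert p P)"
  proof (rule mult_right_mono)
    have "sqrt (real p) \<ge> sqrt 2" using prime_ge_2_nat[OF p] by simp
    moreover have "sqrt 2 \<ge> (4 / 3 :: real)" by (rule real_le_rsqrt) (simp add: power2_eq_square)
    ultimately have "sqrt (real p) \<ge> 4 / 3" by linarith
    hence "1 / sqrt (real p) \<le> 1 / (4 / 3)" using prime_gt_0_nat[OF p] by (intro divide_left_mono) auto
    thus "1 / sqrt (real p) \<le> 3 / 4" by simp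
  qed (auto intro: sum_nonneg)
  finally have "?T (insert p P) \<le> 4 * ?T P" by simp
  also have "\<dots> \<le> 4 * 4 ^ card P" using insert by (intro mult_left_mono insert.IH) auto
  finally show ?case using insert by simp
qed

text \<open>A prime with p^\<delta> \<ge> 4 pays for its own factor 4; the fewer than P + 1
  remaining primes contribute at most the constant 4^P.\<close>

lemma four_power_omega_le:
  fixes \<delta> :: real
  assumes "\<delta> > 0"
  obtains K where "K > 0" "\<And>s::nat. s > 0 \<Longrightarrow> 4 ^ card (prime_factors s) \<le> K * real s powr \<delta>"
proof -
  define P where "P = nat \<lceil>4 powr (1 / \<delta>)\<rceil>"
  have big: "4 \<le> real p powr \<delta>" if "p > P" for p
  proof -
    have "4 powr (1 / \<delta>) \<le> real P" unfolding P_def by linarith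
    hence "4 powr (1 / \<delta>) \<le> real p" using that by simp
    hence "(4 powr (1 / \<delta>)) powr \<delta> \<le> real p powr \<delta>" using assms by (intro powr_mono2) auto
    thus ?thesis using assms by (simp add: powr_powr)
  qed
  have "4 ^ card (prime_factors s) \<le> 4 ^ P * real s powr \<delta>" if s: "s > 0" for s :: nat
  proof -
    have "(4::real) ^ card (prime_factors s) = (\<Prod>p\<in>prime_factors s. 4)" by simp
    also have "\<dots> \<le> (\<Prod>p\<in>prime_factors s. (if p \<le> P then 4 else 1) * real p powr \<delta>)"
    proof (rule prod_mono)
      fix p assume p: "p \<in> prime_factors s"
      hence "real p \<ge> 1" by (auto simp: in_prime_factors_iff dest: prime_ge_1_nat)
      hence "1 \<le> real p powr \<delta>" using assms by (intro ge_one_powr_ge_zero) auto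
      thus "0 \<le> (4::real) \<and> 4 \<le> (if p \<le> P then 4 else 1) * real p powr \<delta>" using big[of p] by auto
    qed
    also have "\<dots> = (\<Prod>p\<in>prime_factors s. if p \<le> P then 4 else 1) * (\<Prod>p\<in>prime_factors s. real p powr \<delta>)"
      by (rule prod.distrib)
    also have "(\<Prod>p\<in>prime_factors s. if p \<le> P then 4 else 1 :: real) = 4 ^ card (prime_factors s \<inter> {p. p \<le> P})"
      by (simp add: prod.If_cases)
    also have "\<dots> * (\<Prod>p\<in>prime_factors s. real p powr \<delta>) \<le> 4 ^ P * real s powr \<delta>"
    proof (rule mult_mono)
      have "card (prime_factors s \<inter> {p. p \<le> P}) \<le> card {1..P}"
        by (intro card_mono) (auto simp: in_prime_factors_iff Suc_le_eq dest: prime_gt_0_nat)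
      thus "(4::real) ^ card (prime_factors s \<inter> {p. p \<le> P}) \<le> 4 ^ P" by (intro power_increasing) auto
      have "(\<Prod>p\<in>prime_factors s. real p powr \<delta>) = real (\<Prod>p\<in>prime_factors s. p) powr \<delta>"
        by (simp add: prod_powr_distrib)
      also have "\<dots> \<le> real s powr \<delta>"
      proof (intro powr_mono2)
        have "(\<Prod>p\<in>prime_factors s. p) \<le> (\<Prod>p\<in>prime_factors s. p ^ multiplicity p s)"
          by (intro prod_mono) (auto simp: in_prime_factors_iff s self_le_power prime_ge_1_nat prime_multiplicity_gt_zero_iff prime_gt_0_nat Suc_le_eq)
        also have "\<dots> = s" using s by (simp add: prime_factorization_nat[symmetric])
        finally show "real (\<Prod>p\<in>prime_factors s. p) \<le> real s" by (simp only: of_nat_le_iff)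
      qed (use assms in \<open>auto intro: prod_nonneg\<close>)
      finally show "(\<Prod>p\<in>prime_factors s. real p powr \<delta>) \<le> real s powr \<delta>" .
    qed (auto intro: prod_nonneg)
    finally show ?thesis .
  qed
  thus thesis by (intro that[of "4 ^ P"]) auto
qed

section \<open>The class C and Dirichlet inverses\<close>


lemma class_C_one: "f \<in> class_C \<Longrightarrow> f (Suc 0) = 1"
  by (simp add: class_C_def multiplicative_def)

lemma class_C_mult: "f \<in> class_C \<Longrightarrow> m > 0 \<Longrightarrow> n > 0 \<Longrightarrow> coprime m n \<Longrightarrow> f (m * n) = f m * f n"
  by (simp add: class_C_def multiplicative_def)

lemma class_C_norm_Lambda_of_le:
  assumes "f \<in> class_C" "n > 0"
  shows "norm (Lambda_of f n) \<le> mangoldt n"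
  using assms by (simp add: class_C_def)

text \<open>Strong induction in f(n) log n = \<Sum> \<Lambda>_f(d) f(n/d): the right side is
  dominated by the sum of \<Lambda>(d) over the divisors of n, which is log n.\<close>

lemma class_C_norm_le_1:
  assumes "f \<in> class_C" "n > 0"
  shows "norm (f n) \<le> 1"
  using assms(2)
proof (induction n rule: less_induct)
  case (less n)
  show ?case
  proof (cases "n = 1")
    case True
    thus ?thesis using class_C_one[OF assms(1)] by simp
  next
    case False
    hence ln: "ln (real n) > 0" using less.prems by simp
    have "f n * of_real (ln (real n)) = (\<Sum>d | d dvd n. Lambda_of f d * f (n div d))"
      using class_C_one[OF assms(1)] less.prems by (intro Lambda_of_convolution) auto
    hence "norm (f n) * ln (real n) = norm (\<Sum>d | d dvd n. Lambda_of f d * f (n div d))"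
      using ln by (metis abs_of_pos norm_mult norm_of_real)
    also have "\<dots> \<le> (\<Sum>d | d dvd n. mangoldt d)"
    proof (rule sum_norm_le)
      fix d assume "d \<in> {d. d dvd n}"
      hence d: "d dvd n" "d > 0" "n div d > 0" using less.prems by (auto intro!: Nat.gr0I simp: dvd_div_eq_0_iff)
      show "norm (Lambda_of f d * f (n div d)) \<le> mangoldt d"
      \<comment> \<open>The term \<open>d = 1\<close> contains \<open>f n\<close> itself, out of
        reach of the induction; its coefficient vanishes because
        \<open>mangoldt 1 = 0\<close>.\<close>
      proof (cases "d = 1")
        case True
        thus ?thesis using class_C_norm_Lambda_of_le[OF assms(1), of 1] by simp
      next
        case False
        hence "n div d < n" using d less.prems by (intro div_less_dividend) auto
        hence "norm (f (n div d)) \<le> 1" using d by (intro less.IH)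
        thus ?thesis using class_C_norm_Lambda_of_le[OF assms(1) d(2)]
          unfolding norm_mult by (metis mult_mono mult.right_neutral norm_ge_zero mangoldt_nonneg)
      qed
    qed
    also have "\<dots> = ln (real n)" using mangoldt_sum[of n, where 'a = real] less.prems by simp
    finally show ?thesis using ln by simp
  qed
qed

lemma Lambda_of_prime:
  assumes "f (Suc 0) = 1" "prime p"
  shows "Lambda_of f p = f p * of_real (ln (real p))"
proof -
  have "{d. d dvd p \<and> d < p} = {1}"
    using assms(2) prime_gt_1_nat[OF assms(2)] by (auto simp: prime_nat_iff)
  moreover have "Lambda_of f (Suc 0) = 0" by (subst Lambda_of.simps) (simp, rule sum.neutral, auto)
  ultimately show ?thesis by (subst Lambda_of.simps) simp
qed

lemma sum_divisors_swap:
  assumes "n > 0"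
  shows "(\<Sum>m | m dvd n. \<Sum>d | d dvd n div m. h m d) = (\<Sum>d | d dvd n. \<Sum>m | m dvd n div d. h m (d::nat))"
proof -
  have *: "m dvd n \<and> d dvd n div m \<longleftrightarrow> d * m dvd n" for d m :: nat
  proof (cases "m dvd n")
    case True
    thus ?thesis using assms by (auto elim!: dvdE)
  qed (auto dest: dvd_mult_right)
  have fin: "finite {d. d dvd n div k}" if "k dvd n" for k
    using that assms by (intro finite_divisors_nat) (auto elim!: dvdE)
  have "(\<Sum>m | m dvd n. \<Sum>d | d dvd n div m. h m d) = (\<Sum>(m, d)\<in>(SIGMA m:{m. m dvd n}. {d. d dvd n div m}). h m d)"
    using fin assms by (intro sum.Sigma) auto
  also have "(SIGMA m:{m. m dvd n}. {d. d dvd n div m}) = {(m, d). d * m dvd n}" using * by auto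
  also have "(\<Sum>(m, d)\<in>{(m, d). d * m dvd n}. h m d) = (\<Sum>(d, m)\<in>{(d, m). m * d dvd n}. h m d)"
    by (intro sum.reindex_bij_witness[of _ "\<lambda>(d, m). (m, d)" "\<lambda>(m, d). (d, m)"]) (auto simp: mult.commute)
  also have "{(d, m). m * d dvd n} = (SIGMA d:{d. d dvd n}. {m. m dvd n div d})" using * by auto
  also have "(\<Sum>(d, m)\<in>(SIGMA d:{d. d dvd n}. {m. m dvd n div d}). h m d) = (\<Sum>d | d dvd n. \<Sum>m | m dvd n div d. h m d)"
    using fin assms by (intro sum.Sigma[symmetric]) auto
  finally show ?thesis .
qed

lemma sum_divisors_hyperbola:
  "(\<Sum>n = 1..N. \<Sum>d | d dvd n. h d (n div d)) = (\<Sum>d = 1..N. \<Sum>e = 1..N div d. h d (e::nat))"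
proof -
  have "(\<Sum>n = 1..N. \<Sum>d | d dvd n. h d (n div d)) = (\<Sum>(n, d)\<in>(SIGMA n:{1..N}. {d. d dvd n}). h d (n div d))"
    by (intro sum.Sigma) auto
  also have "\<dots> = (\<Sum>(d, e)\<in>(SIGMA d:{1..N}. {1..N div d}). h d e)"
  proof (intro sum.reindex_bij_witness[of _ "\<lambda>(d, e). (d * e, d)" "\<lambda>(n, d). (d, n div d)"])
    fix z assume "z \<in> (SIGMA n:{1..N}. {d. d dvd n})"
    then obtain d e where z: "z = (d * e, d)" "d * e \<in> {1..N}" by (auto elim!: dvdE)
    hence "d \<ge> 1" "e \<ge> 1" "d \<le> d * e" by (auto simp: Suc_le_eq)
    thus "(case z of (n, d) \<Rightarrow> (d, n div d)) \<in> (SIGMA d:{1..N}. {1..N div d})"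
      using z order.trans[of d "d * e" N] by (auto simp: less_eq_div_iff_mult_less_eq mult.commute)
  next
    fix z assume "z \<in> (SIGMA d:{1..N}. {1..N div d})"
    then obtain d e where z: "z = (d, e)" "1 \<le> d" "1 \<le> e" "e \<le> N div d" by auto
    hence "e * d \<le> N" by (simp add: less_eq_div_iff_mult_less_eq)
    thus "(case z of (d, e) \<Rightarrow> (d * e, d)) \<in> (SIGMA n:{1..N}. {d. d dvd n})"
      using z by (auto simp: mult.commute)
  qed auto
  also have "\<dots> = (\<Sum>d = 1..N. \<Sum>e = 1..N div d. h d e)" by (intro sum.Sigma[symmetric]) auto
  finally show ?thesis .
qed

text \<open>F G = 1 at the level of coefficients: \<open>g\<close> convolved with \<open>f\<close>
  is the unit of Dirichlet convolution.\<close>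

definition dirichlet_inverses :: "(nat \<Rightarrow> complex) \<Rightarrow> (nat \<Rightarrow> complex) \<Rightarrow> bool" where
  "dirichlet_inverses f g \<longleftrightarrow> (\<forall>n>0. (\<Sum>d | d dvd n. g d * f (n div d)) = (if n = 1 then 1 else 0))"

lemma dirichlet_inverses_sym:
  assumes "dirichlet_inverses f g"
  shows "dirichlet_inverses g f"
  unfolding dirichlet_inverses_def
proof (intro allI impI)
  fix n :: nat assume n: "n > 0"
  have "(\<Sum>d | d dvd n. f d * g (n div d)) = (\<Sum>d | d dvd n. g d * f (n div d))"
    using n by (intro sum.reindex_bij_witness[of _ "\<lambda>d. n div d" "\<lambda>d. n div d"])
      (auto simp: div_div_eq_right mult.commute)
  thus "(\<Sum>d | d dvd n. f d * g (n div d)) = (if n = 1 then 1 else 0)"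
    using assms n by (simp add: dirichlet_inverses_def)
qed

text \<open>Convolving f log = \<Lambda>_f * f with \<open>g\<close> cancels \<open>f\<close>; the
  interchange of the two divisor sums is the associativity of convolution.\<close>

lemma Lambda_of_eq_convolution:
  assumes "f (Suc 0) = 1" "dirichlet_inverses f g" "n > 0"
  shows "Lambda_of f n = (\<Sum>m | m dvd n. g m * (f (n div m) * of_real (ln (real (n div m)))))"
proof -
  have "(\<Sum>m | m dvd n. g m * (f (n div m) * of_real (ln (real (n div m)))))
      = (\<Sum>m | m dvd n. \<Sum>d | d dvd n div m. g m * (Lambda_of f d * f (n div m div d)))"
  proof (intro sum.cong refl)
    fix m assume "m \<in> {m. m dvd n}"
    hence "n div m > 0" using assms(3) by (auto elim!: dvdE)
    from Lambda_of_convolution[of f, OF _ this] assms(1)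
    show "g m * (f (n div m) * of_real (ln (real (n div m)))) = (\<Sum>d | d dvd n div m. g m * (Lambda_of f d * f (n div m div d)))"
      by (simp add: sum_distrib_left)
  qed
  also have "\<dots> = (\<Sum>d | d dvd n. \<Sum>m | m dvd n div d. g m * (Lambda_of f d * f (n div m div d)))"
    by (rule sum_divisors_swap[OF assms(3)])
  also have "\<dots> = (\<Sum>d | d dvd n. if d = n then Lambda_of f d else 0)"
  proof (intro sum.cong refl)
    fix d assume d: "d \<in> {d. d dvd n}"
    hence nd: "n div d > 0" using assms(3) by (auto elim!: dvdE)
    have "(\<Sum>m | m dvd n div d. g m * (Lambda_of f d * f (n div m div d)))
        = Lambda_of f d * (\<Sum>m | m dvd n div d. g m * f (n div d div m))"
      unfolding sum_distrib_left by (intro sum.cong refl) (simp add: div_mult2_eq[symmetric] mult_ac)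
    also have "\<dots> = Lambda_of f d * (if n div d = 1 then 1 else 0)"
      using assms(2) nd by (simp add: dirichlet_inverses_def)
    also have "n div d = 1 \<longleftrightarrow> d = n" using d assms(3) by (auto elim!: dvdE)
    finally show "(\<Sum>m | m dvd n div d. g m * (Lambda_of f d * f (n div m div d))) = (if d = n then Lambda_of f d else 0)"
      by simp
  qed
  also have "\<dots> = Lambda_of f n" using assms(3) by (simp add: sum.delta')
  finally show ?thesis by simp
qed

lemma dirichlet_inverses_prime:
  assumes "f (Suc 0) = 1" "g (Suc 0) = 1" "dirichlet_inverses f g" "prime p"
  shows "g p = - f p"
proof -
  have "{d. d dvd p} = {1, p}" "p \<noteq> 1" "p > 0"
    using assms(4) prime_gt_1_nat[OF assms(4)] by (auto simp: prime_nat_iff)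
  moreover have "(\<Sum>d | d dvd p. g d * f (p div d)) = 0"
    using assms(3) \<open>p \<noteq> 1\<close> \<open>p > 0\<close> by (auto simp: dirichlet_inverses_def)
  ultimately show ?thesis using assms by (simp add: add_eq_0_iff)
qed

lemma smooth_coprime_decomposition:
  fixes n s :: nat
  assumes "n > 0" "s > 0"
  obtains u v where "n = u * v" "prime_factors u \<subseteq> prime_factors s" "coprime v s" "u > 0" "v > 0"
  using assms(1)
proof (induction n arbitrary: thesis rule: less_induct)
  case (less n)
  show ?case
  proof (cases "coprime n s")
    case True
    thus ?thesis using less.prems by (intro less.prems(1)[of 1 n]) auto
  next
    case False
    then obtain p where p: "prime p" "p dvd n" "p dvd s"
      by (metis coprime_iff_gcd_eq_1 gcd_nat.bounded_iff prime_factor_nat)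
    obtain m where m: "n = p * m" using p by blast
    hence "m > 0" "m < n" using less.prems p prime_gt_1_nat by auto
    then obtain u v where "m = u * v" "prime_factors u \<subseteq> prime_factors s" "coprime v s" "u > 0" "v > 0"
      using less.IH by metis
    thus ?thesis using p m assms(2)
      by (intro less.prems(1)[of "p * u" v]) (auto simp: prime_factors_product prime_gt_0_nat prime_prime_factors)
  qed
qed

lemma smooth_imp_coprime:
  fixes u v s :: nat
  assumes "prime_factors u \<subseteq> prime_factors s" "coprime v s" "u > 0"
  shows "coprime u v"
proof (rule ccontr)
  assume "\<not> coprime u v"
  then obtain p where p: "prime p" "p dvd u" "p dvd v"
    by (metis coprime_iff_gcd_eq_1 gcd_nat.bounded_iff prime_factor_nat)
  hence "p dvd s" using assms by (auto simp: in_prime_factors_iff)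
  thus False using p assms(2) by (metis coprime_common_divisor not_prime_unit)
qed

text \<open>
  Restricting \<open>f\<close> to the integers prime to \<open>s\<close> divides its Dirichlet series by the Euler factors
  at the primes dividing \<open>s\<close>, i.e.\ it multiplies it by the corresponding factors of the inverse.
\<close>

lemma coprime_restriction:
  assumes f: "f \<in> class_C" and fg: "dirichlet_inverses f g" and n: "n > 0" and s: "s > 0"
  shows "(\<Sum>d | d dvd n. if prime_factors d \<subseteq> prime_factors s then g d * f (n div d) else 0) = (if coprime n s then f n else 0)"
proof -
  obtain u v where uv: "n = u * v" "prime_factors u \<subseteq> prime_factors s" "coprime v s" "u > 0" "v > 0"
    using smooth_coprime_decomposition[OF n s] .
  \<comment> \<open>The divisors of \<open>n\<close> composed of primes of \<open>s\<close> are
    exactly the divisors of \<open>u\<close>. The sum therefore becomes the convolution of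
    \<open>g\<close> and \<open>f\<close> at \<open>u\<close>, times \<open>f v\<close>, and it
    vanishes unless \<open>u = 1\<close>.\<close>
  have sub: "d dvd u \<longleftrightarrow> d dvd n \<and> prime_factors d \<subseteq> prime_factors s" for d
  proof
    assume "d dvd u"
    thus "d dvd n \<and> prime_factors d \<subseteq> prime_factors s"
      using uv dvd_prime_factors[of u d] by auto
  next
    assume d: "d dvd n \<and> prime_factors d \<subseteq> prime_factors s"
    hence "d > 0" using n by (auto intro: Nat.gr0I)
    hence "coprime d v" using d uv by (intro smooth_imp_coprime[of d s]) auto
    thus "d dvd u" using d uv by (simp add: coprime_dvd_mult_left_iff)
  qed
  have "(\<Sum>d | d dvd n. if prime_factors d \<subseteq> prime_factors s then g d * f (n div d) else 0)
      = (\<Sum>d | d dvd u. g d * f (n div d))"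
    using n by (intro sum.mono_neutral_cong_right) (auto simp: sub finite_divisors_nat)
  also have "\<dots> = (\<Sum>d | d dvd u. g d * f (u div d)) * f v"
    unfolding sum_distrib_right
  proof (intro sum.cong refl)
    fix d assume "d \<in> {d. d dvd u}"
    then obtain e where e: "u = d * e" by blast
    hence de: "d > 0" "e > 0" using uv by auto
    have "coprime e v" using e uv(2-5) smooth_imp_coprime[OF uv(2,3,4)] by simp
    hence "f (e * v) = f e * f v" using f de uv by (intro class_C_mult)
    thus "g d * f (n div d) = g d * f (u div d) * f v" using e de uv(1) by (simp add: mult.assoc)
  qed
  also have "\<dots> = (if u = 1 then 1 else 0) * f v" using fg uv by (simp add: dirichlet_inverses_def)
  also have u1: "u = 1 \<longleftrightarrow> coprime n s"
  proof
    assume "coprime n s"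
    hence "coprime u s" using uv(1) by simp
    hence "coprime u u" using uv by (intro smooth_imp_coprime[of u s u])
    thus "u = 1" by simp
  qed (use uv in auto)
  finally show ?thesis using uv(1) u1 by (cases "coprime n s") auto
qed

text \<open>A completely multiplicative twist passes through the convolution. The gain is that the
  inner sums over \<open>e\<close> carry no coprimality condition, so that a bound for plain twisted
  sums of \<open>f\<close> applies to them.\<close>

lemma sum_coprime_restriction:
  fixes \<eta> :: "nat \<Rightarrow> complex"
  assumes "f \<in> class_C" "dirichlet_inverses f g" "s > 0" "\<And>m n. \<eta> (m * n) = \<eta> m * \<eta> n"
  shows "(\<Sum>n = 1..N. if coprime n s then f n * \<eta> n else 0)
    = (\<Sum>d | d \<in> {1..N} \<and> prime_factors d \<subseteq> prime_factors s. g d * \<eta> d * (\<Sum>e = 1..N div d. f e * \<eta> e))"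
proof -
  have "(\<Sum>n = 1..N. if coprime n s then f n * \<eta> n else 0)
      = (\<Sum>n = 1..N. \<Sum>d | d dvd n. if prime_factors d \<subseteq> prime_factors s then g d * \<eta> d * (f (n div d) * \<eta> (n div d)) else 0)"
  proof (intro sum.cong refl)
    fix n assume "n \<in> {1..N}"
    hence n: "n > 0" by simp
    have "(\<Sum>d | d dvd n. if prime_factors d \<subseteq> prime_factors s then g d * \<eta> d * (f (n div d) * \<eta> (n div d)) else 0)
        = (\<Sum>d | d dvd n. if prime_factors d \<subseteq> prime_factors s then g d * f (n div d) else 0) * \<eta> n"
      unfolding sum_distrib_right
    proof (intro sum.cong refl)
      fix d assume "d \<in> {d. d dvd n}"
      hence "\<eta> n = \<eta> d * \<eta> (n div d)" by (simp flip: assms(4))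
      thus "(if prime_factors d \<subseteq> prime_factors s then g d * \<eta> d * (f (n div d) * \<eta> (n div d)) else 0)
        = (if prime_factors d \<subseteq> prime_factors s then g d * f (n div d) else 0) * \<eta> n" by (simp add: mult_ac)
    qed
    thus "(if coprime n s then f n * \<eta> n else 0)
        = (\<Sum>d | d dvd n. if prime_factors d \<subseteq> prime_factors s then g d * \<eta> d * (f (n div d) * \<eta> (n div d)) else 0)"
      by (simp add: coprime_restriction[OF assms(1,2) n assms(3)])
  qed
  also have "\<dots> = (\<Sum>d = 1..N. \<Sum>e = 1..N div d. if prime_factors d \<subseteq> prime_factors s then g d * \<eta> d * (f e * \<eta> e) else 0)"
    by (rule sum_divisors_hyperbola)
  also have "\<dots> = (\<Sum>d = 1..N. if prime_factors d \<subseteq> prime_factors s then g d * \<eta> d * (\<Sum>e = 1..N div d. f e * \<eta> e) else 0)"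
    by (intro sum.cong refl) (auto simp: sum_distrib_left)
  also have "\<dots> = (\<Sum>d | d \<in> {1..N} \<and> prime_factors d \<subseteq> prime_factors s. g d * \<eta> d * (\<Sum>e = 1..N div d. f e * \<eta> e))"
    by (intro sum.mono_neutral_cong_right) auto
  finally show ?thesis .
qed

section \<open>From the identity of Dirichlet series to the convolution identity\<close>

text \<open>Of the exponent \<open>k\<close>, two units are kept for convergence and the other
  \<open>k - 2\<close> are bounded at N + 1. The point is that the factor in front of (N+1)^(-k)
  does not depend on \<open>k\<close>.\<close>

lemma dirichlet_series_tail:
  assumes "\<And>n. n > 0 \<Longrightarrow> norm (f n) \<le> 1" "k \<ge> 2"
  shows "norm (dirichlet_series f (of_nat k) - (\<Sum>n = 1..N. f n / of_nat n ^ k))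
    \<le> (\<Sum>n. 1 / (real (Suc n))\<^sup>2) * (real (Suc N))\<^sup>2 / real (Suc N) ^ k"
proof -
  define a where "a = (\<lambda>n. f (Suc n) / of_nat (Suc n) ^ k)"
  have Z: "summable (\<lambda>n. 1 / (real (Suc n))\<^sup>2)"
    using inverse_power_summable[of 2, where 'a = real] by (subst summable_Suc_iff) (simp add: inverse_eq_divide)
  have an: "norm (a (n + N)) \<le> 1 / (real (Suc n))\<^sup>2 * ((real (Suc N))\<^sup>2 / real (Suc N) ^ k)" for n N
  proof -
    have "norm (a (n + N)) \<le> 1 / real (Suc (n + N)) ^ k"
      unfolding a_def norm_divide norm_power norm_of_nat using assms(1)[of "Suc (n + N)"] by (intro divide_right_mono) auto
    also have "\<dots> = 1 / (real (Suc (n + N)))\<^sup>2 * (1 / real (Suc (n + N)) ^ (k - 2))"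
    proof -
      have "x ^ k = x\<^sup>2 * x ^ (k - 2)" for x :: real using assms(2) by (metis le_add_diff_inverse power_add)
      thus ?thesis by simp
    qed
    also have "\<dots> \<le> 1 / (real (Suc n))\<^sup>2 * (1 / real (Suc N) ^ (k - 2))"
      by (intro mult_mono divide_left_mono power_mono mult_pos_pos) auto
    also have "1 / real (Suc N) ^ (k - 2) = (real (Suc N))\<^sup>2 / real (Suc N) ^ k"
    proof -
      have "real (Suc N) ^ k = (real (Suc N))\<^sup>2 * real (Suc N) ^ (k - 2)"
        using assms(2) by (metis le_add_diff_inverse power_add)
      thus ?thesis by simp
    qed
    finally show ?thesis .
  qed
  have sN: "summable (\<lambda>n. a (n + N))"
    by (rule summable_comparison_test'[OF summable_mult2[OF Z] an])
  hence s: "summable a" using summable_iff_shift[of a N] by simp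
  have "dirichlet_series f (of_nat k) = suminf a"
    unfolding dirichlet_series_def a_def by (intro suminf_cong) (subst powr_nat', auto simp del: of_nat_Suc)
  also have "\<dots> = (\<Sum>n. a (n + N)) + (\<Sum>n<N. a n)" by (rule suminf_split_initial_segment[OF s])
  also have "(\<Sum>n<N. a n) = (\<Sum>n = 1..N. f n / of_nat n ^ k)"
    unfolding a_def by (rule sum.reindex_bij_witness[of _ "\<lambda>n. n - 1" Suc]) auto
  finally have "norm (dirichlet_series f (of_nat k) - (\<Sum>n = 1..N. f n / of_nat n ^ k)) = norm (\<Sum>n. a (n + N))" by simp
  also have "\<dots> \<le> (\<Sum>n. 1 / (real (Suc n))\<^sup>2 * ((real (Suc N))\<^sup>2 / real (Suc N) ^ k))"
    by (intro norm_suminf_le an summable_mult2 Z)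
  also have "\<dots> = (\<Sum>n. 1 / (real (Suc n))\<^sup>2) * ((real (Suc N))\<^sup>2 / real (Suc N) ^ k)"
    by (rule suminf_mult2[symmetric, OF Z])
  finally show ?thesis by simp
qed

text \<open>Uniqueness of Dirichlet coefficients, read off at integers s = k tending to infinity. If
  the coefficients of G F below N are those of 1 and the one at N is wrong by e, then |e| / N^k is
  at most a constant over (N+1)^k, and e = 0 in the limit.\<close>

lemma dirichlet_series_inverse_imp:
  assumes bd: "\<And>n. n > 0 \<Longrightarrow> norm (f n) \<le> 1" "\<And>n. n > 0 \<Longrightarrow> norm (g n) \<le> 1"
    and FG: "\<And>s. Re s > 1 \<Longrightarrow> dirichlet_series f s * dirichlet_series g s = 1"
  shows "dirichlet_inverses f g"
  unfolding dirichlet_inverses_def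
proof (intro allI impI)
  fix n :: nat assume "n > 0"
  thus "(\<Sum>d | d dvd n. g d * f (n div d)) = (if n = 1 then 1 else 0)"
  proof (induction n rule: less_induct)
    case (less N)
    define c where "c = (\<lambda>n. \<Sum>d | d dvd n. g d * f (n div d))"
    define e where "e = c N - (if N = 1 then 1 else 0)"
    define T where "T = (\<Sum>n. 1 / (real (Suc n))\<^sup>2) * (real (Suc N))\<^sup>2"
    have T: "T \<ge> 0" unfolding T_def
      using inverse_power_summable[of 2, where 'a = real]
      by (intro mult_nonneg_nonneg suminf_nonneg) (subst summable_Suc_iff, simp_all add: inverse_eq_divide)
    \<comment> \<open>The first two terms come from truncating F and G at N, the last one from the
      at most N^2 pairs with product greater than N.\<close>
    define K where "K = 2 * real N * T + T * T + (real N)\<^sup>2"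
    have main: "norm e \<le> K * (real N / real (Suc N)) ^ k" if k: "k \<ge> 2" for k
    proof -
      define P where "P = (\<Sum>n = 1..N. f n / of_nat n ^ k)"
      define R where "R = (\<Sum>n = 1..N. g n / of_nat n ^ k)"
      define F where "F = dirichlet_series f (of_nat k)"
      define G where "G = dirichlet_series g (of_nat k)"
      define y where "y = 1 / real (Suc N) ^ k"
      have y: "0 \<le> y" "y \<le> 1" by (auto simp: y_def)
      have FP: "norm (F - P) \<le> T * y" and GR: "norm (G - R) \<le> T * y"
        using dirichlet_series_tail[of f k N, OF bd(1) k] dirichlet_series_tail[of g k N, OF bd(2) k]
        by (simp_all add: F_def P_def G_def R_def T_def y_def)
      have bound: "norm (\<Sum>n = 1..N. h n / of_nat n ^ k) \<le> real N" if "\<And>n. n > 0 \<Longrightarrow> norm (h n :: complex) \<le> 1" for h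
      proof -
        have "norm (\<Sum>n = 1..N. h n / of_nat n ^ k) \<le> (\<Sum>n = 1..N. 1)"
        proof (rule sum_norm_le)
          fix n assume n: "n \<in> {1..N}"
          have "norm (h n / of_nat n ^ k) \<le> 1 / 1"
            unfolding norm_divide norm_power norm_of_nat using n that[of n] by (intro frac_le one_le_power) auto
          thus "norm (h n / of_nat n ^ k) \<le> 1" by simp
        qed
        thus ?thesis by simp
      qed
      have "F * G = 1" unfolding F_def G_def using k by (intro FG) simp
      hence PR: "P * R - 1 = - ((F - P) * R + P * (G - R) + (F - P) * (G - R))" by (simp add: algebra_simps)
      have "norm (P * R - 1) \<le> norm (F - P) * norm R + norm P * norm (G - R) + norm (F - P) * norm (G - R)"
        unfolding PR norm_minus_cancel norm_mult[symmetric]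
        by (rule order.trans[OF norm_triangle_ineq add_right_mono[OF norm_triangle_ineq]])
      also have "\<dots> \<le> (T * y) * real N + real N * (T * y) + (T * y) * (T * 1)"
      proof (intro add_mono mult_mono)
        show "norm P \<le> real N" "norm R \<le> real N"
          unfolding P_def R_def by (rule bound, erule bd)+
        have "T * y \<le> T * 1" using y T by (intro mult_left_mono)
        thus "norm (G - R) \<le> T * 1" using GR by linarith
      qed (use FP GR y T in auto)
      finally have 1: "norm (P * R - 1) \<le> (2 * real N * T + T * T) * y" by (simp add: algebra_simps)
      define z where "z = (\<lambda>(d, m). g d * f m / (of_nat d ^ k * of_nat m ^ k))"
      have "P * R = (\<Sum>d = 1..N. \<Sum>m = 1..N. z (d, m))"
        unfolding P_def R_def z_def by (subst mult.commute) (simp add: sum_product)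
      also have "\<dots> = (\<Sum>w\<in>{1..N} \<times> {1..N}. z w)" by (simp add: sum.cartesian_product)
      also have "\<dots> = (\<Sum>w\<in>(SIGMA d:{1..N}. {1..N div d}). z w) + (\<Sum>w\<in>{1..N} \<times> {1..N} - (SIGMA d:{1..N}. {1..N div d}). z w)"
        by (subst add.commute, intro sum.subset_diff)
           (auto intro: order.trans[OF _ div_le_dividend])
      also have "(\<Sum>w\<in>(SIGMA d:{1..N}. {1..N div d}). z w) = (\<Sum>d = 1..N. \<Sum>m = 1..N div d. z (d, m))"
        by (subst sum.Sigma) auto
      also have "\<dots> = (\<Sum>n = 1..N. \<Sum>d | d dvd n. z (d, n div d))"
        by (rule sum_divisors_hyperbola[symmetric])
      also have "\<dots> = (\<Sum>n = 1..N. c n / of_nat n ^ k)"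
      proof (intro sum.cong refl)
        fix n assume n: "n \<in> {1..N}"
        show "(\<Sum>d | d dvd n. z (d, n div d)) = c n / of_nat n ^ k"
          unfolding c_def sum_divide_distrib
        proof (intro sum.cong refl)
          fix d assume "d \<in> {d. d dvd n}"
          hence "n = d * (n div d)" by simp
          hence "(of_nat n :: complex) ^ k = of_nat d ^ k * of_nat (n div d) ^ k"
            by (metis of_nat_mult power_mult_distrib)
          thus "z (d, n div d) = g d * f (n div d) / of_nat n ^ k" by (simp add: z_def)
        qed
      qed
      also have "\<dots> = (\<Sum>n = 1..N. (if n = 1 then 1 else 0) + (if n = N then e / of_nat N ^ k else 0))"
      proof (intro sum.cong refl)
        fix n assume n: "n \<in> {1..N}"
        show "c n / of_nat n ^ k = (if n = 1 then 1 else 0) + (if n = N then e / of_nat N ^ k else 0)"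
        proof (cases "n = N")
          case True
          thus ?thesis using less.prems by (auto simp: e_def diff_divide_distrib)
        next
          case False
          hence "c n = (if n = 1 then 1 else 0)" unfolding c_def using n by (intro less.IH) auto
          thus ?thesis using False by auto
        qed
      qed
      also have "\<dots> = 1 + e / of_nat N ^ k" using less.prems by (simp add: sum.distrib)
      finally have "e / of_nat N ^ k = (P * R - 1) - (\<Sum>w\<in>{1..N} \<times> {1..N} - (SIGMA d:{1..N}. {1..N div d}). z w)" by simp
      also have "norm \<dots> \<le> norm (P * R - 1) + norm (\<Sum>w\<in>{1..N} \<times> {1..N} - (SIGMA d:{1..N}. {1..N div d}). z w)"
        by (rule norm_triangle_ineq4)
      also have "norm (\<Sum>w\<in>{1..N} \<times> {1..N} - (SIGMA d:{1..N}. {1..N div d}). z w) \<le> (real N)\<^sup>2 * y"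
      proof -
        have "norm (\<Sum>w\<in>{1..N} \<times> {1..N} - (SIGMA d:{1..N}. {1..N div d}). z w)
            \<le> (\<Sum>w\<in>{1..N} \<times> {1..N} - (SIGMA d:{1..N}. {1..N div d}). y)"
        proof (rule sum_norm_le)
          fix w assume w0: "w \<in> {1..N} \<times> {1..N} - (SIGMA d:{1..N}. {1..N div d})"
          obtain d m where wdm: "w = (d, m)" by (cases w)
          have w: "w = (d, m)" "d \<in> {1..N}" "m \<in> {1..N}" "\<not> m \<le> N div d"
            using w0 unfolding wdm by auto
          hence dm: "Suc N \<le> d * m" by (auto simp: less_eq_div_iff_mult_less_eq mult.commute not_le)
          have "norm (z w) = norm (g d) * norm (f m) / real (d * m) ^ k"
            by (simp add: z_def w norm_divide norm_mult norm_power power_mult_distrib)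
          also have "\<dots> \<le> 1 / real (Suc N) ^ k"
          proof (rule frac_le)
            show "norm (g d) * norm (f m) \<le> 1" using bd(1)[of m] bd(2)[of d] w by (intro mult_le_one) auto
            show "real (Suc N) ^ k \<le> real (d * m) ^ k" using dm by (intro power_mono) (simp_all only: of_nat_le_iff of_nat_0_le_iff)
          qed auto
          finally show "norm (z w) \<le> y" by (simp add: y_def)
        qed
        also have "\<dots> \<le> (\<Sum>w\<in>{1..N} \<times> {1..N}. y)" using y by (intro sum_mono2) auto
        finally show ?thesis by (simp add: power2_eq_square)
      qed
      also have "norm (P * R - 1) + (real N)\<^sup>2 * y \<le> K * y" using 1 by (simp add: K_def algebra_simps)
      finally have "norm e / real N ^ k \<le> K / real (Suc N) ^ k" by (simp add: norm_divide norm_power y_def)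
      thus ?thesis using less.prems by (simp add: power_divide field_simps)
    qed
    have "(\<lambda>k. K * (real N / real (Suc N)) ^ k) \<longlonglongrightarrow> K * 0"
      by (intro tendsto_mult tendsto_const LIMSEQ_power_zero) auto
    hence "norm e \<le> K * 0"
      by (rule tendsto_lowerbound) (use main in \<open>auto simp: eventually_at_top_linorder\<close>)
    thus ?case by (simp add: e_def c_def)
  qed
qed

section \<open>The kernel of the discrepancy and Type I sums\<close>


text \<open>The kernel of \<Delta>: the indicator of the class of \<open>a\<close> minus its
  projection to the characters in \<Xi>_q, so that \<Delta> is the sum of \<open>h n\<close> against
  it. In this form \<Delta> can be manipulated before the sequence is fixed.\<close>

definition kappa :: "(nat \<Rightarrow> complex) set \<Rightarrow> nat \<Rightarrow> nat \<Rightarrow> nat \<Rightarrow> complex" where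
  "kappa \<Xi> q a n = (if [n = a] (mod q) then 1 else 0) -
     1 / of_nat (totient q) * (\<Sum>\<eta>\<in>induced_chars \<Xi> q. \<eta> a * cnj (\<eta> n))"

lemma induced_chars_subset: "induced_chars \<Xi> q \<subseteq> chars q"
  by (auto simp: induced_chars_def induced_by_def chars_def)

lemma induced_chars_dirichlet_char: "\<eta> \<in> induced_chars \<Xi> q \<Longrightarrow> dirichlet_char q \<eta>"
  using induced_chars_subset by (auto simp: chars_def)

lemma card_induced_chars_le:
  assumes "finite \<Xi>"
  shows "card (induced_chars \<Xi> q) \<le> card \<Xi>"
proof -
  have "induced_chars \<Xi> q \<subseteq> (\<lambda>\<psi> n. if coprime n q then \<psi> n else 0) ` \<Xi>"
  proof
    fix \<eta> assume "\<eta> \<in> induced_chars \<Xi> q"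
    then obtain \<psi> d where "\<psi> \<in> \<Xi>" "induced_by q \<eta> d \<psi>" by (auto simp: induced_chars_def)
    moreover from this have "\<eta> = (\<lambda>n. if coprime n q then \<psi> n else 0)"
      by (intro ext) (auto simp: induced_by_def dirichlet_char_eq_0_iff)
    ultimately show "\<eta> \<in> (\<lambda>\<psi> n. if coprime n q then \<psi> n else 0) ` \<Xi>" by blast
  qed
  thus ?thesis using assms by (meson card_image_le card_mono finite_imageI order_trans)
qed

lemma nat_interval_floor: "{n. 1 \<le> n \<and> real n \<le> X} = {1..nat \<lfloor>X\<rfloor>}"
proof -
  have "n \<ge> 1 \<and> real n \<le> X \<longleftrightarrow> n \<in> {1..nat \<lfloor>X\<rfloor>}" for n :: nat
    by (cases "X < 0") (auto simp: le_nat_iff le_floor_iff)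
  thus ?thesis by blast
qed

lemma Delta_eq_kappa_sum: "Delta \<Xi> u X q a = (\<Sum>n = 1..nat \<lfloor>X\<rfloor>. u n * kappa \<Xi> q a n)"
proof -
  have "(\<Sum>\<eta>\<in>induced_chars \<Xi> q. \<eta> a * char_sum u X \<eta>) = (\<Sum>n = 1..nat \<lfloor>X\<rfloor>. u n * (\<Sum>\<eta>\<in>induced_chars \<Xi> q. \<eta> a * cnj (\<eta> n)))"
    unfolding char_sum_def nat_interval_floor sum_distrib_left by (subst sum.swap) (simp add: mult_ac)
  moreover have "(\<Sum>n | 1 \<le> n \<and> real n \<le> X \<and> [n = a] (mod q). u n) = (\<Sum>n = 1..nat \<lfloor>X\<rfloor>. u n * (if [n = a] (mod q) then 1 else 0))"
  proof -
    have "{n. 1 \<le> n \<and> real n \<le> X \<and> [n = a] (mod q)} = {n \<in> {1..nat \<lfloor>X\<rfloor>}. [n = a] (mod q)}"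
      using nat_interval_floor[of X] by blast
    thus ?thesis by (simp only: sum.inter_filter finite_atLeastAtMost) (intro sum.cong, auto)
  qed
  ultimately show ?thesis
    by (simp add: Delta_def kappa_def right_diff_distrib sum_subtractf sum_distrib_left mult_ac)
qed

lemma kappa_cong:
  assumes "[a = b] (mod q)"
  shows "kappa \<Xi> q a n = kappa \<Xi> q b n"
proof -
  have "[n = a] (mod q) \<longleftrightarrow> [n = b] (mod q)" using assms by (metis cong_sym cong_trans)
  moreover have "(\<Sum>\<eta>\<in>induced_chars \<Xi> q. \<eta> a * cnj (\<eta> n)) = (\<Sum>\<eta>\<in>induced_chars \<Xi> q. \<eta> b * cnj (\<eta> n))"
    using dirichlet_char_cong[OF induced_chars_dirichlet_char assms] by (intro sum.cong) auto
  ultimately show ?thesis by (simp add: kappa_def)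
qed

text \<open>Both parts of the kernel are unchanged when the class and the argument are multiplied by
  the same unit; \<open>b\<close> is the class of a/m.\<close>

lemma kappa_mult:
  assumes "coprime m q" "[b * m = a] (mod q)"
  shows "kappa \<Xi> q a (m * n) = kappa \<Xi> q b n"
proof -
  have "kappa \<Xi> q a (m * n) = kappa \<Xi> q (b * m) (m * n)" by (rule kappa_cong[OF cong_sym[OF assms(2)]])
  also have "\<dots> = kappa \<Xi> q b n"
  proof -
    have "[m * n = b * m] (mod q) \<longleftrightarrow> [n = b] (mod q)"
      using cong_mult_rcancel_nat[OF assms(1), of n b] by (simp add: mult.commute)
    moreover have "(\<Sum>\<eta>\<in>induced_chars \<Xi> q. \<eta> (b * m) * cnj (\<eta> (m * n))) = (\<Sum>\<eta>\<in>induced_chars \<Xi> q. \<eta> b * cnj (\<eta> n))"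
    proof (intro sum.cong refl)
      fix \<eta> assume "\<eta> \<in> induced_chars \<Xi> q"
      hence d: "dirichlet_char q \<eta>" by (rule induced_chars_dirichlet_char)
      have "\<eta> (b * m) * cnj (\<eta> (m * n)) = (\<eta> m * cnj (\<eta> m)) * (\<eta> b * cnj (\<eta> n))"
        using d by (simp add: dirichlet_char_mult mult_ac)
      thus "\<eta> (b * m) * cnj (\<eta> (m * n)) = \<eta> b * cnj (\<eta> n)"
        using dirichlet_char_mult_cnj[OF d, of m] assms(1) by simp
    qed
    ultimately show ?thesis by (simp add: kappa_def)
  qed
  finally show ?thesis .
qed

lemma kappa_not_coprime:
  assumes "\<not> coprime n q" "coprime a q"
  shows "kappa \<Xi> q a n = 0"
proof -
  have "\<not> [n = a] (mod q)" using assms by (metis cong_imp_coprime cong_sym)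
  moreover have "(\<Sum>\<eta>\<in>induced_chars \<Xi> q. \<eta> a * cnj (\<eta> n)) = 0"
    using assms by (intro sum.neutral) (auto simp: dirichlet_char_eq_0_iff dest: induced_chars_dirichlet_char)
  ultimately show ?thesis by (simp add: kappa_def)
qed

text \<open>By orthogonality the indicator of the class is the average over all characters mod
  \<open>q\<close>, from which the kernel removes those in \<Xi>_q.\<close>

lemma kappa_eq_char_sum:
  assumes "q > 0" "coprime a q"
  shows "kappa \<Xi> q a n = 1 / of_nat (totient q) * (\<Sum>\<eta>\<in>chars q - induced_chars \<Xi> q. \<eta> a * cnj (\<eta> n))"
proof -
  have "(if [n = a] (mod q) then 1 else 0) = 1 / of_nat (totient q) * (\<Sum>\<eta>\<in>chars q. \<eta> a * cnj (\<eta> n))"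
    using assms by (simp add: chars_orthogonality)
  thus ?thesis
    by (simp add: kappa_def sum_diff[OF finite_chars induced_chars_subset] right_diff_distrib)
qed

lemma norm_kappa_le:
  assumes "finite \<Xi>"
  shows "norm (kappa \<Xi> q a n) \<le> (if [n = a] (mod q) then 1 else 0) + real (card \<Xi>) / real (totient q)"
proof -
  have "norm (\<Sum>\<eta>\<in>induced_chars \<Xi> q. \<eta> a * cnj (\<eta> n)) \<le> (\<Sum>\<eta>\<in>induced_chars \<Xi> q. 1)"
    using norm_dirichlet_char_le_1[OF induced_chars_dirichlet_char]
    by (intro sum_norm_le) (auto simp: norm_mult intro!: mult_le_one)
  also have "\<dots> \<le> real (card \<Xi>)" using card_induced_chars_le[OF assms, of q] by simp
  finally have "norm (1 / of_nat (totient q) * (\<Sum>\<eta>\<in>induced_chars \<Xi> q. \<eta> a * cnj (\<eta> n))) \<le> real (card \<Xi>) / real (totient q)"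
    by (simp add: norm_mult norm_divide divide_right_mono)
  thus ?thesis unfolding kappa_def
    by (intro order.trans[OF norm_triangle_ineq4] add_mono) auto
qed

section \<open>Sums over moduli of maxima over residue classes\<close>

definition sum_max :: "nat \<Rightarrow> (nat \<Rightarrow> nat \<Rightarrow> real) \<Rightarrow> real" where
  "sum_max N T = (\<Sum>q = 1..N. Max (T q ` totatives q))"

lemma sum_max_Delta_eq: "sum_max_Delta \<Xi> h X Q = sum_max (nat \<lfloor>Q\<rfloor>) (\<lambda>q a. norm (Delta \<Xi> h X q a))"
  unfolding sum_max_Delta_def sum_max_def nat_interval_floor ..

lemma Max_totatives_leI:
  assumes "q > 0" "\<And>a. a \<in> totatives q \<Longrightarrow> T a \<le> (B::real)"
  shows "Max (T ` totatives q) \<le> B"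
  using assms by (subst Max_le_iff) (auto simp: totatives_eq_empty_iff)

lemma Max_totatives_ge: "a \<in> totatives q \<Longrightarrow> T a \<le> Max (T ` totatives q :: real set)"
  by (intro Max_ge) auto

lemma sum_max_leI:
  assumes "\<And>q a. q \<in> {1..N} \<Longrightarrow> a \<in> totatives q \<Longrightarrow> T q a \<le> B q"
  shows "sum_max N T \<le> (\<Sum>q = 1..N. B q)"
  unfolding sum_max_def using assms by (intro sum_mono Max_totatives_leI) auto

lemma sum_max_mono:
  assumes "\<And>q a. q \<in> {1..N} \<Longrightarrow> a \<in> totatives q \<Longrightarrow> T q a \<le> U q a"
  shows "sum_max N T \<le> sum_max N U"
  unfolding sum_max_def[of N U]
  using assms Max_totatives_ge by (intro sum_max_leI) (meson order.trans)

text \<open>The class \<open>b i\<close> may depend on the index and differ from \<open>a\<close>.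
  This is what absorbs the change of class caused by a short factor \<open>m\<close>.\<close>

lemma sum_max_le_weighted:
  fixes T :: "nat \<Rightarrow> nat \<Rightarrow> real" and S :: "'i \<Rightarrow> nat \<Rightarrow> nat \<Rightarrow> real"
  assumes "\<And>q a. q \<in> {1..N} \<Longrightarrow> a \<in> totatives q \<Longrightarrow> \<exists>b. (\<forall>i. b i \<in> totatives q) \<and> T q a \<le> (\<Sum>i\<in>I. c i * S i q (b i))"
    "\<And>i. i \<in> I \<Longrightarrow> c i \<ge> 0"
  shows "sum_max N T \<le> (\<Sum>i\<in>I. c i * sum_max N (S i))"
proof -
  have "sum_max N T \<le> (\<Sum>q = 1..N. \<Sum>i\<in>I. c i * Max (S i q ` totatives q))"
  proof (rule sum_max_leI)
    fix q a assume "q \<in> {1..N}" "a \<in> totatives q"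
    then obtain b where b: "\<And>i. b i \<in> totatives q" "T q a \<le> (\<Sum>i\<in>I. c i * S i q (b i))" using assms(1) by blast
    note b(2)
    also have "(\<Sum>i\<in>I. c i * S i q (b i)) \<le> (\<Sum>i\<in>I. c i * Max (S i q ` totatives q))"
      using assms(2) b(1) by (intro sum_mono mult_left_mono Max_totatives_ge) auto
    finally show "T q a \<le> (\<Sum>i\<in>I. c i * Max (S i q ` totatives q))" .
  qed
  also have "\<dots> = (\<Sum>i\<in>I. c i * sum_max N (S i))"
    unfolding sum_max_def sum_distrib_left by (rule sum.swap)
  finally show ?thesis .
qed

lemma sum_max_add: "sum_max N (\<lambda>q a. T q a + U q a) \<le> sum_max N T + sum_max N U"
  unfolding sum_max_def sum.distrib[symmetric]
  by (intro sum_mono Max_totatives_leI add_mono Max_totatives_ge) auto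

lemma sum_max_sum:
  "sum_max N (\<lambda>q a. \<Sum>i\<in>I. S i q a) \<le> (\<Sum>i\<in>I. sum_max N (S i))"
  using sum_max_le_weighted[where T = "\<lambda>q a. \<Sum>i\<in>I. S i q a" and I = I and c = "\<lambda>_. 1" and S = S and N = N] by fastforce

lemma totative_solution:
  assumes "coprime m q" "coprime a q" "q > 0"
  obtains b where "b \<in> totatives q" "[b * m = a] (mod q)"
proof -
  obtain v where v: "coprime v q" "[m * v = 1] (mod q)" using cong_inverse_nat[OF assms(1,3)] by blast
  have "[a * v * m = a] (mod q)"
    using cong_mult[OF cong_refl[of a] v(2)] by (simp add: mult_ac)
  moreover have "\<exists>b\<in>totatives q. [b = a * v] (mod q)"
  proof (cases "q = 1")
    case False
    have "coprime ((a * v) mod q) q" using assms v by simp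
    moreover from this have "(a * v) mod q \<noteq> 0" using False by (metis coprime_0_left_iff nat_dvd_1_iff_1)
    ultimately have "(a * v) mod q \<in> totatives q"
      using assms(3) by (auto simp: totatives_def intro: less_imp_le)
    thus ?thesis by (intro bexI) (auto simp: cong_def)
  qed auto
  ultimately show thesis using that by (metis cong_mult cong_refl cong_trans)
qed

text \<open>
  The weight on the long variable is removed by partial summation, and the short variable \<open>m\<close> merely permutes the residue classes.
\<close>

lemma type_I_bound:
  fixes w :: "nat \<Rightarrow> real" and u :: "nat \<Rightarrow> complex"
  assumes w: "mono_on {a<..b} w \<or> antimono_on {a<..b} w" "\<And>n. a < n \<Longrightarrow> n \<le> b \<Longrightarrow> 0 \<le> w n \<and> w n \<le> 1"
    and B: "\<And>k. a \<le> k \<Longrightarrow> k \<le> b \<Longrightarrow> sum_max N (\<lambda>q r. norm (Delta \<Xi> u (real k) q r)) \<le> B" and "B \<ge> 0"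
  shows "sum_max N (\<lambda>q r. norm (\<Sum>n\<in>{a<..b}. of_real (w n) * u n * kappa \<Xi> q r (m * n))) \<le> 2 * B"
proof -
  obtain c where c: "\<And>u :: nat \<Rightarrow> complex. (\<Sum>n\<in>{a<..b}. of_real (w n) * u n) = (\<Sum>k\<in>{a..b}. of_real (c k) * (\<Sum>n = 1..k. u n))"
    "(\<Sum>k\<in>{a..b}. \<bar>c k\<bar>) \<le> 2" using monotone_abel_summation[OF w] by blast
  have "sum_max N (\<lambda>q r. norm (\<Sum>n\<in>{a<..b}. of_real (w n) * u n * kappa \<Xi> q r (m * n)))
      \<le> (\<Sum>k\<in>{a..b}. \<bar>c k\<bar> * sum_max N (\<lambda>q r. norm (Delta \<Xi> u (real k) q r)))"
  proof (rule sum_max_le_weighted)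
    fix q r assume q: "q \<in> {1..N}" and r: "r \<in> totatives q"
    have cop: "coprime r q" using r by (auto simp: totatives_def)
    show "\<exists>d. (\<forall>i. d i \<in> totatives q) \<and>
      norm (\<Sum>n\<in>{a<..b}. of_real (w n) * u n * kappa \<Xi> q r (m * n)) \<le> (\<Sum>k\<in>{a..b}. \<bar>c k\<bar> * norm (Delta \<Xi> u (real k) q (d k)))"
    proof (cases "coprime m q")
      case False
      hence "\<not> coprime (m * n) q" for n by auto
      hence "(\<Sum>n\<in>{a<..b}. of_real (w n) * u n * kappa \<Xi> q r (m * n)) = 0"
        using kappa_not_coprime[OF _ cop] by (intro sum.neutral) auto
      thus ?thesis using r by (intro exI[of _ "\<lambda>_. r"]) (auto intro!: sum_nonneg)
    next
      case True
      then obtain d where d: "d \<in> totatives q" "[d * m = r] (mod q)" using totative_solution[OF True cop] q by auto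
      have "(\<Sum>n\<in>{a<..b}. of_real (w n) * u n * kappa \<Xi> q r (m * n)) = (\<Sum>n\<in>{a<..b}. of_real (w n) * (u n * kappa \<Xi> q d n))"
        by (simp add: kappa_mult[OF True d(2)] mult.assoc)
      also have "\<dots> = (\<Sum>k\<in>{a..b}. of_real (c k) * Delta \<Xi> u (real k) q d)"
        unfolding c(1) Delta_eq_kappa_sum by simp
      also have "norm \<dots> \<le> (\<Sum>k\<in>{a..b}. \<bar>c k\<bar> * norm (Delta \<Xi> u (real k) q d))"
        by (rule order.trans[OF norm_sum]) (simp add: norm_mult)
      finally show ?thesis using d(1) by (intro exI[of _ "\<lambda>_. d"]) auto
    qed
  qed auto
  also have "\<dots> \<le> (\<Sum>k\<in>{a..b}. \<bar>c k\<bar> * B)" using B by (intro sum_mono mult_left_mono) auto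
  also have "\<dots> = (\<Sum>k\<in>{a..b}. \<bar>c k\<bar>) * B" by (simp add: sum_distrib_right)
  also have "\<dots> \<le> 2 * B" using c(2) assms(4) by (rule mult_right_mono)
  finally show ?thesis .
qed

lemma card_residue_class_le:
  assumes "q > 0"
  shows "card {n \<in> {1..N}. [n = a] (mod q)} \<le> N div q + 1"
proof -
  have "inj_on (\<lambda>n. n div q) {n \<in> {1..N}. [n = a] (mod q)}"
    by (rule inj_onI) (metis (mono_tags, lifting) cong_def div_mult_mod_eq mem_Collect_eq)
  moreover have "(\<lambda>n. n div q) ` {n \<in> {1..N}. [n = a] (mod q)} \<subseteq> {0..N div q}"
    by (auto intro: div_le_mono)
  ultimately have "card {n \<in> {1..N}. [n = a] (mod q)} \<le> card {0..N div q}"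
    by (intro card_inj_on_le[where f = "\<lambda>n. n div q"]) auto
  thus ?thesis by simp
qed

text \<open>Counting only: a residue class has at most N/q + 1 members, and each of the characters
  in \<Xi>_q contributes at most N/\<phi>(q). It serves on the initial segment that is too short for
  (ii).\<close>

lemma sum_max_Delta_trivial:
  assumes "finite \<Xi>" "\<And>n. n > 0 \<Longrightarrow> norm (u n) \<le> 1" "M > 0"
  shows "sum_max M (\<lambda>q a. norm (Delta \<Xi> u (real N) q a))
    \<le> real M + real N * (4 * (real (card \<Xi>) + 1) * (1 + ln (real M)))"
proof -
  have "sum_max M (\<lambda>q a. norm (Delta \<Xi> u (real N) q a))
      \<le> (\<Sum>q = 1..M. 1 + real N * (1 / real q) + real N * real (card \<Xi>) * (1 / real (totient q)))"
  proof (rule sum_max_leI)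
    fix q a assume q: "q \<in> {1..M}"
    have "norm (Delta \<Xi> u (real N) q a) \<le> (\<Sum>n = 1..N. (if [n = a] (mod q) then 1 else 0) + real (card \<Xi>) / real (totient q))"
      unfolding Delta_eq_kappa_sum floor_of_nat nat_int
    proof (rule sum_norm_le)
      fix n assume "n \<in> {1..N}"
      hence "norm (u n) * norm (kappa \<Xi> q a n) \<le> 1 * norm (kappa \<Xi> q a n)"
        using assms(2) by (intro mult_right_mono) auto
      thus "norm (u n * kappa \<Xi> q a n) \<le> (if [n = a] (mod q) then 1 else 0) + real (card \<Xi>) / real (totient q)"
        using norm_kappa_le[OF assms(1), of q a n] by (simp add: norm_mult)
    qed
    also have "\<dots> = real (card {n \<in> {1..N}. [n = a] (mod q)}) + real N * real (card \<Xi>) / real (totient q)"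
      by (simp add: sum.distrib sum.If_cases Int_def)
    also have "real (card {n \<in> {1..N}. [n = a] (mod q)}) \<le> real (N div q + 1)"
      using q by (simp only: of_nat_le_iff) (intro card_residue_class_le, auto)
    also have "real (N div q + 1) \<le> 1 + real N * (1 / real q)"
      using of_nat_div_le_of_nat[of N q, where 'a = real] by simp
    finally show "norm (Delta \<Xi> u (real N) q a) \<le> 1 + real N * (1 / real q) + real N * real (card \<Xi>) * (1 / real (totient q))"
      by simp
  qed
  also have "\<dots> = real M + real N * (\<Sum>q = 1..M. 1 / real q) + real N * real (card \<Xi>) * (\<Sum>q = 1..M. 1 / real (totient q))"
    by (simp only: sum.distrib sum_distrib_left[symmetric]) simp
  also have "\<dots> \<le> real M + real N * (1 + ln (real M)) + real N * real (card \<Xi>) * (4 * (1 + ln (real M)))"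
    by (intro add_mono mult_left_mono harmonic_sum_le sum_inverse_totient_le order_refl) (use assms in auto)
  also have "\<dots> \<le> real M + real N * (4 * (real (card \<Xi>) + 1) * (1 + ln (real M)))"
  proof -
    have "0 \<le> real N * (1 + ln (real M))" using assms(3) by (intro mult_nonneg_nonneg) auto
    thus ?thesis by (simp add: algebra_simps)
  qed
  finally show ?thesis .
qed

section \<open>Characters of small conductor\<close>


text \<open>Take the least modulus from which the character is induced; induction of characters is
  transitive, so the inducing character is primitive.\<close>

lemma primitive_inducer_exists:
  assumes "dirichlet_char q \<eta>"
  shows "\<exists>p. primitive_char (fst p) (snd p) \<and> induced_by q \<eta> (fst p) (snd p)"
proof -
  define P where "P = (\<lambda>d. \<exists>\<psi>. induced_by q \<eta> d \<psi>)"
  have "P q" using assms by (auto simp: P_def induced_by_def)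
  hence "P (LEAST d. P d)" by (rule LeastI)
  then obtain \<psi> where \<psi>: "induced_by q \<eta> (LEAST d. P d) \<psi>" by (auto simp: P_def)
  have "primitive_char (LEAST d. P d) \<psi>"
    unfolding primitive_char_def
  proof (intro conjI allI impI)
    show "dirichlet_char (LEAST d. P d) \<psi>" using \<psi> by (simp add: induced_by_def)
    fix d \<psi>' assume d: "induced_by (LEAST d. P d) \<psi> d \<psi>'"
    have "induced_by q \<eta> d \<psi>'"
      using \<psi> d unfolding induced_by_def by (metis coprime_divisors dvd_refl dvd_trans)
    hence "(LEAST d. P d) \<le> d" by (intro Least_le) (auto simp: P_def)
    moreover have "d \<le> (LEAST d. P d)" using d by (auto simp: induced_by_def dirichlet_char_def intro: dvd_imp_le)
    ultimately show "d = (LEAST d. P d)" by simp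
  qed
  thus ?thesis using \<psi> by (intro exI[of _ "((LEAST d. P d), \<psi>)"]) simp
qed

text \<open>The conductor together with the primitive character. Any choice serves, because
  \<open>q\<close> and the pair determine \<open>\<eta>\<close>.\<close>

definition primitive_inducer :: "nat \<Rightarrow> (nat \<Rightarrow> complex) \<Rightarrow> nat \<times> (nat \<Rightarrow> complex)" where
  "primitive_inducer q \<eta> = (SOME p. primitive_char (fst p) (snd p) \<and> induced_by q \<eta> (fst p) (snd p))"

lemma primitive_inducer_spec:
  assumes "dirichlet_char q \<eta>" "primitive_inducer q \<eta> = (r, \<psi>)"
  shows "primitive_char r \<psi>" "induced_by q \<eta> r \<psi>"
proof -
  have "primitive_char (fst (primitive_inducer q \<eta>)) (snd (primitive_inducer q \<eta>)) \<and>
      induced_by q \<eta> (fst (primitive_inducer q \<eta>)) (snd (primitive_inducer q \<eta>))"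
    unfolding primitive_inducer_def by (rule someI_ex[OF primitive_inducer_exists[OF assms(1)]])
  thus "primitive_char r \<psi>" "induced_by q \<eta> r \<psi>" using assms(2) by simp_all
qed

lemma induced_by_eq:
  assumes "induced_by q \<eta> r \<psi>"
  shows "\<eta> = (\<lambda>n. if coprime n q then \<psi> n else 0)"
  using assms by (intro ext) (auto simp: induced_by_def dirichlet_char_eq_0_iff)

lemma inj_on_primitive_inducer: "inj_on (primitive_inducer q) (chars q)"
proof (rule inj_onI)
  fix \<eta> \<eta>' assume h: "\<eta> \<in> chars q" "\<eta>' \<in> chars q" "primitive_inducer q \<eta> = primitive_inducer q \<eta>'"
  obtain r \<psi> where p: "primitive_inducer q \<eta> = (r, \<psi>)" by (cases "primitive_inducer q \<eta>")
  have ind: "induced_by q \<eta> r \<psi>" "induced_by q \<eta>' r \<psi>"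
    using primitive_inducer_spec(2)[of q _ r \<psi>] h p by (auto simp: chars_def)
  show "\<eta> = \<eta>'" by (rule trans[OF induced_by_eq[OF ind(1)] induced_by_eq[OF ind(2), symmetric]])
qed

text \<open>A primitive character induced by a member of \<Xi> is that member itself, and would put
  \<open>\<eta>\<close> into \<Xi>_q. Hence the discrepancy at the small modulus \<open>r\<close>,
  instead of \<open>q\<close>, controls the twisted sums with \<open>\<psi>\<close>.\<close>

lemma primitive_inducer_not_induced:
  assumes "dirichlet_char q \<eta>" "primitive_inducer q \<eta> = (r, \<psi>)" "\<eta> \<notin> induced_chars \<Xi> q"
  shows "\<psi> \<in> chars r - induced_chars \<Xi> r"
proof -
  note p = primitive_inducer_spec[OF assms(1,2)]
  have "\<psi> \<notin> induced_chars \<Xi> r"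
  proof
    assume "\<psi> \<in> induced_chars \<Xi> r"
    then obtain \<psi>' d where d: "\<psi>' \<in> \<Xi>" "primitive_char d \<psi>'" "induced_by r \<psi> d \<psi>'" by (auto simp: induced_chars_def)
    hence "d = r" using p by (auto simp: primitive_char_def)
    hence "\<psi> = (\<lambda>n. if coprime n r then \<psi>' n else 0)" using d induced_by_eq by blast
    also have "\<dots> = \<psi>'" using d \<open>d = r\<close> by (intro ext) (auto simp: induced_by_def dirichlet_char_eq_0_iff)
    finally show False using assms(3) d(1) p by (auto simp: induced_chars_def)
  qed
  thus ?thesis using p by (auto simp: chars_def primitive_char_def)
qed

lemma chars_orthogonality':
  assumes "dirichlet_char q \<eta>" "dirichlet_char q \<psi>"
  shows "(\<Sum>a<q. \<eta> a * cnj (\<psi> a)) = (if \<eta> = \<psi> then of_nat (totient q) else 0)"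
proof -
  have q: "q > 0" using assms dirichlet_char_pos by blast
  have "dirichlet_char q (\<lambda>n. \<eta> n * cnj (\<psi> n))"
    using assms by (intro dirichlet_char_times dirichlet_char_cnj)
  moreover have "(\<lambda>n. \<eta> n * cnj (\<psi> n)) = principal_char q \<longleftrightarrow> \<eta> = \<psi>"
  proof
    assume *: "(\<lambda>n. \<eta> n * cnj (\<psi> n)) = principal_char q"
    show "\<eta> = \<psi>"
    proof
      fix n
      show "\<eta> n = \<psi> n"
      proof (cases "coprime n q")
        case True
        hence "\<eta> n * cnj (\<psi> n) = 1" using fun_cong[OF *, of n] by (simp add: principal_char_def)
        moreover have "\<psi> n * cnj (\<psi> n) = 1" using dirichlet_char_mult_cnj[OF assms(2), of n] True by simp
        ultimately show ?thesis by (metis mult_right_cancel mult_zero_right zero_neq_one)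
      qed (use assms dirichlet_char_eq_0_iff in metis)
    qed
  next
    assume "\<eta> = \<psi>"
    thus "(\<lambda>n. \<eta> n * cnj (\<psi> n)) = principal_char q"
      using dirichlet_char_mult_cnj[OF assms(2)] by (auto simp: principal_char_def fun_eq_iff)
  qed
  ultimately show ?thesis using sum_residues_dirichlet_char[of q "\<lambda>n. \<eta> n * cnj (\<psi> n)"] by simp
qed

text \<open>Summing the kernel against the conjugate of \<open>\<psi>\<close> over the units mod
  \<open>r\<close> isolates \<open>\<psi>\<close> among the characters outside \<Xi>_r. So the
  twisted sum is a combination of \<open>totient r\<close> discrepancies with coefficients of
  modulus 1.\<close>

lemma char_sum_le_Delta:
  assumes "\<psi> \<in> chars r - induced_chars \<Xi> r" and B: "\<And>a. coprime a r \<Longrightarrow> norm (Delta \<Xi> u X r a) \<le> B"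
  shows "norm (\<Sum>n = 1..nat \<lfloor>X\<rfloor>. u n * cnj (\<psi> n)) \<le> real (totient r) * B"
proof -
  have \<psi>: "dirichlet_char r \<psi>" using assms by (simp add: chars_def)
  have r: "r > 0" using \<psi> by (rule dirichlet_char_pos)
  define A where "A = {a. a < r \<and> coprime a r}"
  have A: "finite A" "card A = totient r" using card_coprime_residues[OF r] by (auto simp: A_def)
  have *: "(\<Sum>a\<in>A. cnj (\<psi> a) * kappa \<Xi> r a n) = cnj (\<psi> n)" for n
  proof -
    have "(\<Sum>a\<in>A. cnj (\<psi> a) * kappa \<Xi> r a n)
        = (\<Sum>a\<in>A. \<Sum>\<eta>\<in>chars r - induced_chars \<Xi> r. 1 / of_nat (totient r) * cnj (\<eta> n) * (\<eta> a * cnj (\<psi> a)))"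
      using r by (intro sum.cong refl) (simp add: A_def kappa_eq_char_sum sum_distrib_left mult_ac)
    also have "\<dots> = (\<Sum>\<eta>\<in>chars r - induced_chars \<Xi> r. 1 / of_nat (totient r) * cnj (\<eta> n) * (\<Sum>a\<in>A. \<eta> a * cnj (\<psi> a)))"
      by (subst sum.swap) (simp add: sum_distrib_left)
    also have "\<dots> = (\<Sum>\<eta>\<in>chars r - induced_chars \<Xi> r. if \<eta> = \<psi> then cnj (\<psi> n) else 0)"
    proof (intro sum.cong refl)
      fix \<eta> assume "\<eta> \<in> chars r - induced_chars \<Xi> r"
      hence \<eta>: "dirichlet_char r \<eta>" by (simp add: chars_def)
      have "(\<Sum>a\<in>A. \<eta> a * cnj (\<psi> a)) = (\<Sum>a<r. \<eta> a * cnj (\<psi> a))"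
        using \<psi> by (intro sum.mono_neutral_left) (auto simp: A_def dirichlet_char_eq_0_iff)
      thus "1 / of_nat (totient r) * cnj (\<eta> n) * (\<Sum>a\<in>A. \<eta> a * cnj (\<psi> a)) = (if \<eta> = \<psi> then cnj (\<psi> n) else 0)"
        using chars_orthogonality'[OF \<eta> \<psi>] r by simp
    qed
    also have "\<dots> = cnj (\<psi> n)" using assms(1) finite_chars[of r] by simp
    finally show ?thesis .
  qed
  have "(\<Sum>n = 1..nat \<lfloor>X\<rfloor>. u n * cnj (\<psi> n)) = (\<Sum>n = 1..nat \<lfloor>X\<rfloor>. u n * (\<Sum>a\<in>A. cnj (\<psi> a) * kappa \<Xi> r a n))"
    by (simp only: *)
  also have "\<dots> = (\<Sum>n = 1..nat \<lfloor>X\<rfloor>. \<Sum>a\<in>A. cnj (\<psi> a) * (u n * kappa \<Xi> r a n))"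
    by (simp add: sum_distrib_left mult_ac)
  also have "\<dots> = (\<Sum>a\<in>A. cnj (\<psi> a) * Delta \<Xi> u X r a)"
    unfolding Delta_eq_kappa_sum by (subst sum.swap) (simp add: sum_distrib_left)
  also have "norm \<dots> \<le> (\<Sum>a\<in>A. B)"
  proof (rule sum_norm_le)
    fix a assume "a \<in> A"
    hence a: "coprime a r" by (simp add: A_def)
    have "norm (cnj (\<psi> a) * Delta \<Xi> u X r a) \<le> 1 * norm (Delta \<Xi> u X r a)"
      unfolding norm_mult complex_mod_cnj by (intro mult_right_mono norm_dirichlet_char_le_1[OF \<psi>]) auto
    thus "norm (cnj (\<psi> a) * Delta \<Xi> u X r a) \<le> B" using B[OF a] by simp
  qed
  also have "\<dots> = real (totient r) * B" using A by simp
  finally show ?thesis .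
qed

text \<open>
  Passing from a primitive character to an induced one costs a sum over the integers \<open>d\<close> composed
  of primes dividing the modulus; the large \<open>d\<close>, for which no cancellation is available, are rare.
\<close>

lemma induced_char_sum_le:
  assumes f: "f \<in> class_C" and g: "g \<in> class_C" and fg: "dirichlet_inverses f g"
    and \<eta>: "dirichlet_char q \<eta>" "primitive_inducer q \<eta> = (r, \<psi>)" "\<eta> \<notin> induced_chars \<Xi> q"
    and D: "\<And>X a. Y \<le> X \<Longrightarrow> X \<le> x \<Longrightarrow> coprime a r \<Longrightarrow> norm (Delta \<Xi> f X r a) \<le> \<beta> * X"
    and k: "1 \<le> k" "real k \<le> x" and Y: "Y > 0" and \<beta>: "\<beta> \<ge> 0"
  shows "norm (\<Sum>n = 1..k. f n * cnj (\<eta> n))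
    \<le> real (totient r) * \<beta> * real k * (1 + ln (real k)) + sqrt (real k * Y) * 4 ^ card (prime_factors q)"
proof -
  note ind = primitive_inducer_spec[OF \<eta>(1,2)]
  have \<psi>: "\<psi> \<in> chars r - induced_chars \<Xi> r" by (rule primitive_inducer_not_induced[OF \<eta>])
  hence \<psi>d: "dirichlet_char r \<psi>" by (simp add: chars_def)
  have q: "q > 0" using \<eta>(1) by (rule dirichlet_char_pos)
  define S where "S = (\<lambda>k. \<Sum>n = 1..k. f n * cnj (\<psi> n))"
  let ?D = "{d. d \<in> {1..k} \<and> prime_factors d \<subseteq> prime_factors q}"
  have S_triv: "norm (S j) \<le> real j" for j
  proof -
    have "norm (S j) \<le> (\<Sum>n = 1..j. 1)" unfolding S_def
    proof (rule sum_norm_le)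
      fix n assume "n \<in> {1..j}"
      thus "norm (f n * cnj (\<psi> n)) \<le> 1"
        unfolding norm_mult complex_mod_cnj using class_C_norm_le_1[OF f, of n] norm_dirichlet_char_le_1[OF \<psi>d, of n]
        by (intro mult_le_one) auto
    qed
    thus ?thesis by simp
  qed
  have bound: "norm (S (k div d)) \<le> real (totient r) * \<beta> * real k * (1 / real d) + sqrt (real k * Y) * (1 / sqrt (real d))"
    if d: "d \<in> {1..k}" for d
  proof (cases "Y \<le> real k / real d")
    case True
    have "real k / real d \<le> real k" using d by (simp add: field_simps)
    hence "norm (\<Sum>n = 1..nat \<lfloor>real k / real d\<rfloor>. f n * cnj (\<psi> n)) \<le> real (totient r) * (\<beta> * (real k / real d))"
      using k True by (intro char_sum_le_Delta[OF \<psi>] D) auto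
    moreover have "nat \<lfloor>real k / real d\<rfloor> = k div d" by (simp add: floor_divide_of_nat_eq)
    moreover have "0 \<le> sqrt (real k * Y) * (1 / sqrt (real d))" using Y by simp
    ultimately show ?thesis by (simp add: S_def mult_ac)
  next
    case False
    hence le: "real k / real d \<le> Y" by simp
    have "norm (S (k div d)) \<le> real k / real d"
      using S_triv[of "k div d"] of_nat_div_le_of_nat[of k d, where 'a = real] by linarith
    \<comment> \<open>Only one of the two square roots is replaced by sqrt Y. The other keeps a
      decay 1/sqrt d, enough to sum over all \<open>d\<close> composed of primes of
      \<open>q\<close>.\<close>
    also have "\<dots> = sqrt (real k / real d) * sqrt (real k / real d)" by simp
    also have "\<dots> \<le> sqrt (real k / real d) * sqrt Y" using le by (intro mult_left_mono) auto
    also have "\<dots> = sqrt (real k * Y) * (1 / sqrt (real d))" by (simp add: real_sqrt_mult real_sqrt_divide)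
    also have "\<dots> \<le> real (totient r) * \<beta> * real k * (1 / real d) + sqrt (real k * Y) * (1 / sqrt (real d))"
      using \<beta> by simp
    finally show ?thesis .
  qed
  have "(\<Sum>n = 1..k. f n * cnj (\<eta> n)) = (\<Sum>n = 1..k. if coprime n q then f n * cnj (\<psi> n) else 0)"
    by (subst induced_by_eq[OF ind(2)]) (intro sum.cong, auto)
  also have "\<dots> = (\<Sum>d\<in>?D. g d * cnj (\<psi> d) * S (k div d))"
    unfolding S_def by (intro sum_coprime_restriction[OF f fg q]) (simp add: dirichlet_char_mult[OF \<psi>d])
  also have "norm \<dots> \<le> (\<Sum>d\<in>?D. real (totient r) * \<beta> * real k * (1 / real d) + sqrt (real k * Y) * (1 / sqrt (real d)))"
  proof (rule sum_norm_le)
    fix d assume d: "d \<in> ?D"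
    have "norm (g d * cnj (\<psi> d)) \<le> 1"
      unfolding norm_mult complex_mod_cnj using class_C_norm_le_1[OF g, of d] norm_dirichlet_char_le_1[OF \<psi>d, of d] d
      by (intro mult_le_one) auto
    hence "norm (g d * cnj (\<psi> d) * S (k div d)) \<le> 1 * norm (S (k div d))"
      unfolding norm_mult[of "g d * cnj (\<psi> d)"] by (intro mult_right_mono) auto
    thus "norm (g d * cnj (\<psi> d) * S (k div d)) \<le> real (totient r) * \<beta> * real k * (1 / real d) + sqrt (real k * Y) * (1 / sqrt (real d))"
      using bound[of d] d by simp
  qed
  also have "\<dots> = real (totient r) * \<beta> * real k * (\<Sum>d\<in>?D. 1 / real d) + sqrt (real k * Y) * (\<Sum>d\<in>?D. 1 / sqrt (real d))"
    by (simp only: sum.distrib sum_distrib_left)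
  also have "\<dots> \<le> real (totient r) * \<beta> * real k * (1 + ln (real k)) + sqrt (real k * Y) * 4 ^ card (prime_factors q)"
  proof (intro add_mono mult_left_mono)
    have "(\<Sum>d\<in>?D. 1 / real d) \<le> (\<Sum>d = 1..k. 1 / real d)" by (intro sum_mono2) auto
    also have "\<dots> \<le> 1 + ln (real k)" using k by (intro harmonic_sum_le) auto
    finally show "(\<Sum>d\<in>?D. 1 / real d) \<le> 1 + ln (real k)" .
    show "(\<Sum>d\<in>?D. 1 / sqrt (real d)) \<le> 4 ^ card (prime_factors q)"
      by (rule sum_smooth_le) auto
  qed (use \<beta> Y in auto)
  finally show ?thesis .
qed

section \<open>The logarithmic weight and the bilinear sum\<close>

text \<open>The factor left when g * (f log) is divided by the logarithm of m n. It increases in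
  \<open>n\<close> and decreases in \<open>m\<close>, as partial summation requires. At m n = 1 it
  is 0 by the convention for division by zero.\<close>

definition log_weight :: "nat \<Rightarrow> nat \<Rightarrow> real" where
  "log_weight m n = ln (real n) / ln (real (m * n))"

lemma log_weight_bounds:
  assumes "m > 0" "n > 0"
  shows "0 \<le> log_weight m n \<and> log_weight m n \<le> 1"
proof -
  have "0 \<le> ln (real n)" "ln (real n) \<le> ln (real (m * n))" using assms by simp_all
  thus ?thesis unfolding log_weight_def by (cases "ln (real (m * n)) = 0") (auto simp: divide_le_eq_1)
qed

lemma log_weight_mono:
  assumes "m > 0"
  shows "mono_on {a<..b} (\<lambda>n. log_weight m n)"
proof (rule mono_onI)
  fix n n' assume n: "n \<in> {a<..b}" "n' \<in> {a<..b}" "n \<le> n'"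
  hence pos: "n > 0" "n' > 0" by auto
  show "log_weight m n \<le> log_weight m n'"
  proof (cases "ln (real (m * n)) > 0")
    case True
    have le: "ln (real n) \<le> ln (real n')" using n pos by simp
    have m: "ln (real m) \<ge> 0" "ln (real n) \<ge> 0" using assms pos by auto
    have e: "ln (real (m * k)) = ln (real m) + ln (real k)" if "k > 0" for k using assms that by (simp add: ln_mult)
    have "ln (real n) * (ln (real m) + ln (real n')) \<le> ln (real n') * (ln (real m) + ln (real n))"
      using mult_right_mono[OF le m(1)] by (simp add: algebra_simps)
    moreover have "ln (real m) + ln (real n) > 0" using True e pos by simp
    moreover from this le have "ln (real m) + ln (real n') > 0" by linarith
    ultimately show ?thesis unfolding log_weight_def e[OF pos(1)] e[OF pos(2)] by (simp add: field_simps)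
  next
    case False
    have "ln (real (m * n)) \<ge> 0" using assms pos by (intro ln_ge_zero) (simp add: Suc_le_eq flip: of_nat_mult)
    hence "ln (real (m * n)) = 0" using False by simp
    hence "log_weight m n = 0" by (simp add: log_weight_def)
    thus ?thesis using log_weight_bounds[OF assms pos(2)] by simp
  qed
qed

lemma log_weight_antimono:
  assumes "n > 0"
  shows "antimono_on {a<..b} (\<lambda>m. log_weight m n)"
proof (rule monotone_onI)
  fix m m' assume m: "m \<in> {a<..b}" "m' \<in> {a<..b}" "m \<le> m'"
  hence pos: "m > 0" "m' > 0" by auto
  show "log_weight m n \<ge> log_weight m' n"
  proof (cases "n = 1")
    case False
    hence n: "ln (real n) > 0" using assms by simp
    have e: "ln (real (k * n)) = ln (real k) + ln (real n)" if "k > 0" for k using assms that by (simp add: ln_mult)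
    show ?thesis
      unfolding log_weight_def e[OF pos(1)] e[OF pos(2)] using n m pos
      by (intro divide_left_mono mult_pos_pos add_nonneg_pos) auto
  qed (simp add: log_weight_def)
qed

definition bilinear_sum :: "(nat \<Rightarrow> complex) \<Rightarrow> (nat \<Rightarrow> complex) \<Rightarrow> nat \<Rightarrow> nat \<Rightarrow> (nat \<Rightarrow> complex) \<Rightarrow> complex" where
  "bilinear_sum g f V N \<eta> =
     (\<Sum>m\<in>{V<..N}. \<Sum>n\<in>{V<..N div m}. g m * f n * of_real (log_weight m n) * cnj (\<eta> (m * n)))"

lemma weighted_sum_le:
  fixes w :: "nat \<Rightarrow> real" and u :: "nat \<Rightarrow> complex"
  assumes "mono_on {a<..b} w \<or> antimono_on {a<..b} w" "\<And>n. a < n \<Longrightarrow> n \<le> b \<Longrightarrow> 0 \<le> w n \<and> w n \<le> 1"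
    and "\<And>k. k \<le> b \<Longrightarrow> norm (\<Sum>n = 1..k. u n) \<le> B"
  shows "norm (\<Sum>n\<in>{a<..b}. of_real (w n) * u n) \<le> 2 * B"
proof -
  obtain c where c: "\<And>u :: nat \<Rightarrow> complex. (\<Sum>n\<in>{a<..b}. of_real (w n) * u n) = (\<Sum>k\<in>{a..b}. of_real (c k) * (\<Sum>n = 1..k. u n))"
    "(\<Sum>k\<in>{a..b}. \<bar>c k\<bar>) \<le> 2" using monotone_abel_summation[OF assms(1,2)] by blast
  have B: "B \<ge> 0" using assms(3)[of 0] by simp
  have "norm (\<Sum>n\<in>{a<..b}. of_real (w n) * u n) \<le> (\<Sum>k\<in>{a..b}. \<bar>c k\<bar> * B)"
    unfolding c(1) using assms(3) by (intro sum_norm_le) (auto simp: norm_mult intro!: mult_left_mono)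
  also have "\<dots> = (\<Sum>k\<in>{a..b}. \<bar>c k\<bar>) * B" by (simp add: sum_distrib_right)
  also have "\<dots> \<le> 2 * B" using c(2) B by (rule mult_right_mono)
  finally show ?thesis .
qed

text \<open>One of the variables is at most the root \<open>z\<close> of N and is kept outside, so
  the inner sum extends up to x/m \<ge> sqrt x, where \<open>sums\<close> gives cancellation. That
  hypothesis compares every partial sum of length \<open>k \<le> X\<close> with X itself, the form
  needed to remove the weight by partial summation. The outer sum of x/m costs one
  logarithm.\<close>

lemma bilinear_sum_le:
  assumes \<eta>: "dirichlet_char q \<eta>" and bd: "\<And>n. n > 0 \<Longrightarrow> norm (f n) \<le> 1" "\<And>n. n > 0 \<Longrightarrow> norm (g n) \<le> 1"
    and N: "N > 0" "real N \<le> x" and \<Gamma>: "\<Gamma> \<ge> 0"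
    and sums: "\<And>h X k. h \<in> {f, g} \<Longrightarrow> sqrt x \<le> X \<Longrightarrow> X \<le> x \<Longrightarrow> real k \<le> X \<Longrightarrow> norm (\<Sum>n = 1..k. h n * cnj (\<eta> n)) \<le> \<Gamma> * X"
  shows "norm (bilinear_sum g f V N \<eta>) \<le> 4 * x * (1 + ln x) * \<Gamma>"
proof -
  define z where "z = nat \<lfloor>sqrt (real N)\<rfloor>"
  have x: "x \<ge> 1" using N by linarith
  have z: "real z \<le> sqrt (real N)" "sqrt (real N) < real z + 1" unfolding z_def by (simp_all add: nat_less_real_le)
  have z1: "z \<ge> 1" unfolding z_def using N by (simp add: le_nat_iff)
  have zN: "z \<le> N"
  proof -
    have "sqrt (real N) \<le> real N" using N by (intro real_le_lsqrt) (auto simp: power2_eq_square)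
    thus ?thesis using z(1) by linarith
  qed
  have zx: "sqrt x \<le> x / real m" if "m \<in> {1..z}" for m
  proof -
    have "real m \<le> sqrt x" using that z(1) N(2) by (meson atLeastAtMost_iff of_nat_le_iff order_trans real_sqrt_le_iff)
    hence "x / sqrt x \<le> x / real m" using x that by (intro divide_left_mono mult_pos_pos) auto
    thus ?thesis using x by (simp add: real_div_sqrt)
  qed
  have zsum: "(\<Sum>m\<in>{V<..z}. 2 * (\<Gamma> * (x / real m))) \<le> 2 * x * (1 + ln x) * \<Gamma>"
  proof -
    have "(\<Sum>m\<in>{V<..z}. 2 * (\<Gamma> * (x / real m))) \<le> (\<Sum>m\<in>{1..z}. 2 * (\<Gamma> * (x / real m)))"
      using \<Gamma> x by (intro sum_mono2) auto
    also have "\<dots> = 2 * \<Gamma> * x * (\<Sum>m\<in>{1..z}. 1 / real m)" by (simp add: sum_distrib_left mult_ac)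
    also have "\<dots> \<le> 2 * \<Gamma> * x * (1 + ln x)"
    proof (intro mult_left_mono)
      have "(\<Sum>m\<in>{1..z}. 1 / real m) \<le> 1 + ln (real z)" using z1 by (intro harmonic_sum_le) auto
      moreover have "ln (real z) \<le> ln x" using z1 zN N by simp
      ultimately show "(\<Sum>m\<in>{1..z}. 1 / real m) \<le> 1 + ln x" by linarith
    qed (use \<Gamma> x in auto)
    finally show ?thesis by (simp add: mult_ac)
  qed
  have xm: "x / real m \<le> x" if "m \<ge> 1" for m using that x by (simp add: field_simps)
  have kx: "real k \<le> x / real m" if "m \<ge> 1" "k \<le> N div m" for k m
  proof -
    have "real k \<le> real N / real m" using that of_nat_div_le_of_nat[of N m, where 'a = real] by (meson of_nat_le_iff order_trans)
    also have "\<dots> \<le> x / real m" using N that by (intro divide_right_mono) auto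
    finally show ?thesis .
  qed
  define t where "t = (\<lambda>m n. g m * f n * of_real (log_weight m n) * cnj (\<eta> (m * n)))"
  have "{V<..N} = {V<..z} \<union> {max V z<..N}" using zN by auto
  hence "bilinear_sum g f V N \<eta> = (\<Sum>m\<in>{V<..z}. \<Sum>n\<in>{V<..N div m}. t m n) + (\<Sum>m\<in>{max V z<..N}. \<Sum>n\<in>{V<..N div m}. t m n)"
    unfolding bilinear_sum_def t_def by (simp add: sum.union_disjoint)
  \<comment> \<open>For \<open>m > z\<close> the condition m n \<le> N forces
    \<open>n \<le> z\<close>, so the roles of the variables are exchanged. The lower limit is
    \<open>max V z\<close> because \<open>V\<close> may exceed \<open>z\<close>.\<close>
  also have "(\<Sum>m\<in>{max V z<..N}. \<Sum>n\<in>{V<..N div m}. t m n) = (\<Sum>n\<in>{V<..z}. \<Sum>m\<in>{max V z<..N div n}. t m n)"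
  proof -
    have "(\<Sum>m\<in>{max V z<..N}. \<Sum>n\<in>{V<..N div m}. t m n) = (\<Sum>(m, n)\<in>(SIGMA m:{max V z<..N}. {V<..N div m}). t m n)"
      by (intro sum.Sigma) auto
    also have "\<dots> = (\<Sum>(n, m)\<in>(SIGMA n:{V<..z}. {max V z<..N div n}). t m n)"
    proof (intro sum.reindex_bij_witness[of _ "\<lambda>(n, m). (m, n)" "\<lambda>(m, n). (n, m)"])
      fix p assume p0: "p \<in> (SIGMA m:{max V z<..N}. {V<..N div m})"
      obtain m n where p: "p = (m, n)" by (cases p)
      have mn: "max V z < m" "m \<le> N" "V < n" "n \<le> N div m" using p0 unfolding p by auto
      hence nm: "n * m \<le> N" by (simp add: less_eq_div_iff_mult_less_eq)
      have "n \<le> z"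
      proof (rule ccontr)
        assume "\<not> n \<le> z"
        hence "(z + 1) * (z + 1) \<le> n * m" using mn by (intro mult_mono) auto
        hence "real ((z + 1) * (z + 1)) \<le> real N" using nm by (simp only: of_nat_le_iff)
        hence "(real z + 1)\<^sup>2 \<le> real N" by (simp add: power2_eq_square algebra_simps)
        hence "real z + 1 \<le> sqrt (real N)" by (rule real_le_rsqrt)
        thus False using z(2) by simp
      qed
      moreover have "m \<le> N div n" using nm mn by (simp add: less_eq_div_iff_mult_less_eq mult.commute)
      ultimately show "(case p of (m, n) \<Rightarrow> (n, m)) \<in> (SIGMA n:{V<..z}. {max V z<..N div n})"
        using mn by (auto simp: p)
    next
      fix p assume p0: "p \<in> (SIGMA n:{V<..z}. {max V z<..N div n})"
      obtain n m where p: "p = (n, m)" by (cases p)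
      have mn: "max V z < m" "V < n" "n \<le> z" "m \<le> N div n" using p0 unfolding p by auto
      hence nm: "m * n \<le> N" by (simp add: less_eq_div_iff_mult_less_eq)
      hence "n \<le> N div m" using mn by (simp add: less_eq_div_iff_mult_less_eq mult.commute)
      moreover have "m \<le> N" using mn by (meson div_le_dividend order_trans)
      ultimately show "(case p of (n, m) \<Rightarrow> (m, n)) \<in> (SIGMA m:{max V z<..N}. {V<..N div m})"
        using mn by (auto simp: p)
    qed auto
    also have "\<dots> = (\<Sum>n\<in>{V<..z}. \<Sum>m\<in>{max V z<..N div n}. t m n)" by (intro sum.Sigma[symmetric]) auto
    finally show ?thesis .
  qed
  finally have "norm (bilinear_sum g f V N \<eta>) \<le> norm (\<Sum>m\<in>{V<..z}. \<Sum>n\<in>{V<..N div m}. t m n) + norm (\<Sum>n\<in>{V<..z}. \<Sum>m\<in>{max V z<..N div n}. t m n)"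
    by (simp add: norm_triangle_ineq)
  also have "norm (\<Sum>m\<in>{V<..z}. \<Sum>n\<in>{V<..N div m}. t m n) \<le> (\<Sum>m\<in>{V<..z}. 2 * (\<Gamma> * (x / real m)))"
  proof (rule sum_norm_le)
    fix m assume m: "m \<in> {V<..z}"
    hence m': "m \<in> {1..z}" "m \<ge> 1" "m > 0" by auto
    have "(\<Sum>n\<in>{V<..N div m}. t m n) = g m * cnj (\<eta> m) * (\<Sum>n\<in>{V<..N div m}. of_real (log_weight m n) * (f n * cnj (\<eta> n)))"
      unfolding t_def sum_distrib_left by (simp add: dirichlet_char_mult[OF \<eta>] mult_ac)
    also have "norm \<dots> \<le> 1 * norm (\<Sum>n\<in>{V<..N div m}. of_real (log_weight m n) * (f n * cnj (\<eta> n)))"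
      unfolding norm_mult complex_mod_cnj using bd(2)[of m] norm_dirichlet_char_le_1[OF \<eta>, of m] m'
      by (intro mult_right_mono mult_le_one) auto
    also have "norm (\<Sum>n\<in>{V<..N div m}. of_real (log_weight m n) * (f n * cnj (\<eta> n))) \<le> 2 * (\<Gamma> * (x / real m))"
      using zx[OF m'(1)] xm[OF m'(2)] kx[OF m'(2)] m'(3)
      by (intro weighted_sum_le disjI1 log_weight_mono log_weight_bounds sums) auto
    finally show "norm (\<Sum>n\<in>{V<..N div m}. t m n) \<le> 2 * (\<Gamma> * (x / real m))" by simp
  qed
  also have "norm (\<Sum>n\<in>{V<..z}. \<Sum>m\<in>{max V z<..N div n}. t m n) \<le> (\<Sum>n\<in>{V<..z}. 2 * (\<Gamma> * (x / real n)))"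
  proof (rule sum_norm_le)
    fix n assume n: "n \<in> {V<..z}"
    hence n': "n \<in> {1..z}" "n \<ge> 1" "n > 0" by auto
    have "(\<Sum>m\<in>{max V z<..N div n}. t m n) = f n * cnj (\<eta> n) * (\<Sum>m\<in>{max V z<..N div n}. of_real (log_weight m n) * (g m * cnj (\<eta> m)))"
      unfolding t_def sum_distrib_left by (simp add: dirichlet_char_mult[OF \<eta>] mult_ac)
    also have "norm \<dots> \<le> 1 * norm (\<Sum>m\<in>{max V z<..N div n}. of_real (log_weight m n) * (g m * cnj (\<eta> m)))"
      unfolding norm_mult complex_mod_cnj using bd(1)[of n] norm_dirichlet_char_le_1[OF \<eta>, of n] n'
      by (intro mult_right_mono mult_le_one) auto
    also have "norm (\<Sum>m\<in>{max V z<..N div n}. of_real (log_weight m n) * (g m * cnj (\<eta> m))) \<le> 2 * (\<Gamma> * (x / real n))"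
      using zx[OF n'(1)] xm[OF n'(2)] kx[OF n'(2)] n'(3)
      by (intro weighted_sum_le disjI2 log_weight_antimono log_weight_bounds sums) auto
    finally show "norm (\<Sum>m\<in>{max V z<..N div n}. t m n) \<le> 2 * (\<Gamma> * (x / real n))" by simp
  qed
  finally show ?thesis using zsum by (simp add: algebra_simps)
qed

definition conductor :: "nat \<Rightarrow> (nat \<Rightarrow> complex) \<Rightarrow> nat" where
  "conductor q \<eta> = fst (primitive_inducer q \<eta>)"

text \<open>For fixed \<open>q\<close> a character is determined by its conductor and primitive
  character, and each modulus \<open>r \<le> R\<close> has at most R characters.\<close>

lemma card_small_conductor_le: "card {\<eta> \<in> chars q. conductor q \<eta> \<le> R} \<le> R\<^sup>2"
proof -
  let ?C = "{\<eta> \<in> chars q. conductor q \<eta> \<le> R}"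
  have "primitive_inducer q ` ?C \<subseteq> (SIGMA r:{1..R}. chars r)"
  proof clarify
    fix \<eta> r \<psi> assume h: "\<eta> \<in> chars q" "conductor q \<eta> \<le> R" "(r, \<psi>) = primitive_inducer q \<eta>"
    hence p: "primitive_char r \<psi>" by (intro primitive_inducer_spec(1)[of q \<eta>]) (auto simp: chars_def)
    hence "dirichlet_char r \<psi>" by (simp add: primitive_char_def)
    moreover from this have "r > 0" by (rule dirichlet_char_pos)
    moreover have "r \<le> R" using h(2) arg_cong[OF h(3), of fst] by (simp add: conductor_def)
    ultimately show "r \<in> {1..R} \<and> \<psi> \<in> chars r" by (auto simp: chars_def)
  qed
  moreover have "inj_on (primitive_inducer q) ?C"
    by (rule inj_on_subset[OF inj_on_primitive_inducer]) auto
  ultimately have "card ?C \<le> card (SIGMA r:{1..R}. chars r)"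
    by (intro card_inj_on_le[where f = "primitive_inducer q"]) (auto intro: finite_chars)
  also have "\<dots> = (\<Sum>r = 1..R. card (chars r))" by (intro card_SigmaI) (auto intro: finite_chars)
  also have "\<dots> \<le> (\<Sum>r = 1..R. R)"
    by (intro sum_mono) (auto simp: card_chars intro: order.trans[OF totient_le])
  finally show ?thesis by (simp add: power2_eq_square)
qed

text \<open>Here \<open>Y\<close> is the length from which discrepancy bounds are available and
  \<open>\<Omega>\<close> dominates the cost of imposing coprimality to \<open>q\<close>. Both enter
  only in the term with Y / sqrt x, a negative power of x in the application. The sum over moduli of
  1/\<phi>(q) adds one logarithm.\<close>

lemma small_conductor_bound:
  assumes f: "f \<in> class_C" and g: "g \<in> class_C" and fg: "dirichlet_inverses f g"
    and D: "\<And>h X r a. h \<in> {f, g} \<Longrightarrow> Y \<le> X \<Longrightarrow> X \<le> x \<Longrightarrow> 1 \<le> r \<Longrightarrow> coprime a r \<Longrightarrow> norm (Delta \<Xi> h X r a) \<le> \<beta> * X"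
    and N: "N > 0" "real N \<le> x" and Y: "Y > 0" and \<beta>: "\<beta> \<ge> 0" and M: "M > 0"
    and \<Omega>: "\<And>q. q \<in> {1..M} \<Longrightarrow> 4 ^ card (prime_factors q) \<le> \<Omega>"
  shows "(\<Sum>q = 1..M. 1 / real (totient q) * (\<Sum>\<eta> | \<eta> \<in> chars q - induced_chars \<Xi> q \<and> conductor q \<eta> \<le> R. norm (bilinear_sum g f V N \<eta>)))
    \<le> 4 * (1 + ln (real M)) * (real R)\<^sup>2 * (4 * x * (1 + ln x) * (real R * \<beta> * (1 + ln x) + sqrt (Y / sqrt x) * \<Omega>))"
proof -
  define \<Gamma> where "\<Gamma> = real R * \<beta> * (1 + ln x) + sqrt (Y / sqrt x) * \<Omega>"
  have x: "x \<ge> 1" using N by linarith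
  have \<Omega>0: "\<Omega> \<ge> 0" using \<Omega>[of 1] M by (auto intro: order.trans[rotated])
  have \<Gamma>: "\<Gamma> \<ge> 0" unfolding \<Gamma>_def using \<beta> x Y \<Omega>0 by (intro add_nonneg_nonneg mult_nonneg_nonneg) auto
  have fg': "dirichlet_inverses g f" using fg by (rule dirichlet_inverses_sym)
  have bil: "norm (bilinear_sum g f V N \<eta>) \<le> 4 * x * (1 + ln x) * \<Gamma>"
    if q: "q \<in> {1..M}" and \<eta>: "\<eta> \<in> chars q - induced_chars \<Xi> q" "conductor q \<eta> \<le> R" for q \<eta>
  proof (rule bilinear_sum_le)
    obtain r \<psi> where p: "primitive_inducer q \<eta> = (r, \<psi>)" by (cases "primitive_inducer q \<eta>")
    show d: "dirichlet_char q \<eta>" using \<eta> by (simp add: chars_def)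
    have r: "r \<le> R" using \<eta> p by (simp add: conductor_def)
    have r1: "r \<ge> 1" using primitive_inducer_spec(1)[OF d p] by (auto simp: primitive_char_def dirichlet_char_def)
    show "norm (\<Sum>n = 1..k. h n * cnj (\<eta> n)) \<le> \<Gamma> * X"
      if h: "h \<in> {f, g}" and X: "sqrt x \<le> X" "X \<le> x" "real k \<le> X" for h X k
    proof (cases "k = 0")
      case False
      hence k: "k \<ge> 1" by simp
      obtain h' where h': "h \<in> class_C" "h' \<in> class_C" "dirichlet_inverses h h'" using h f g fg fg' by auto
      have X0: "X > 0" using X(1) x by (meson less_le_trans real_sqrt_gt_zero zero_less_one order_less_le_trans)
      have "norm (\<Sum>n = 1..k. h n * cnj (\<eta> n))
        \<le> real (totient r) * \<beta> * real k * (1 + ln (real k)) + sqrt (real k * Y) * 4 ^ card (prime_factors q)"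
      proof (rule induced_char_sum_le[OF h' d p _ _ k _ Y \<beta>])
        show "norm (Delta \<Xi> h X' r a) \<le> \<beta> * X'" if "Y \<le> X'" "X' \<le> x" "coprime a r" for X' a
          using D[OF h that(1,2) r1 that(3)] .
      qed (use \<eta> X in auto)
      also have "\<dots> \<le> real R * \<beta> * X * (1 + ln x) + (sqrt (Y / sqrt x) * X) * \<Omega>"
      proof (intro add_mono mult_mono)
        show "real (totient r) \<le> real R" using r totient_le[of r] by simp
        show "ln (real k) \<le> ln x" using X k by simp
        \<comment> \<open>As X \<ge> sqrt x, the product k Y is at most (Y / sqrt x) X^2; this puts
          the error into the shape of a constant times X.\<close>
        have "real k * Y \<le> X * Y" using X Y by (intro mult_right_mono) auto
        also have "\<dots> = (Y / X) * X\<^sup>2" using X0 by (simp add: power2_eq_square)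
        also have "\<dots> \<le> (Y / sqrt x) * X\<^sup>2" using X X0 x Y by (intro mult_right_mono divide_left_mono) auto
        finally have "sqrt (real k * Y) \<le> sqrt ((Y / sqrt x) * X\<^sup>2)" by (rule real_sqrt_le_mono)
        also have "sqrt ((Y / sqrt x) * X\<^sup>2) = sqrt (Y / sqrt x) * X"
          using X0 by (simp only: real_sqrt_mult) simp
        finally show "sqrt (real k * Y) \<le> sqrt (Y / sqrt x) * X" .
        show "4 ^ card (prime_factors q) \<le> \<Omega>" using \<Omega> q by blast
      qed (use X X0 \<beta> k Y x in auto)
      also have "\<dots> = \<Gamma> * X" by (simp add: \<Gamma>_def algebra_simps)
      finally show ?thesis .
    qed (use \<Gamma> X x in \<open>auto intro!: mult_nonneg_nonneg intro: order.trans[of 0 "sqrt x"]\<close>)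
  qed (use N \<Gamma> class_C_norm_le_1 f g in auto)
  have B0: "4 * x * (1 + ln x) * \<Gamma> \<ge> 0" using x \<Gamma> by (intro mult_nonneg_nonneg) auto
  have "(\<Sum>q = 1..M. 1 / real (totient q) * (\<Sum>\<eta> | \<eta> \<in> chars q - induced_chars \<Xi> q \<and> conductor q \<eta> \<le> R. norm (bilinear_sum g f V N \<eta>)))
     \<le> (\<Sum>q = 1..M. 1 / real (totient q) * ((real R)\<^sup>2 * (4 * x * (1 + ln x) * \<Gamma>)))"
  proof (intro sum_mono mult_left_mono)
    fix q assume q: "q \<in> {1..M}"
    let ?C = "{\<eta>. \<eta> \<in> chars q - induced_chars \<Xi> q \<and> conductor q \<eta> \<le> R}"
    have "(\<Sum>\<eta>\<in>?C. norm (bilinear_sum g f V N \<eta>)) \<le> (\<Sum>\<eta>\<in>?C. 4 * x * (1 + ln x) * \<Gamma>)"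
      using bil[OF q] by (intro sum_mono) auto
    also have "\<dots> = real (card ?C) * (4 * x * (1 + ln x) * \<Gamma>)" by simp
    also have "\<dots> \<le> (real R)\<^sup>2 * (4 * x * (1 + ln x) * \<Gamma>)"
    proof (rule mult_right_mono[OF _ B0])
      have "card ?C \<le> card {\<eta> \<in> chars q. conductor q \<eta> \<le> R}"
        by (intro card_mono) (auto intro: finite_subset[OF _ finite_chars[of q]])
      also have "\<dots> \<le> R\<^sup>2" by (rule card_small_conductor_le)
      finally show "real (card ?C) \<le> (real R)\<^sup>2" by (simp flip: of_nat_power)
    qed
    finally show "(\<Sum>\<eta>\<in>?C. norm (bilinear_sum g f V N \<eta>)) \<le> (real R)\<^sup>2 * (4 * x * (1 + ln x) * \<Gamma>)" .
  qed auto
  also have "\<dots> = (\<Sum>q = 1..M. 1 / real (totient q)) * ((real R)\<^sup>2 * (4 * x * (1 + ln x) * \<Gamma>))"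
    by (rule sum_distrib_right[symmetric])
  also have "\<dots> \<le> (4 * (1 + ln (real M))) * ((real R)\<^sup>2 * (4 * x * (1 + ln x) * \<Gamma>))"
    using B0 by (intro mult_right_mono sum_inverse_totient_le[OF M]) auto
  finally show ?thesis by (simp add: \<Gamma>_def mult_ac)
qed

section \<open>Characters of large conductor\<close>


definition twisted_sum :: "nat \<Rightarrow> (nat \<Rightarrow> complex) \<Rightarrow> (nat \<Rightarrow> complex) \<Rightarrow> complex" where
  "twisted_sum N b \<psi> = (\<Sum>n<N. b n * cnj (\<psi> n))"

lemma large_sieve_unit_coefficients:
  assumes "\<And>n. n < N \<Longrightarrow> norm (b n) \<le> 1"
  shows "(\<Sum>r = 1..D. real r / real (totient r) * (\<Sum>\<psi>\<in>prim_chars r. (norm (twisted_sum N b \<psi>))\<^sup>2))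
    \<le> 8 * (real N + (real D)\<^sup>2) * real N"
proof -
  have "(\<Sum>n<N. (norm (b n))\<^sup>2) \<le> (\<Sum>n<N. 1)" using assms by (intro sum_mono) (simp add: power_le_one)
  hence "8 * (real N + (real D)\<^sup>2) * (\<Sum>n<N. (norm (b n))\<^sup>2) \<le> 8 * (real N + (real D)\<^sup>2) * real N"
    by (intro mult_left_mono) auto
  thus ?thesis unfolding twisted_sum_def using multiplicative_large_sieve[where b = b and N = N and D = D] by linarith
qed

lemma sqrt_add_square_le: "x \<ge> 0 \<Longrightarrow> y \<ge> 0 \<Longrightarrow> sqrt (x + y\<^sup>2) \<le> sqrt x + y"
  using sqrt_add_le_add_sqrt[of x "y\<^sup>2"] by simp

text \<open>For r between D and 2D the factor 1/\<phi>(r) is at most 1/D times the weight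
  r/\<phi>(r) of the large sieve. Cauchy-Schwarz over the pairs of a conductor and a primitive
  character then leaves two large sieve sums.\<close>

lemma bilinear_large_sieve_dyadic:
  assumes "\<And>n. n < P \<Longrightarrow> norm (a n) \<le> 1" "\<And>n. n < N \<Longrightarrow> norm (b n) \<le> 1" "D \<ge> 1"
  shows "(\<Sum>r\<in>{D..<2*D}. 1 / real (totient r) * (\<Sum>\<psi>\<in>prim_chars r. norm (twisted_sum P a \<psi>) * norm (twisted_sum N b \<psi>)))
    \<le> 8 * sqrt (real P * real N) * (sqrt (real P * real N) / real D + 2 * sqrt (real P) + 2 * sqrt (real N) + 4 * real D)"
proof -
  let ?I = "SIGMA r:{D..<2*D}. prim_chars r"
  let ?w = "\<lambda>r. real r / real (totient r)"
  have fin: "finite ?I" by (auto intro: finite_prim_chars)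
  have LS: "(\<Sum>(r, \<psi>)\<in>?I. ?w r * (norm (twisted_sum K c \<psi>))\<^sup>2) \<le> 8 * (real K + (real (2 * D))\<^sup>2) * real K"
    if "\<And>n. n < K \<Longrightarrow> norm (c n) \<le> 1" for K c
  proof -
    have "(\<Sum>(r, \<psi>)\<in>?I. ?w r * (norm (twisted_sum K c \<psi>))\<^sup>2) = (\<Sum>r\<in>{D..<2*D}. ?w r * (\<Sum>\<psi>\<in>prim_chars r. (norm (twisted_sum K c \<psi>))\<^sup>2))"
      unfolding sum_distrib_left by (intro sum.Sigma[symmetric]) (auto intro: finite_prim_chars)
    also have "\<dots> \<le> (\<Sum>r = 1..2*D. ?w r * (\<Sum>\<psi>\<in>prim_chars r. (norm (twisted_sum K c \<psi>))\<^sup>2))"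
      using assms(3) by (intro sum_mono2 mult_nonneg_nonneg sum_nonneg) auto
    also have "\<dots> \<le> 8 * (real K + (real (2 * D))\<^sup>2) * real K" by (rule large_sieve_unit_coefficients[OF that])
    finally show ?thesis .
  qed
  have "(\<Sum>r\<in>{D..<2*D}. 1 / real (totient r) * (\<Sum>\<psi>\<in>prim_chars r. norm (twisted_sum P a \<psi>) * norm (twisted_sum N b \<psi>)))
      \<le> (\<Sum>r\<in>{D..<2*D}. 1 / real D * (?w r * (\<Sum>\<psi>\<in>prim_chars r. norm (twisted_sum P a \<psi>) * norm (twisted_sum N b \<psi>))))"
  proof (rule sum_mono)
    fix r assume r: "r \<in> {D..<2*D}"
    have "1 / real (totient r) \<le> 1 / real D * ?w r" using r assms(3) by (simp add: field_simps)
    thus "1 / real (totient r) * (\<Sum>\<psi>\<in>prim_chars r. norm (twisted_sum P a \<psi>) * norm (twisted_sum N b \<psi>))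
      \<le> 1 / real D * (?w r * (\<Sum>\<psi>\<in>prim_chars r. norm (twisted_sum P a \<psi>) * norm (twisted_sum N b \<psi>)))"
      unfolding mult.assoc[symmetric] by (intro mult_right_mono sum_nonneg) auto
  qed
  also have "\<dots> = 1 / real D * (\<Sum>r\<in>{D..<2*D}. \<Sum>\<psi>\<in>prim_chars r. ?w r * (norm (twisted_sum P a \<psi>) * norm (twisted_sum N b \<psi>)))"
    by (simp only: sum_distrib_left)
  also have "\<dots> = 1 / real D * (\<Sum>(r, \<psi>)\<in>?I. ?w r * (norm (twisted_sum P a \<psi>) * norm (twisted_sum N b \<psi>)))"
    by (subst sum.Sigma) (auto intro: finite_prim_chars)
  also have "(\<Sum>(r, \<psi>)\<in>?I. ?w r * (norm (twisted_sum P a \<psi>) * norm (twisted_sum N b \<psi>)))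
    = (\<Sum>p\<in>?I. \<bar>sqrt (?w (fst p)) * norm (twisted_sum P a (snd p))\<bar> * \<bar>sqrt (?w (fst p)) * norm (twisted_sum N b (snd p))\<bar>)"
  proof (intro sum.cong refl)
    fix p :: "nat \<times> (nat \<Rightarrow> complex)"
    have "sqrt (?w (fst p)) * sqrt (?w (fst p)) = ?w (fst p)" by simp
    moreover have "\<bar>sqrt (?w (fst p)) * norm (twisted_sum P a (snd p))\<bar> * \<bar>sqrt (?w (fst p)) * norm (twisted_sum N b (snd p))\<bar>
      = (sqrt (?w (fst p)) * sqrt (?w (fst p))) * (norm (twisted_sum P a (snd p)) * norm (twisted_sum N b (snd p)))"
      by (simp only: abs_mult abs_norm_cancel real_sqrt_abs2 mult_ac)
    ultimately show "(case p of (r, \<psi>) \<Rightarrow> ?w r * (norm (twisted_sum P a \<psi>) * norm (twisted_sum N b \<psi>)))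
      = \<bar>sqrt (?w (fst p)) * norm (twisted_sum P a (snd p))\<bar> * \<bar>sqrt (?w (fst p)) * norm (twisted_sum N b (snd p))\<bar>"
      by (simp add: case_prod_beta)
  qed
  also have "\<dots> \<le> L2_set (\<lambda>p. sqrt (?w (fst p)) * norm (twisted_sum P a (snd p))) ?I * L2_set (\<lambda>p. sqrt (?w (fst p)) * norm (twisted_sum N b (snd p))) ?I"
    by (rule L2_set_mult_ineq)
  also have "\<dots> \<le> sqrt (8 * (real P + (real (2 * D))\<^sup>2) * real P) * sqrt (8 * (real N + (real (2 * D))\<^sup>2) * real N)"
  proof (rule mult_mono)
    have L2: "L2_set (\<lambda>p. sqrt (?w (fst p)) * norm (twisted_sum K c (snd p))) ?I \<le> sqrt (8 * (real K + (real (2 * D))\<^sup>2) * real K)"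
      if "\<And>n. n < K \<Longrightarrow> norm (c n) \<le> 1" for K c
      unfolding L2_set_def using LS[of K c, OF that]
      by (intro real_sqrt_le_mono) (simp add: power_mult_distrib case_prod_beta)
    show "L2_set (\<lambda>p. sqrt (?w (fst p)) * norm (twisted_sum P a (snd p))) ?I \<le> sqrt (8 * (real P + (real (2 * D))\<^sup>2) * real P)"
      by (rule L2[OF assms(1)])
    show "L2_set (\<lambda>p. sqrt (?w (fst p)) * norm (twisted_sum N b (snd p))) ?I \<le> sqrt (8 * (real N + (real (2 * D))\<^sup>2) * real N)"
      by (rule L2[OF assms(2)])
  qed auto
  also have "\<dots> = 8 * sqrt (real P * real N) * (sqrt (real P + (2 * real D)\<^sup>2) * sqrt (real N + (2 * real D)\<^sup>2))"
  proof -
    have "sqrt (8 * X * real P) * sqrt (8 * Y * real N) = (sqrt 8 * sqrt 8) * sqrt (real P * real N) * (sqrt X * sqrt Y)" for X Y :: real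
      by (simp only: real_sqrt_mult mult_ac)
    moreover have "sqrt 8 * sqrt 8 = (8 :: real)" "real (2 * D) = 2 * real D" by simp_all
    ultimately show ?thesis by (simp only:)
  qed
  also have "\<dots> \<le> 8 * sqrt (real P * real N) * ((sqrt (real P) + 2 * real D) * (sqrt (real N) + 2 * real D))"
    by (intro mult_left_mono mult_mono sqrt_add_square_le) auto
  finally have "(\<Sum>r\<in>{D..<2*D}. 1 / real (totient r) * (\<Sum>\<psi>\<in>prim_chars r. norm (twisted_sum P a \<psi>) * norm (twisted_sum N b \<psi>)))
     \<le> 1 / real D * (8 * sqrt (real P * real N) * ((sqrt (real P) + 2 * real D) * (sqrt (real N) + 2 * real D)))"
    by (simp add: divide_right_mono)
  also have "\<dots> = 8 * sqrt (real P * real N) * (sqrt (real P * real N) / real D + 2 * sqrt (real P) + 2 * sqrt (real N) + 4 * real D)"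
    using assms(3) by (simp add: field_simps real_sqrt_mult)
  finally show ?thesis .
qed

lemma floor_log2_le:
  assumes "x \<ge> 1"
  shows "real (nat \<lfloor>log 2 x\<rfloor>) + 1 \<le> 1 + 2 * ln x"
proof -
  have "real (nat \<lfloor>log 2 x\<rfloor>) \<le> ln x / ln 2" using assms by (simp add: log_def)
  also have "\<dots> \<le> ln x / (1 / 2)" using assms ln2_ge_two_thirds by (intro divide_left_mono) auto
  finally show ?thesis by simp
qed

lemma dyadic_partition:
  fixes t :: "nat \<Rightarrow> 'b :: comm_monoid_add"
  assumes U: "real U \<le> x" "x \<ge> 1"
  shows "(\<Sum>r\<in>{R<..U}. t r) = (\<Sum>i\<in>{0..nat \<lfloor>log 2 x\<rfloor>}. \<Sum>r\<in>{2 ^ i..<2 * 2 ^ i}. if R < r \<and> r \<le> U then t r else 0)"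
proof -
  define k where "k = nat \<lfloor>log 2 x\<rfloor>"
  have disj: "{2 ^ i..<2 * 2 ^ i} \<inter> {2 ^ j..<2 * 2 ^ j} = ({} :: nat set)" if "i < j" for i j :: nat
  proof -
    have "(2::nat) ^ Suc i \<le> 2 ^ j" using that by (intro power_increasing) auto
    thus ?thesis by auto
  qed
  have sub: "{R<..U} \<subseteq> (\<Union>i\<in>{0..k}. {2 ^ i..<2 * 2 ^ i})"
  proof
    fix r assume r: "r \<in> {R<..U}"
    define i where "i = nat \<lfloor>log 2 (real r)\<rfloor>"
    have r0: "r > 0" using r by auto
    have "real i \<le> log 2 (real r)" "log 2 (real r) < real i + 1" using r0 unfolding i_def by (simp_all add: Suc_le_eq)
    hence "2 powr real i \<le> real r" "real r < 2 powr (real i + 1)"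
      using r0 by (simp_all add: le_log_iff log_less_iff)
    hence "2 ^ i \<le> real r" "real r < 2 * 2 ^ i" by (simp_all add: powr_add powr_realpow)
    hence "real (2 ^ i) \<le> real r" "real r < real (2 * 2 ^ i)" by simp_all
    hence "2 ^ i \<le> r" "r < 2 * 2 ^ i" by (simp_all only: of_nat_le_iff of_nat_less_iff)
    moreover have "i \<le> k"
      unfolding i_def k_def using r U r0 by (intro nat_mono floor_mono) (simp add: log_le_cancel_iff)
    ultimately show "r \<in> (\<Union>i\<in>{0..k}. {2 ^ i..<2 * 2 ^ i})" by auto
  qed
  have "(\<Sum>r\<in>{R<..U}. t r) = (\<Sum>r\<in>(\<Union>i\<in>{0..k}. {2 ^ i..<2 * 2 ^ i}). if R < r \<and> r \<le> U then t r else 0)"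
    using sub by (intro sum.mono_neutral_cong_left) auto
  also have "\<dots> = (\<Sum>i\<in>{0..k}. \<Sum>r\<in>{2 ^ i..<2 * 2 ^ i}. if R < r \<and> r \<le> U then t r else 0)"
    using disj by (intro sum.UNION_disjoint) (simp, simp, metis inf_commute nat_neq_iff)
  finally show ?thesis unfolding k_def .
qed

lemma sum_dyadic_le:
  fixes t :: "nat \<Rightarrow> real"
  assumes t: "\<And>r. t r \<ge> 0" and U: "real U \<le> x" "x \<ge> 1" and B: "B \<ge> 0"
    and dyadic: "\<And>i. R < 2 ^ (i + 1) \<Longrightarrow> 2 ^ i \<le> U \<Longrightarrow> (\<Sum>r\<in>{2 ^ i..<2 * 2 ^ i}. if R < r \<and> r \<le> U then t r else 0) \<le> B"
  shows "(\<Sum>r\<in>{R<..U}. t r) \<le> (1 + 2 * ln x) * B"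
proof -
  define k where "k = nat \<lfloor>log 2 x\<rfloor>"
  have k: "real k + 1 \<le> 1 + 2 * ln x" unfolding k_def by (rule floor_log2_le[OF U(2)])
  have "(\<Sum>r\<in>{R<..U}. t r) = (\<Sum>i\<in>{0..k}. \<Sum>r\<in>{2 ^ i..<2 * 2 ^ i}. if R < r \<and> r \<le> U then t r else 0)"
    unfolding k_def by (rule dyadic_partition[OF U])
  also have "(\<Sum>i\<in>{0..k}. \<Sum>r\<in>{2 ^ i..<2 * 2 ^ i}. if R < r \<and> r \<le> U then t r else 0) \<le> (\<Sum>i\<in>{0..k}. B)"
  proof (rule sum_mono)
    fix i assume "i \<in> {0..k}"
    show "(\<Sum>r\<in>{2 ^ i..<2 * 2 ^ i}. if R < r \<and> r \<le> U then t r else 0) \<le> B"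
    proof (cases "R < 2 ^ (i + 1) \<and> 2 ^ i \<le> U")
      case False
      hence "(\<Sum>r\<in>{2 ^ i..<2 * 2 ^ i}. if R < r \<and> r \<le> U then t r else 0) = 0"
        by (intro sum.neutral) auto
      thus ?thesis using B by simp
    qed (use dyadic in auto)
  qed
  also have "\<dots> = (real k + 1) * B" by simp
  also have "\<dots> \<le> (1 + 2 * ln x) * B" using k B by (rule mult_right_mono)
  finally show ?thesis .
qed

text \<open>A contributing dyadic block starts at some 2^i with R/2 < 2^i \<le> U. The term with 1/D
  is worst at the lower end and the term with D at the upper end; the number of blocks costs one
  logarithm.\<close>

lemma bilinear_large_sieve:
  assumes "\<And>n. n < P \<Longrightarrow> norm (a n) \<le> 1" "\<And>n. n < N \<Longrightarrow> norm (b n) \<le> 1" "R \<ge> 1" "real U \<le> x" "x \<ge> 1"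
  shows "(\<Sum>r\<in>{R<..U}. 1 / real (totient r) * (\<Sum>\<psi>\<in>prim_chars r. norm (twisted_sum P a \<psi>) * norm (twisted_sum N b \<psi>)))
    \<le> (1 + 2 * ln x) * (8 * sqrt (real P * real N) * (2 * sqrt (real P * real N) / real R + 2 * sqrt (real P) + 2 * sqrt (real N) + 4 * real U))"
proof (rule sum_dyadic_le)
  let ?t = "\<lambda>r. 1 / real (totient r) * (\<Sum>\<psi>\<in>prim_chars r. norm (twisted_sum P a \<psi>) * norm (twisted_sum N b \<psi>))"
  show t: "?t r \<ge> 0" for r by (intro mult_nonneg_nonneg sum_nonneg) auto
  fix i :: nat assume i: "R < 2 ^ (i + 1)" "2 ^ i \<le> U"
  have "(\<Sum>r\<in>{2 ^ i..<2 * 2 ^ i}. if R < r \<and> r \<le> U then ?t r else 0) \<le> (\<Sum>r\<in>{2 ^ i..<2 * 2 ^ i}. ?t r)"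
    using t by (intro sum_mono) auto
  also have "\<dots> \<le> 8 * sqrt (real P * real N) * (sqrt (real P * real N) / real (2 ^ i) + 2 * sqrt (real P) + 2 * sqrt (real N) + 4 * real (2 ^ i))"
    using assms(1,2) by (intro bilinear_large_sieve_dyadic) auto
  also have "\<dots> \<le> 8 * sqrt (real P * real N) * (2 * sqrt (real P * real N) / real R + 2 * sqrt (real P) + 2 * sqrt (real N) + 4 * real U)"
  proof (intro mult_left_mono add_mono)
    have "real R \<le> real (2 * 2 ^ i)" using i(1) by (simp only: of_nat_le_iff) simp
    hence "real R \<le> 2 * real (2 ^ i)" by simp
    hence "sqrt (real P * real N) * (1 / real (2 ^ i)) \<le> sqrt (real P * real N) * (2 / real R)"
      using assms(3) by (intro mult_left_mono) (auto simp: field_simps)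
    thus "sqrt (real P * real N) / real (2 ^ i) \<le> 2 * sqrt (real P * real N) / real R" by (simp add: mult_ac)
    show "real (2 ^ i) \<le> real U" using i(2) by (simp only: of_nat_le_iff)
  qed auto
  finally show "(\<Sum>r\<in>{2 ^ i..<2 * 2 ^ i}. if R < r \<and> r \<le> U then ?t r else 0) \<le> \<dots>" .
qed (use assms in auto)

text \<open>
  In a dyadic block of \<open>m\<close> the condition \<open>m n \<le> N\<close> and the weight are separated by expanding the
  weight, as a function of \<open>n\<close>, in additive characters modulo \<open>N'\<close>.
\<close>

lemma dyadic_block_separation:
  assumes f0: "\<forall>n>0. norm (f n) \<le> 1" and g0: "\<forall>n>0. norm (g n) \<le> 1" and i: "2 ^ i \<le> N"
  defines "N' \<equiv> N div 2 ^ i + 1"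
  shows "\<exists>a b. (\<forall>k<N'. \<forall>m<2 * 2 ^ i. norm (a k m) \<le> 1) \<and> (\<forall>k<N'. \<forall>n<N'. norm (b k n) \<le> 1) \<and>
    (\<forall>\<psi> :: nat \<Rightarrow> complex. norm (\<Sum>m\<in>{2 ^ i..<2 * 2 ^ i}. if V < m \<and> m \<le> N then
        (\<Sum>n\<in>{V<..N div m}. g m * f n * of_real (log_weight m n) * (cnj (\<psi> m) * cnj (\<psi> n))) else 0)
      \<le> (\<Sum>k<N'. fourier_majorant N' k * (norm (twisted_sum (2 * 2 ^ i) (a k) \<psi>) * norm (twisted_sum N' (b k) \<psi>))))"
proof -
  note f = f0[rule_format] and g = g0[rule_format]
  have "\<exists>h. (\<forall>n<N'. (if V < n \<and> n \<le> N div m then of_real (log_weight m n) else 0) = (\<Sum>k<N'. h k * unit_root N' (k * n)))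
      \<and> (\<forall>k<N'. norm (h k) \<le> fourier_majorant N' k)" if m: "m \<ge> 2 ^ i" for m
  proof -
    have m0: "m > 0" using m by (metis gr0I not_numeral_le_zero power_not_zero zero_neq_numeral le_zero_eq)
    show ?thesis
    proof (rule fourier_separation[of V "N div m" "log_weight m" N'])
      show "mono_on {V<..N div m} (log_weight m) \<or> antimono_on {V<..N div m} (log_weight m)"
        using log_weight_mono[OF m0] by blast
      show "0 \<le> log_weight m n \<and> log_weight m n \<le> 1" if "V < n" for n
        using that by (intro log_weight_bounds m0) simp
      \<comment> \<open>This is the reason for the modulus: for m \<ge> 2^i every admissible
        \<open>n\<close> is at most N div 2^i = N' - 1.\<close>
      show "N div m < N'" unfolding N'_def using div_le_mono2[OF _ m, of N] by simp
      fix h assume h: "\<And>n. n < N' \<Longrightarrow> (if V < n \<and> n \<le> N div m then of_real (log_weight m n) else 0) = (\<Sum>k<N'. h k * unit_root N' (k * n))"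
        "\<And>k. k < N' \<Longrightarrow> norm (h k) \<le> fourier_majorant N' k"
      show ?thesis using h by (intro exI[of _ h] conjI allI impI)
    qed
  qed
  then obtain h where h: "\<And>m n. m \<ge> 2 ^ i \<Longrightarrow> n < N' \<Longrightarrow> (if V < n \<and> n \<le> N div m then complex_of_real (log_weight m n) else 0) = (\<Sum>k<N'. h m k * unit_root N' (k * n))"
    "\<And>m k. m \<ge> 2 ^ i \<Longrightarrow> k < N' \<Longrightarrow> norm (h m k) \<le> fourier_majorant N' k" by metis
  have F0: "fourier_majorant N' k > 0" if "k < N'" for k
    using that by (auto simp: fourier_majorant_def intro: add_pos_pos)
  \<comment> \<open>The Fourier coefficient depends on \<open>m\<close> and the frequency only, so
    it joins the coefficient of \<open>m\<close>. Dividing by the majorant makes the new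
    coefficients bounded by 1; in \<open>b\<close> the index 0 is removed because \<open>f 0\<close>
    is arbitrary.\<close>
  define a where "a = (\<lambda>k m. if 2 ^ i \<le> m \<and> V < m \<and> m \<le> N then g m * h m k / of_real (fourier_majorant N' k) else 0)"
  define b where "b = (\<lambda>k n. if n = 0 then 0 else f n * unit_root N' (k * n))"
  have a: "norm (a k m) \<le> 1" if "k < N'" "m < 2 * 2 ^ i" for k m
  proof (cases "2 ^ i \<le> m \<and> V < m \<and> m \<le> N")
    case True
    hence "norm (g m) * norm (h m k) \<le> 1 * fourier_majorant N' k"
      using g[of m] h(2)[of m k] that by (intro mult_mono) auto
    thus ?thesis using True F0[OF that(1)] by (simp add: a_def norm_mult norm_divide divide_le_eq)
  next
    case False
    hence "a k m = 0" by (auto simp: a_def)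
    thus ?thesis by simp
  qed
  have b: "norm (b k n) \<le> 1" if "k < N'" "n < N'" for k n
    using f[of n] by (auto simp: b_def norm_mult)
  have main: "norm (\<Sum>m\<in>{2 ^ i..<2 * 2 ^ i}. if V < m \<and> m \<le> N then
        (\<Sum>n\<in>{V<..N div m}. g m * f n * of_real (log_weight m n) * (cnj (\<psi> m) * cnj (\<psi> n))) else 0)
      \<le> (\<Sum>k<N'. fourier_majorant N' k * (norm (twisted_sum (2 * 2 ^ i) (a k) \<psi>) * norm (twisted_sum N' (b k) \<psi>)))"
    for \<psi> :: "nat \<Rightarrow> complex"
  proof -
    have "(if V < m \<and> m \<le> N then (\<Sum>n\<in>{V<..N div m}. g m * f n * of_real (log_weight m n) * (cnj (\<psi> m) * cnj (\<psi> n))) else 0)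
      = (\<Sum>k<N'. of_real (fourier_majorant N' k) * (a k m * cnj (\<psi> m) * twisted_sum N' (b k) \<psi>))"
      if m: "m \<in> {2 ^ i..<2 * 2 ^ i}" for m
    proof (cases "V < m \<and> m \<le> N")
      case True
      have m0: "m > 0" using True by simp
      have Nm: "N div m < N'" unfolding N'_def using m div_le_mono2[of "2 ^ i" m N] by simp
      have "(\<Sum>n\<in>{V<..N div m}. g m * f n * of_real (log_weight m n) * (cnj (\<psi> m) * cnj (\<psi> n)))
          = (\<Sum>n<N'. g m * cnj (\<psi> m) * (if n = 0 then 0 else f n) * cnj (\<psi> n) * (if V < n \<and> n \<le> N div m then complex_of_real (log_weight m n) else 0))"
        using Nm by (intro sum.mono_neutral_cong_left) auto
      also have "\<dots> = (\<Sum>n<N'. \<Sum>k<N'. g m * cnj (\<psi> m) * h m k * (b k n * cnj (\<psi> n)))"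
      proof (intro sum.cong refl)
        fix n assume "n \<in> {..<N'}"
        hence hn: "(if V < n \<and> n \<le> N div m then complex_of_real (log_weight m n) else 0) = (\<Sum>k<N'. h m k * unit_root N' (k * n))"
          using m by (intro h) auto
        show "g m * cnj (\<psi> m) * (if n = 0 then 0 else f n) * cnj (\<psi> n) * (if V < n \<and> n \<le> N div m then complex_of_real (log_weight m n) else 0)
          = (\<Sum>k<N'. g m * cnj (\<psi> m) * h m k * (b k n * cnj (\<psi> n)))"
          unfolding hn sum_distrib_left by (intro sum.cong refl) (simp add: b_def mult_ac)
      qed
      also have "\<dots> = (\<Sum>k<N'. g m * cnj (\<psi> m) * h m k * twisted_sum N' (b k) \<psi>)"
        unfolding twisted_sum_def by (subst sum.swap) (simp add: sum_distrib_left)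
      also have "\<dots> = (\<Sum>k<N'. of_real (fourier_majorant N' k) * (a k m * cnj (\<psi> m) * twisted_sum N' (b k) \<psi>))"
      proof (intro sum.cong refl)
        fix k assume "k \<in> {..<N'}"
        hence "fourier_majorant N' k \<noteq> 0" using F0[of k] by simp
        thus "g m * cnj (\<psi> m) * h m k * twisted_sum N' (b k) \<psi> = of_real (fourier_majorant N' k) * (a k m * cnj (\<psi> m) * twisted_sum N' (b k) \<psi>)"
          using True m by (simp add: a_def)
      qed
      finally show ?thesis using True by simp
    next
      case False
      hence "a k m = 0" for k by (auto simp: a_def)
      thus ?thesis using False by auto
    qed
    hence "(\<Sum>m\<in>{2 ^ i..<2 * 2 ^ i}. if V < m \<and> m \<le> N then
        (\<Sum>n\<in>{V<..N div m}. g m * f n * of_real (log_weight m n) * (cnj (\<psi> m) * cnj (\<psi> n))) else 0)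
      = (\<Sum>m\<in>{2 ^ i..<2 * 2 ^ i}. \<Sum>k<N'. of_real (fourier_majorant N' k) * (a k m * cnj (\<psi> m) * twisted_sum N' (b k) \<psi>))"
      by (intro sum.cong refl)
    also have "\<dots> = (\<Sum>k<N'. of_real (fourier_majorant N' k) * ((\<Sum>m\<in>{2 ^ i..<2 * 2 ^ i}. a k m * cnj (\<psi> m)) * twisted_sum N' (b k) \<psi>))"
      unfolding sum_distrib_left sum_distrib_right by (rule sum.swap)
    also have "\<dots> = (\<Sum>k<N'. of_real (fourier_majorant N' k) * (twisted_sum (2 * 2 ^ i) (a k) \<psi> * twisted_sum N' (b k) \<psi>))"
    proof (intro sum.cong refl)
      fix k
      have "(\<Sum>m\<in>{2 ^ i..<2 * 2 ^ i}. a k m * cnj (\<psi> m)) = twisted_sum (2 * 2 ^ i) (a k) \<psi>"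
        unfolding twisted_sum_def by (intro sum.mono_neutral_left) (auto simp: a_def)
      thus "of_real (fourier_majorant N' k) * ((\<Sum>m\<in>{2 ^ i..<2 * 2 ^ i}. a k m * cnj (\<psi> m)) * twisted_sum N' (b k) \<psi>)
        = of_real (fourier_majorant N' k) * (twisted_sum (2 * 2 ^ i) (a k) \<psi> * twisted_sum N' (b k) \<psi>)" by simp
    qed
    finally have eq: "(\<Sum>m\<in>{2 ^ i..<2 * 2 ^ i}. if V < m \<and> m \<le> N then
        (\<Sum>n\<in>{V<..N div m}. g m * f n * of_real (log_weight m n) * (cnj (\<psi> m) * cnj (\<psi> n))) else 0)
      = (\<Sum>k<N'. of_real (fourier_majorant N' k) * (twisted_sum (2 * 2 ^ i) (a k) \<psi> * twisted_sum N' (b k) \<psi>))" .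
    show ?thesis unfolding eq
      by (intro sum_norm_le) (simp add: norm_mult fourier_majorant_nonneg)
  qed
  show ?thesis
  proof (rule exI[of _ a], rule exI[of _ b], intro conjI allI impI)
    show "norm (a k m) \<le> 1" if "k < N'" "m < 2 * 2 ^ i" for k m by (rule a[OF that])
    show "norm (b k n) \<le> 1" if "k < N'" "n < N'" for k n by (rule b[OF that])
  qed (rule main)
qed

text \<open>The lengths P of the range of \<open>m\<close> and N' of the range of \<open>n\<close>
  satisfy P N' \<le> 4x. Since the block meets m > V and n > V, neither length is small compared
  with V, so each is at most 4x/V. This is where keeping both variables above V pays off.\<close>

lemma dyadic_block_bound:
  assumes f: "\<And>n. n > 0 \<Longrightarrow> norm (f n) \<le> 1" and g: "\<And>n. n > 0 \<Longrightarrow> norm (g n) \<le> 1" and i: "2 ^ i \<le> N"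
    and N: "real N \<le> x" and R: "R \<ge> 1" and U: "real U \<le> x" and V: "V > 0" "V < 2 ^ (i + 1)" "V < N div 2 ^ i"
  shows "(\<Sum>r\<in>{R<..U}. 1 / real (totient r) * (\<Sum>\<psi>\<in>prim_chars r. norm (\<Sum>m\<in>{2 ^ i..<2 * 2 ^ i}. if V < m \<and> m \<le> N then
        (\<Sum>n\<in>{V<..N div m}. g m * f n * of_real (log_weight m n) * (cnj (\<psi> m) * cnj (\<psi> n))) else 0)))
    \<le> (10 + 4 * ln x) * ((1 + 2 * ln x) * (16 * sqrt x * (4 * sqrt x / real R + 8 * sqrt (x / real V) + 4 * real U)))"
proof -
  define N' where "N' = N div 2 ^ i + 1"
  define P :: nat where "P = 2 * 2 ^ i"
  define T where "T \<psi> = (\<Sum>m\<in>{2 ^ i..<2 * 2 ^ i}. if V < m \<and> m \<le> N then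
        (\<Sum>n\<in>{V<..N div m}. g m * f n * of_real (log_weight m n) * (cnj (\<psi> m) * cnj (\<psi> n))) else 0)" for \<psi> :: "nat \<Rightarrow> complex"
  define \<B> where "\<B> = (1 + 2 * ln x) * (8 * sqrt (real P * real N') * (2 * sqrt (real P * real N') / real R + 2 * sqrt (real P) + 2 * sqrt (real N') + 4 * real U))"
  have "(1::nat) \<le> 2 ^ i" by simp
  hence N1: "N \<ge> 1" using i by linarith
  hence x: "x \<ge> 1" using N by linarith
  have "\<forall>n>0. norm (f n) \<le> 1" "\<forall>n>0. norm (g n) \<le> 1" using f g by blast+
  from dyadic_block_separation[OF this i, where V = V, folded T_def, folded N'_def P_def]
  obtain a b where a: "\<forall>k<N'. \<forall>m<P. norm (a k m) \<le> 1" and b: "\<forall>k<N'. \<forall>n<N'. norm (b k n) \<le> 1"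
    and T': "\<forall>\<psi>. norm (T \<psi>) \<le> (\<Sum>k<N'. fourier_majorant N' k * (norm (twisted_sum P (a k) \<psi>) * norm (twisted_sum N' (b k) \<psi>)))"
    by (elim exE conjE)
  note T = T'[rule_format]
  have "(\<Sum>r\<in>{R<..U}. 1 / real (totient r) * (\<Sum>\<psi>\<in>prim_chars r. norm (T \<psi>)))
      \<le> (\<Sum>r\<in>{R<..U}. 1 / real (totient r) * (\<Sum>\<psi>\<in>prim_chars r. \<Sum>k<N'. fourier_majorant N' k * (norm (twisted_sum P (a k) \<psi>) * norm (twisted_sum N' (b k) \<psi>))))"
    by (intro sum_mono mult_left_mono T) auto
  also have "\<dots> = (\<Sum>r\<in>{R<..U}. \<Sum>k<N'. fourier_majorant N' k * (1 / real (totient r) * (\<Sum>\<psi>\<in>prim_chars r. norm (twisted_sum P (a k) \<psi>) * norm (twisted_sum N' (b k) \<psi>))))"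
  proof (intro sum.cong refl)
    fix r
    have "(\<Sum>\<psi>\<in>prim_chars r. \<Sum>k<N'. fourier_majorant N' k * (norm (twisted_sum P (a k) \<psi>) * norm (twisted_sum N' (b k) \<psi>)))
        = (\<Sum>k<N'. fourier_majorant N' k * (\<Sum>\<psi>\<in>prim_chars r. norm (twisted_sum P (a k) \<psi>) * norm (twisted_sum N' (b k) \<psi>)))"
      unfolding sum_distrib_left by (rule sum.swap)
    thus "1 / real (totient r) * (\<Sum>\<psi>\<in>prim_chars r. \<Sum>k<N'. fourier_majorant N' k * (norm (twisted_sum P (a k) \<psi>) * norm (twisted_sum N' (b k) \<psi>)))
        = (\<Sum>k<N'. fourier_majorant N' k * (1 / real (totient r) * (\<Sum>\<psi>\<in>prim_chars r. norm (twisted_sum P (a k) \<psi>) * norm (twisted_sum N' (b k) \<psi>))))"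
      by (simp only: sum_distrib_left mult.left_commute)
  qed
  also have "\<dots> = (\<Sum>k<N'. fourier_majorant N' k * (\<Sum>r\<in>{R<..U}. 1 / real (totient r) * (\<Sum>\<psi>\<in>prim_chars r. norm (twisted_sum P (a k) \<psi>) * norm (twisted_sum N' (b k) \<psi>))))"
    unfolding sum_distrib_left[of "fourier_majorant _ _"] by (rule sum.swap)
  also have "\<dots> \<le> (\<Sum>k<N'. fourier_majorant N' k * \<B>)"
    unfolding \<B>_def using a b R U x by (intro sum_mono mult_left_mono bilinear_large_sieve fourier_majorant_nonneg) auto
  also have "\<dots> = (\<Sum>k<N'. fourier_majorant N' k) * \<B>" by (rule sum_distrib_right[symmetric])
  also have "\<dots> \<le> (10 + 4 * ln x) * ((1 + 2 * ln x) * (16 * sqrt x * (4 * sqrt x / real R + 8 * sqrt (x / real V) + 4 * real U)))"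
  proof (rule mult_mono)
    have "N div 2 ^ i \<le> N" by simp
    hence "real N' \<le> 2 * x" using N N1 unfolding N'_def by linarith
    hence "ln (real N') \<le> ln (2 * x)" unfolding N'_def using x by (subst ln_le_cancel_iff) auto
    also have "\<dots> = ln 2 + ln x" using x by (simp add: ln_mult)
    also have "ln 2 \<le> (1::real)" using ln_le_minus_one[of 2] by simp
    finally have lnN: "ln (real N') \<le> 1 + ln x" by simp
    have "(\<Sum>k<N'. fourier_majorant N' k) \<le> 6 + 4 * ln (real N')" by (rule sum_fourier_majorant_le) (simp add: N'_def)
    also have "\<dots> \<le> 10 + 4 * ln x" using lnN by simp
    finally show "(\<Sum>k<N'. fourier_majorant N' k) \<le> 10 + 4 * ln x" .
    have PN: "real P * real N' \<le> 4 * x"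
    proof -
      have "P * N' \<le> 2 * (2 ^ i * (N div 2 ^ i)) + 2 * 2 ^ i" by (simp add: P_def N'_def algebra_simps)
      also have "2 ^ i * (N div 2 ^ i) \<le> N" by (rule times_div_less_eq_dividend)
      finally have "P * N' \<le> 4 * N" using i by linarith
      hence "real (P * N') \<le> real (4 * N)" by (simp only: of_nat_le_iff)
      thus ?thesis using N by simp
    qed
    have P: "real P \<le> 4 * (x / real V)"
    proof -
      have "V * 2 ^ i \<le> (N div 2 ^ i) * 2 ^ i" using V(3) by (intro mult_right_mono) auto
      also have "\<dots> \<le> N" by (rule div_times_less_eq_dividend)
      finally have "real (V * 2 ^ i) \<le> real N" by (simp only: of_nat_le_iff)
      hence "real V * 2 ^ i \<le> x" using N by simp
      hence "2 ^ i \<le> x / real V" using V(1) by (simp add: field_simps)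
      moreover have "0 \<le> x / real V" using x by simp
      ultimately show ?thesis by (simp add: P_def)
    qed
    have Q: "real N' \<le> 4 * (x / real V)"
    proof -
      have "V * N' \<le> P * N'" using V(2) by (intro mult_right_mono) (auto simp: P_def)
      hence "real V * real N' \<le> real P * real N'" by (simp only: of_nat_le_iff flip: of_nat_mult)
      hence "real V * real N' \<le> 4 * x" using PN by simp
      thus ?thesis using V(1) by (simp add: field_simps)
    qed
    have s1: "sqrt (real P * real N') \<le> 2 * sqrt x"
      using real_sqrt_le_mono[OF PN] by (simp add: real_sqrt_mult)
    have s2: "sqrt (real P) \<le> 2 * sqrt (x / real V)"
      using real_sqrt_le_mono[OF P] unfolding real_sqrt_mult[of 4] by simp
    have s3: "sqrt (real N') \<le> 2 * sqrt (x / real V)"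
      using real_sqrt_le_mono[OF Q] unfolding real_sqrt_mult[of 4] by simp
    have "2 * sqrt (real P * real N') / real R \<le> 4 * sqrt x / real R"
      using s1 by (intro divide_right_mono) auto
    hence br: "2 * sqrt (real P * real N') / real R + 2 * sqrt (real P) + 2 * sqrt (real N') + 4 * real U
        \<le> 4 * sqrt x / real R + 8 * sqrt (x / real V) + 4 * real U"
      using s2 s3 by linarith
    show "\<B> \<le> (1 + 2 * ln x) * (16 * sqrt x * (4 * sqrt x / real R + 8 * sqrt (x / real V) + 4 * real U))"
      unfolding \<B>_def
    proof (rule mult_left_mono[OF mult_mono[OF _ br]])
      show "8 * sqrt (real P * real N') \<le> 16 * sqrt x" using s1 by simp
    qed (use x in auto)
    show "0 \<le> \<B>" unfolding \<B>_def using x by (intro mult_nonneg_nonneg add_nonneg_nonneg) auto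
  qed (use x in auto)
  finally show ?thesis unfolding T_def .
qed

lemma sum_bilinear_prim_chars_bound:
  assumes f: "\<And>n. n > 0 \<Longrightarrow> norm (f n) \<le> 1" and g: "\<And>n. n > 0 \<Longrightarrow> norm (g n) \<le> 1"
    and N: "real N \<le> x" "x \<ge> 1" and R: "R \<ge> 1" and U: "real U \<le> x" and V: "V > 0"
  shows "(\<Sum>r\<in>{R<..U}. 1 / real (totient r) * (\<Sum>\<psi>\<in>prim_chars r. norm (bilinear_sum g f V N \<psi>)))
    \<le> (1 + 2 * ln x) * ((10 + 4 * ln x) * ((1 + 2 * ln x) * (16 * sqrt x * (4 * sqrt x / real R + 8 * sqrt (x / real V) + 4 * real U))))"
proof -
  define c where "c = (\<lambda>(\<psi> :: nat \<Rightarrow> complex) (m :: nat). \<Sum>n\<in>{V<..N div m}. g m * f n * of_real (log_weight m n) * (cnj (\<psi> m) * cnj (\<psi> n)))"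
  define B where "B = (10 + 4 * ln x) * ((1 + 2 * ln x) * (16 * sqrt x * (4 * sqrt x / real R + 8 * sqrt (x / real V) + 4 * real U)))"
  have B: "B \<ge> 0" unfolding B_def using N by (intro mult_nonneg_nonneg add_nonneg_nonneg) auto
  let ?b = "\<lambda>\<psi> i. \<Sum>m\<in>{2 ^ i..<2 * 2 ^ i}. if V < m \<and> m \<le> N then c \<psi> m else 0"
  define k where "k = nat \<lfloor>log 2 x\<rfloor>"
  have k: "real k + 1 \<le> 1 + 2 * ln x" unfolding k_def by (rule floor_log2_le[OF N(2)])
  have "(\<Sum>r\<in>{R<..U}. 1 / real (totient r) * (\<Sum>\<psi>\<in>prim_chars r. norm (bilinear_sum g f V N \<psi>)))
      \<le> (\<Sum>r\<in>{R<..U}. 1 / real (totient r) * (\<Sum>\<psi>\<in>prim_chars r. \<Sum>i\<in>{0..k}. norm (?b \<psi> i)))"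
  proof (intro sum_mono mult_left_mono)
    fix r \<psi> assume "\<psi> \<in> prim_chars r"
    hence \<psi>: "dirichlet_char r \<psi>" by (simp add: prim_chars_def primitive_char_def)
    have "bilinear_sum g f V N \<psi> = (\<Sum>m\<in>{V<..N}. c \<psi> m)"
      by (simp add: bilinear_sum_def c_def dirichlet_char_mult[OF \<psi>])
    also have "\<dots> = (\<Sum>i\<in>{0..k}. ?b \<psi> i)" unfolding k_def by (rule dyadic_partition[OF N])
    finally show "norm (bilinear_sum g f V N \<psi>) \<le> (\<Sum>i\<in>{0..k}. norm (?b \<psi> i))"
      by (simp only: norm_sum)
  qed auto
  also have "\<dots> = (\<Sum>i\<in>{0..k}. \<Sum>r\<in>{R<..U}. 1 / real (totient r) * (\<Sum>\<psi>\<in>prim_chars r. norm (?b \<psi> i)))"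
  proof -
    have "(\<Sum>r\<in>{R<..U}. 1 / real (totient r) * (\<Sum>\<psi>\<in>prim_chars r. \<Sum>i\<in>{0..k}. norm (?b \<psi> i)))
       = (\<Sum>r\<in>{R<..U}. \<Sum>i\<in>{0..k}. 1 / real (totient r) * (\<Sum>\<psi>\<in>prim_chars r. norm (?b \<psi> i)))"
      by (intro sum.cong refl, subst sum.swap) (simp only: sum_distrib_left)
    thus ?thesis by (simp only: sum.swap[of _ "{0..k}"])
  qed
  also have "\<dots> \<le> (\<Sum>i\<in>{0..k}. B)"
  proof (rule sum_mono)
    fix i assume "i \<in> {0..k}"
    show "(\<Sum>r\<in>{R<..U}. 1 / real (totient r) * (\<Sum>\<psi>\<in>prim_chars r. norm (?b \<psi> i))) \<le> B"
    proof (cases "2 ^ i \<le> N \<and> V < 2 ^ (i + 1) \<and> V < N div 2 ^ i")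
      case True
      thus ?thesis unfolding c_def B_def using N R U V f g by (intro dyadic_block_bound) auto
    next
      case False
      \<comment> \<open>In this case the block contains no pair with m > V, n > V and m n \<le>
        N.\<close>
      have zero: "?b \<psi> i = 0" for \<psi>
      proof (rule sum.neutral, intro ballI)
        fix m :: nat assume m: "m \<in> {2 ^ i..<2 * 2 ^ i}"
        have "N div m \<le> N div 2 ^ i" using m by (intro div_le_mono2) auto
        hence "N div m \<le> V" if "V < m" "m \<le> N" using False m that by auto
        thus "(if V < m \<and> m \<le> N then c \<psi> m else 0) = 0" by (auto simp: c_def)
      qed
      show ?thesis unfolding zero using B by simp
    qed
  qed
  also have "\<dots> = (real k + 1) * B" by simp
  also have "\<dots> \<le> (1 + 2 * ln x) * B" using k B by (rule mult_right_mono)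
  finally show ?thesis unfolding B_def .
qed

section \<open>Imprimitive characters of large conductor\<close>

definition coprime_part :: "nat \<Rightarrow> (nat \<Rightarrow> complex) \<Rightarrow> nat \<Rightarrow> complex" where
  "coprime_part s u n = (if coprime n s then u n else 0)"

text \<open>The imprimitivity is moved from the character to the coefficients: \<open>\<psi>\<close>
  already vanishes off the units mod \<open>r\<close>, and coprimality to the cofactor
  \<open>s\<close> is imposed on \<open>g\<close> and \<open>f\<close>. The coefficients stay
  bounded by 1, all that the large sieve asks of them.\<close>

lemma bilinear_sum_induced:
  assumes "induced_by q \<eta> r \<psi>" "q = r * s"
  shows "bilinear_sum g f V N \<eta> = bilinear_sum (coprime_part s g) (coprime_part s f) V N \<psi>"
  unfolding bilinear_sum_def
proof (intro sum.cong refl)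
  fix m n
  have \<psi>: "dirichlet_char r \<psi>" using assms by (simp add: induced_by_def)
  have "\<eta> (m * n) = (if coprime m s \<and> coprime n s then \<psi> (m * n) else 0)"
    using induced_by_eq[OF assms(1)] dirichlet_char_eq_0_iff[OF \<psi>, of "m * n"] by (auto simp: assms(2))
  thus "g m * f n * of_real (log_weight m n) * cnj (\<eta> (m * n)) =
    coprime_part s g m * coprime_part s f n * of_real (log_weight m n) * cnj (\<psi> (m * n))"
    by (auto simp: coprime_part_def)
qed

text \<open>Write q = r s with r the conductor; the triple of s, r and the primitive character
  determines q and the character, and \<phi>(q) \<ge> \<phi>(r) \<phi>(s). For fixed s the conductor
  runs up to M div s. Summed over s, the terms free of M cost the logarithm of the sum of
  1/\<phi>(s), whereas the term in M gains a factor 1/s and costs only a constant.\<close>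

lemma large_conductor_bound:
  assumes f: "\<And>n. n > 0 \<Longrightarrow> norm (f n) \<le> 1" and g: "\<And>n. n > 0 \<Longrightarrow> norm (g n) \<le> 1"
    and N: "real N \<le> x" "x \<ge> 1" and R: "R \<ge> 1" and M: "real M \<le> x" "M > 0" and V: "V > 0"
  shows "(\<Sum>q = 1..M. 1 / real (totient q) * (\<Sum>\<eta> | \<eta> \<in> chars q \<and> conductor q \<eta> > R. norm (bilinear_sum g f V N \<eta>)))
    \<le> (1 + 2 * ln x) * ((10 + 4 * ln x) * ((1 + 2 * ln x) * (16 * sqrt x *
        ((4 * sqrt x / real R + 8 * sqrt (x / real V)) * (4 * (1 + ln x)) + 16 * real M))))"
proof -
  let ?A = "SIGMA q:{1..M}. {\<eta>. \<eta> \<in> chars q \<and> conductor q \<eta> > R}"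
  let ?B = "SIGMA s:{1..M}. SIGMA r:{R<..M div s}. prim_chars r"
  define K where "K = (1 + 2 * ln x) * ((10 + 4 * ln x) * ((1 + 2 * ln x) * (16 * sqrt x)))"
  define a where "a = 4 * sqrt x / real R + 8 * sqrt (x / real V)"
  define T where "T = (\<lambda>s. bilinear_sum (coprime_part s g) (coprime_part s f) V N)"
  define \<tau> where "\<tau> = (\<lambda>(q, \<eta>). (q div conductor q \<eta>, primitive_inducer q \<eta>))"
  have K: "K \<ge> 0" unfolding K_def using N by (intro mult_nonneg_nonneg) auto
  have a: "a \<ge> 0" unfolding a_def using N by (intro add_nonneg_nonneg) auto
  have fin: "finite ?B" by (auto intro: finite_prim_chars)
  have \<tau>: "\<exists>s r \<psi>. \<tau> (q, \<eta>) = (s, r, \<psi>) \<and> q = r * s \<and> induced_by q \<eta> r \<psi> \<and> (s, r, \<psi>) \<in> ?B"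
    if "(q, \<eta>) \<in> ?A" for q \<eta>
  proof -
    obtain r \<psi> where p: "primitive_inducer q \<eta> = (r, \<psi>)" by (cases "primitive_inducer q \<eta>")
    have d: "dirichlet_char q \<eta>" using that by (auto simp: chars_def)
    note ind = primitive_inducer_spec[OF d p]
    have "r dvd q" using ind(2) by (simp add: induced_by_def)
    then obtain s where s: "q = r * s" by blast
    have q: "1 \<le> q" "q \<le> M" and r: "R < r" using that p by (auto simp: conductor_def)
    have sr: "s \<ge> 1" "r \<ge> 1" using q s by (auto simp: Suc_le_eq)
    have "\<tau> (q, \<eta>) = (s, r, \<psi>)" using p s sr by (simp add: \<tau>_def conductor_def)
    moreover have "s \<le> M" using s sr q by (metis dvd_imp_le dvd_triv_right le_trans less_le_trans zero_less_one)
    moreover have "r \<le> M div s" using s sr q by (simp add: less_eq_div_iff_mult_less_eq)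
    ultimately show ?thesis using s ind r sr by (auto simp: prim_chars_def)
  qed
  have inj: "inj_on \<tau> ?A"
  proof (rule inj_onI)
    fix z z' assume z: "z \<in> ?A" "z' \<in> ?A" "\<tau> z = \<tau> z'"
    obtain q \<eta> q' \<eta>' where e: "z = (q, \<eta>)" "z' = (q', \<eta>')" by (cases z, cases z')
    from \<tau>[of q \<eta>] \<tau>[of q' \<eta>'] z obtain s r \<psi> where
      "q = r * s" "induced_by q \<eta> r \<psi>" "q' = r * s" "induced_by q' \<eta>' r \<psi>" unfolding e by force
    thus "z = z'" using induced_by_eq[of q \<eta> r \<psi>] induced_by_eq[of q' \<eta>' r \<psi>] by (simp add: e)
  qed
  define w where "w = (\<lambda>(s, r, \<psi>). 1 / real (totient s) * (1 / real (totient r) * norm (T s \<psi>)))"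
  have "(\<Sum>q = 1..M. 1 / real (totient q) * (\<Sum>\<eta> | \<eta> \<in> chars q \<and> conductor q \<eta> > R. norm (bilinear_sum g f V N \<eta>)))
      = (\<Sum>z\<in>?A. 1 / real (totient (fst z)) * norm (bilinear_sum g f V N (snd z)))"
    unfolding sum_distrib_left by (subst sum.Sigma) (auto simp: case_prod_beta intro: finite_subset[OF _ finite_chars])
  also have "\<dots> \<le> (\<Sum>z\<in>?A. w (\<tau> z))"
  proof (rule sum_mono)
    fix z assume z: "z \<in> ?A"
    obtain q \<eta> where e: "z = (q, \<eta>)" by (cases z)
    from \<tau>[of q \<eta>] z obtain s r \<psi> where
      t: "\<tau> (q, \<eta>) = (s, r, \<psi>)" "q = r * s" "induced_by q \<eta> r \<psi>" "(s, r, \<psi>) \<in> ?B" unfolding e by blast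
    have pos: "totient s > 0" "totient r > 0" using t(4) by auto
    have "real (totient s) * real (totient r) \<le> real (totient q)"
      using totient_supermult[of s r] t(2) by (simp add: mult.commute flip: of_nat_mult)
    hence "1 / real (totient q) \<le> 1 / (real (totient s) * real (totient r))"
      using pos by (intro divide_left_mono mult_pos_pos) (auto simp: t(2))
    hence "1 / real (totient q) * norm (T s \<psi>) \<le> 1 / (real (totient s) * real (totient r)) * norm (T s \<psi>)"
      by (rule mult_right_mono) auto
    thus "1 / real (totient (fst z)) * norm (bilinear_sum g f V N (snd z)) \<le> w (\<tau> z)"
      using bilinear_sum_induced[OF t(3,2), of g f V N] by (simp add: e t(1) w_def T_def)
  qed
  also have "\<dots> = (\<Sum>y\<in>\<tau> ` ?A. w y)" by (simp only: sum.reindex[OF inj] o_def)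
  also have "\<dots> \<le> (\<Sum>y\<in>?B. w y)"
    using \<tau> fin by (intro sum_mono2) (fastforce simp: w_def)+
  also have "\<dots> = (\<Sum>s = 1..M. 1 / real (totient s) * (\<Sum>r\<in>{R<..M div s}. 1 / real (totient r) * (\<Sum>\<psi>\<in>prim_chars r. norm (T s \<psi>))))"
    unfolding sum_distrib_left by (subst sum.Sigma, (auto intro: finite_prim_chars)[2], subst sum.Sigma)
      (auto intro: finite_prim_chars simp: w_def case_prod_beta)
  also have "\<dots> \<le> (\<Sum>s = 1..M. 1 / real (totient s) * (K * (a + 4 * (real M / real s))))"
  proof (intro sum_mono mult_left_mono)
    fix s assume s: "s \<in> {1..M}"
    have cp: "norm (coprime_part s u n) \<le> 1" if "norm (u n) \<le> 1" for u n using that by (simp add: coprime_part_def)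
    have Ms: "real (M div s) \<le> real M / real s" by (rule of_nat_div_le_of_nat)
    have "real (M div s) \<le> x" using M(1) div_le_dividend[of M s] by linarith
    hence "(\<Sum>r\<in>{R<..M div s}. 1 / real (totient r) * (\<Sum>\<psi>\<in>prim_chars r. norm (T s \<psi>)))
      \<le> (1 + 2 * ln x) * ((10 + 4 * ln x) * ((1 + 2 * ln x) * (16 * sqrt x * (4 * sqrt x / real R + 8 * sqrt (x / real V) + 4 * real (M div s)))))"
      unfolding T_def using f g N R V by (intro sum_bilinear_prim_chars_bound cp) auto
    also have "\<dots> = K * (a + 4 * real (M div s))" by (simp add: K_def a_def)
    also have "\<dots> \<le> K * (a + 4 * (real M / real s))" using K Ms by (intro mult_left_mono) auto
    finally show "(\<Sum>r\<in>{R<..M div s}. 1 / real (totient r) * (\<Sum>\<psi>\<in>prim_chars r. norm (T s \<psi>))) \<le> K * (a + 4 * (real M / real s))" .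
  qed auto
  also have "\<dots> = K * (a * (\<Sum>s = 1..M. 1 / real (totient s)) + 4 * real M * (\<Sum>s = 1..M. 1 / (real s * real (totient s))))"
    by (simp add: sum_distrib_left sum.distrib algebra_simps)
  also have "\<dots> \<le> K * (a * (4 * (1 + ln x)) + 4 * real M * 4)"
  proof (intro mult_left_mono add_mono sum_inverse_mult_totient_le)
    have "(\<Sum>s = 1..M. 1 / real (totient s)) \<le> 4 * (1 + ln (real M))" by (rule sum_inverse_totient_le[OF M(2)])
    also have "\<dots> \<le> 4 * (1 + ln x)" using M by simp
    finally show "(\<Sum>s = 1..M. 1 / real (totient s)) \<le> 4 * (1 + ln x)" .
  qed (use K a in auto)
  also have "4 * real M * 4 = 16 * real M" by simp
  finally show ?thesis by (simp only: K_def a_def mult.assoc)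
qed

section \<open>The restriction to primes\<close>


text \<open>A power p^j up to N with j \<ge> 2 has p \<le> sqrt N and j \<le> log N / log 2.\<close>

lemma card_proper_prime_powers_le:
  assumes "N \<ge> 1"
  shows "real (card {n \<in> {1..N}. primepow n \<and> \<not> prime n}) \<le> sqrt (real N) * (2 * ln (real N))"
proof -
  define z where "z = nat \<lfloor>sqrt (real N)\<rfloor>"
  define k where "k = nat \<lfloor>log 2 (real N)\<rfloor>"
  have "{n \<in> {1..N}. primepow n \<and> \<not> prime n} \<subseteq> (\<lambda>(p, j). p ^ j) ` ({1..z} \<times> {1..k})"
  proof
    fix n assume "n \<in> {n \<in> {1..N}. primepow n \<and> \<not> prime n}"
    hence n: "n \<le> N" "primepow n" "\<not> prime n" by auto
    then obtain p j where pj: "prime p" "j > 0" "n = p ^ j" by (auto simp: primepow_def)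
    have "j \<noteq> 1" using pj n by auto
    hence j2: "j \<ge> 2" using pj by linarith
    have p2: "p \<ge> 2" using prime_ge_2_nat[OF pj(1)] .
    have "p ^ 2 \<le> p ^ j" using p2 j2 by (intro power_increasing) auto
    hence "p\<^sup>2 \<le> N" using n pj by simp
    hence "(real p)\<^sup>2 \<le> real N" by (simp flip: of_nat_power)
    hence "real p \<le> sqrt (real N)" by (rule real_le_rsqrt)
    hence "p \<le> z" unfolding z_def by (simp add: le_nat_iff le_floor_iff)
    moreover have "j \<le> k"
    proof -
      have "(2::nat) ^ j \<le> p ^ j" using p2 by (intro power_mono) auto
      hence "real (2 ^ j) \<le> real N" using n pj by (simp only: of_nat_le_iff)
      hence "2 powr real j \<le> real N" by (simp add: powr_realpow)
      hence "real j \<le> log 2 (real N)" using assms by (simp add: le_log_iff)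
      thus ?thesis unfolding k_def by (simp add: le_nat_iff le_floor_iff)
    qed
    ultimately show "n \<in> (\<lambda>(p, j). p ^ j) ` ({1..z} \<times> {1..k})"
      using pj p2 by (intro image_eqI[of _ _ "(p, j)"]) auto
  qed
  hence "card {n \<in> {1..N}. primepow n \<and> \<not> prime n} \<le> card ({1..z} \<times> {1..k})"
    by (intro surj_card_le) auto
  hence "real (card {n \<in> {1..N}. primepow n \<and> \<not> prime n}) \<le> real z * real k"
    by (simp add: card_cartesian_product flip: of_nat_mult)
  also have "\<dots> \<le> sqrt (real N) * (2 * ln (real N))"
    using floor_log2_le[of "real N"] assms unfolding z_def k_def by (intro mult_mono) auto
  finally show ?thesis .
qed

text \<open>The pairs m k \<le> N are divided into m \<le> V, then k \<le> V < m, then both above V;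
  the last line removes the proper prime powers. In the first two sums the short variable stands
  outside and first in the product, matching \<open>type_I_bound\<close>.\<close>

lemma on_primes_decomposition:
  fixes u :: "nat \<Rightarrow> complex"
  assumes f: "f (Suc 0) = 1" "dirichlet_inverses f g" and V: "V \<le> N"
  shows "(\<Sum>n = 1..N. on_primes f n * u n) =
      (\<Sum>m = 1..V. g m * (\<Sum>k\<in>{0<..N div m}. of_real (log_weight m k) * f k * u (m * k)))
    + (\<Sum>k = 1..V. f k * (\<Sum>m\<in>{V<..N div k}. of_real (log_weight m k) * g m * u (k * m)))
    + (\<Sum>m\<in>{V<..N}. \<Sum>k\<in>{V<..N div m}. g m * f k * of_real (log_weight m k) * u (m * k))
    - (\<Sum>n = 1..N. (if prime n then 0 else Lambda_of f n / of_real (ln (real n))) * u n)"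
proof -
  define t where "t = (\<lambda>m k. g m * f k * of_real (log_weight m k) * u (m * k))"
  define h where "h = (\<lambda>n. Lambda_of f n / of_real (ln (real n)))"
  have "(\<Sum>n = 1..N. h n * u n) = (\<Sum>n = 1..N. \<Sum>m | m dvd n. t m (n div m))"
  proof (intro sum.cong refl)
    fix n assume "n \<in> {1..N}"
    hence n: "n > 0" by simp
    show "h n * u n = (\<Sum>m | m dvd n. t m (n div m))"
      unfolding h_def Lambda_of_eq_convolution[OF f n] sum_divide_distrib sum_distrib_right
      by (intro sum.cong refl) (auto simp: t_def log_weight_def)
  qed
  also have "\<dots> = (\<Sum>m = 1..N. \<Sum>k = 1..N div m. t m k)" by (rule sum_divisors_hyperbola)
  also have "\<dots> = (\<Sum>m = 1..V. \<Sum>k = 1..N div m. t m k) + (\<Sum>m\<in>{V<..N}. \<Sum>k = 1..N div m. t m k)"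
  proof -
    have "{1..N} = {1..V} \<union> {V<..N}" using V by auto
    thus ?thesis by (simp only:) (intro sum.union_disjoint, auto)
  qed
  also have "(\<Sum>m\<in>{V<..N}. \<Sum>k = 1..N div m. t m k)
      = (\<Sum>m\<in>{V<..N}. (\<Sum>k = 1..min V (N div m). t m k) + (\<Sum>k\<in>{V<..N div m}. t m k))"
  proof (intro sum.cong refl)
    fix m
    have "{1..N div m} = {1..min V (N div m)} \<union> {V<..N div m}" by auto
    thus "(\<Sum>k = 1..N div m. t m k) = (\<Sum>k = 1..min V (N div m). t m k) + (\<Sum>k\<in>{V<..N div m}. t m k)"
      by (simp only:) (intro sum.union_disjoint, auto)
  qed
  also have "\<dots> = (\<Sum>m\<in>{V<..N}. \<Sum>k = 1..min V (N div m). t m k) + (\<Sum>m\<in>{V<..N}. \<Sum>k\<in>{V<..N div m}. t m k)"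
    by (rule sum.distrib)
  also have "(\<Sum>m\<in>{V<..N}. \<Sum>k = 1..min V (N div m). t m k) = (\<Sum>k = 1..V. \<Sum>m\<in>{V<..N div k}. t m k)"
  proof -
    have "(\<Sum>m\<in>{V<..N}. \<Sum>k = 1..min V (N div m). t m k) = (\<Sum>(m, k)\<in>(SIGMA m:{V<..N}. {1..min V (N div m)}). t m k)"
      by (intro sum.Sigma) auto
    also have "\<dots> = (\<Sum>(k, m)\<in>(SIGMA k:{1..V}. {V<..N div k}). t m k)"
    proof (intro sum.reindex_bij_witness[of _ "\<lambda>(k, m). (m, k)" "\<lambda>(m, k). (k, m)"])
      fix p assume p0: "p \<in> (SIGMA m:{V<..N}. {1..min V (N div m)})"
      obtain m k where p: "p = (m, k)" by (cases p)
      have mk: "V < m" "m \<le> N" "1 \<le> k" "k \<le> V" "k \<le> N div m" using p0 unfolding p by auto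
      hence "m \<le> N div k" by (simp add: less_eq_div_iff_mult_less_eq mult.commute)
      thus "(case p of (m, k) \<Rightarrow> (k, m)) \<in> (SIGMA k:{1..V}. {V<..N div k})" using mk by (auto simp: p)
    next
      fix p assume p0: "p \<in> (SIGMA k:{1..V}. {V<..N div k})"
      obtain k m where p: "p = (k, m)" by (cases p)
      have mk: "V < m" "1 \<le> k" "k \<le> V" "m \<le> N div k" using p0 unfolding p by auto
      hence "k \<le> N div m" by (simp add: less_eq_div_iff_mult_less_eq mult.commute)
      moreover have "m \<le> N" using mk by (meson div_le_dividend order_trans)
      ultimately show "(case p of (k, m) \<Rightarrow> (m, k)) \<in> (SIGMA m:{V<..N}. {1..min V (N div m)})" using mk by (auto simp: p)
    qed auto
    also have "\<dots> = (\<Sum>k = 1..V. \<Sum>m\<in>{V<..N div k}. t m k)" by (intro sum.Sigma[symmetric]) auto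
    finally show ?thesis .
  qed
  finally have main: "(\<Sum>n = 1..N. h n * u n) = (\<Sum>m = 1..V. \<Sum>k = 1..N div m. t m k) +
    ((\<Sum>k = 1..V. \<Sum>m\<in>{V<..N div k}. t m k) + (\<Sum>m\<in>{V<..N}. \<Sum>k\<in>{V<..N div m}. t m k))" .
  have "(\<Sum>n = 1..N. on_primes f n * u n) = (\<Sum>n = 1..N. h n * u n - (if prime n then 0 else h n) * u n)"
  proof (intro sum.cong refl)
    fix n assume "n \<in> {1..N}"
    show "on_primes f n * u n = h n * u n - (if prime n then 0 else h n) * u n"
    proof (cases "prime n")
      case True
      hence "ln (real n) \<noteq> 0" using prime_gt_1_nat[OF True] by simp
      hence "h n = f n" unfolding h_def Lambda_of_prime[where f = f and p = n, OF f(1) True] by simp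
      thus ?thesis using True by (simp add: on_primes_def)
    qed (simp add: on_primes_def)
  qed
  hence "(\<Sum>n = 1..N. on_primes f n * u n) = (\<Sum>n = 1..N. h n * u n) - (\<Sum>n = 1..N. (if prime n then 0 else h n) * u n)"
    by (simp only: sum_subtractf)
  moreover have "(\<Sum>m = 1..V. \<Sum>k = 1..N div m. t m k) = (\<Sum>m = 1..V. g m * (\<Sum>k\<in>{0<..N div m}. of_real (log_weight m k) * f k * u (m * k)))"
    unfolding sum_distrib_left t_def by (intro sum.cong) (auto simp: mult_ac)
  moreover have "(\<Sum>k = 1..V. \<Sum>m\<in>{V<..N div k}. t m k) = (\<Sum>k = 1..V. f k * (\<Sum>m\<in>{V<..N div k}. of_real (log_weight m k) * g m * u (k * m)))"
    unfolding sum_distrib_left t_def by (intro sum.cong) (auto simp: mult_ac)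
  ultimately show ?thesis using main unfolding h_def t_def by simp
qed

lemma norm_prime_power_part_le:
  assumes "f \<in> class_C" "n \<ge> 1"
  shows "norm (if prime n then 0 else Lambda_of f n / of_real (ln (real n))) \<le> (if primepow n \<and> \<not> prime n then 1 else 0)"
proof (cases "primepow n \<and> \<not> prime n")
  case True
  have "norm (Lambda_of f n) \<le> mangoldt n" using assms by (intro class_C_norm_Lambda_of_le) auto
  also have "mangoldt n \<le> ln (real n)" using assms by (intro mangoldt_le) auto
  finally have "norm (Lambda_of f n) \<le> ln (real n)" .
  moreover have "ln (real n) \<ge> 0" using assms by simp
  ultimately show ?thesis using True by (auto simp: norm_divide divide_le_eq_1)
next
  case False
  hence "Lambda_of f n = 0" if "\<not> prime n"
    using class_C_norm_Lambda_of_le[OF assms(1), of n] assms(2) that by (simp add: mangoldt_def)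
  thus ?thesis using False by auto
qed

text \<open>The coefficients are at most 1 in modulus and live on few integers, so the kernel may be
  bounded trivially for each modulus. The resulting sqrt N times M is acceptable because M stays
  below sqrt x by a power of the logarithm.\<close>

lemma prime_power_part_bound:
  assumes f: "f \<in> class_C" and \<Xi>: "finite \<Xi>" and N: "N \<ge> 1" and M: "M > 0"
  shows "sum_max M (\<lambda>q a. norm (\<Sum>n = 1..N. (if prime n then 0 else Lambda_of f n / of_real (ln (real n))) * kappa \<Xi> q a n))
    \<le> sqrt (real N) * (2 * ln (real N)) * (real M + real (card \<Xi>) * (4 * (1 + ln (real M))))"
proof -
  define P where "P = sqrt (real N) * (2 * ln (real N))"
  have P: "P \<ge> 0" unfolding P_def using N by (intro mult_nonneg_nonneg) auto
  have "sum_max M (\<lambda>q a. norm (\<Sum>n = 1..N. (if prime n then 0 else Lambda_of f n / of_real (ln (real n))) * kappa \<Xi> q a n))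
    \<le> (\<Sum>q = 1..M. P * (1 + real (card \<Xi>) * (1 / real (totient q))))"
  proof (rule sum_max_leI)
    fix q a
    have "norm (\<Sum>n = 1..N. (if prime n then 0 else Lambda_of f n / of_real (ln (real n))) * kappa \<Xi> q a n)
      \<le> (\<Sum>n = 1..N. (if primepow n \<and> \<not> prime n then 1 else 0) * (1 + real (card \<Xi>) * (1 / real (totient q))))"
    proof (rule sum_norm_le)
      fix n assume n: "n \<in> {1..N}"
      have "norm (kappa \<Xi> q a n) \<le> 1 + real (card \<Xi>) * (1 / real (totient q))"
        using norm_kappa_le[OF \<Xi>, of q a n] by (auto split: if_splits)
      thus "norm ((if prime n then 0 else Lambda_of f n / of_real (ln (real n))) * kappa \<Xi> q a n)
        \<le> (if primepow n \<and> \<not> prime n then 1 else 0) * (1 + real (card \<Xi>) * (1 / real (totient q)))"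
        unfolding norm_mult using norm_prime_power_part_le[OF f, of n] n by (intro mult_mono) auto
    qed
    also have "\<dots> = real (card {n \<in> {1..N}. primepow n \<and> \<not> prime n}) * (1 + real (card \<Xi>) * (1 / real (totient q)))"
      by (simp add: sum.If_cases Int_def flip: sum_distrib_right)
    also have "\<dots> \<le> P * (1 + real (card \<Xi>) * (1 / real (totient q)))"
      unfolding P_def using card_proper_prime_powers_le[OF N] by (intro mult_right_mono add_nonneg_nonneg) auto
    finally show "norm (\<Sum>n = 1..N. (if prime n then 0 else Lambda_of f n / of_real (ln (real n))) * kappa \<Xi> q a n)
      \<le> P * (1 + real (card \<Xi>) * (1 / real (totient q)))" .
  qed
  also have "\<dots> = P * (real M + real (card \<Xi>) * (\<Sum>q = 1..M. 1 / real (totient q)))"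
    by (simp add: sum_distrib_left sum.distrib distrib_left)
  also have "\<dots> \<le> P * (real M + real (card \<Xi>) * (4 * (1 + ln (real M))))"
    using P M by (intro mult_left_mono add_left_mono sum_inverse_totient_le) auto
  finally show ?thesis by (simp add: P_def)
qed

text \<open>After the expansion of the kernel, |\<eta>(a)| = 1 makes the bound uniform in
  \<open>a\<close>. The exclusion of \<Xi>_q is retained only for small conductors; for the others
  the sum is enlarged to all characters, as the large sieve treats them alike.\<close>

lemma type_II_bound:
  assumes "M > 0"
  shows "sum_max M (\<lambda>q a. norm (\<Sum>m\<in>{V<..N}. \<Sum>k\<in>{V<..N div m}. g m * f k * of_real (log_weight m k) * kappa \<Xi> q a (m * k)))
    \<le> (\<Sum>q = 1..M. 1 / real (totient q) * (\<Sum>\<eta> | \<eta> \<in> chars q - induced_chars \<Xi> q \<and> conductor q \<eta> \<le> R. norm (bilinear_sum g f V N \<eta>)))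
    + (\<Sum>q = 1..M. 1 / real (totient q) * (\<Sum>\<eta> | \<eta> \<in> chars q \<and> conductor q \<eta> > R. norm (bilinear_sum g f V N \<eta>)))"
  unfolding sum.distrib[symmetric] distrib_left[symmetric]
proof (rule sum_max_leI)
  fix q a assume q: "q \<in> {1..M}" and a: "a \<in> totatives q"
  let ?X = "chars q - induced_chars \<Xi> q"
  let ?S = "{\<eta>. \<eta> \<in> ?X \<and> conductor q \<eta> \<le> R}" and ?L = "{\<eta>. \<eta> \<in> chars q \<and> conductor q \<eta> > R}"
  have cop: "coprime a q" and q0: "q > 0" using a q by (auto simp: totatives_def)
  have fin: "finite ?X" "finite ?S" "finite ?L" using finite_chars[of q] by auto
  have "(\<Sum>m\<in>{V<..N}. \<Sum>k\<in>{V<..N div m}. g m * f k * of_real (log_weight m k) * kappa \<Xi> q a (m * k))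
      = (\<Sum>m\<in>{V<..N}. \<Sum>k\<in>{V<..N div m}. \<Sum>\<eta>\<in>?X. 1 / of_nat (totient q) * \<eta> a * (g m * f k * of_real (log_weight m k) * cnj (\<eta> (m * k))))"
    unfolding kappa_eq_char_sum[OF q0 cop] sum_distrib_left by (intro sum.cong refl) (simp add: mult_ac)
  also have "\<dots> = (\<Sum>m\<in>{V<..N}. \<Sum>\<eta>\<in>?X. \<Sum>k\<in>{V<..N div m}. 1 / of_nat (totient q) * \<eta> a * (g m * f k * of_real (log_weight m k) * cnj (\<eta> (m * k))))"
    by (intro sum.cong refl sum.swap)
  also have "\<dots> = (\<Sum>\<eta>\<in>?X. \<Sum>m\<in>{V<..N}. \<Sum>k\<in>{V<..N div m}. 1 / of_nat (totient q) * \<eta> a * (g m * f k * of_real (log_weight m k) * cnj (\<eta> (m * k))))"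
    by (rule sum.swap)
  also have "\<dots> = (\<Sum>\<eta>\<in>?X. 1 / of_nat (totient q) * \<eta> a * bilinear_sum g f V N \<eta>)"
    unfolding bilinear_sum_def sum_distrib_left ..
  finally have eq: "(\<Sum>m\<in>{V<..N}. \<Sum>k\<in>{V<..N div m}. g m * f k * of_real (log_weight m k) * kappa \<Xi> q a (m * k))
    = (\<Sum>\<eta>\<in>?X. 1 / of_nat (totient q) * \<eta> a * bilinear_sum g f V N \<eta>)" .
  have "norm (\<Sum>\<eta>\<in>?X. 1 / of_nat (totient q) * \<eta> a * bilinear_sum g f V N \<eta>) \<le> (\<Sum>\<eta>\<in>?X. 1 / real (totient q) * norm (bilinear_sum g f V N \<eta>))"
  proof (rule sum_norm_le)
    fix \<eta> assume "\<eta> \<in> ?X"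
    hence "norm (\<eta> a) = 1" using cop by (intro norm_dirichlet_char[of q]) (auto simp: chars_def)
    thus "norm (1 / of_nat (totient q) * \<eta> a * bilinear_sum g f V N \<eta>) \<le> 1 / real (totient q) * norm (bilinear_sum g f V N \<eta>)"
      by (simp add: norm_mult norm_divide)
  qed
  also have "\<dots> = 1 / real (totient q) * (\<Sum>\<eta>\<in>?X. norm (bilinear_sum g f V N \<eta>))" by (rule sum_distrib_left[symmetric])
  also have "\<dots> \<le> 1 / real (totient q) * (\<Sum>\<eta>\<in>?S \<union> ?L. norm (bilinear_sum g f V N \<eta>))"
    using fin by (intro mult_left_mono sum_mono2) auto
  also have "(\<Sum>\<eta>\<in>?S \<union> ?L. norm (bilinear_sum g f V N \<eta>)) = (\<Sum>\<eta>\<in>?S. norm (bilinear_sum g f V N \<eta>)) + (\<Sum>\<eta>\<in>?L. norm (bilinear_sum g f V N \<eta>))"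
    using fin by (intro sum.union_disjoint) auto
  finally show "norm (\<Sum>m\<in>{V<..N}. \<Sum>k\<in>{V<..N div m}. g m * f k * of_real (log_weight m k) * kappa \<Xi> q a (m * k))
    \<le> 1 / real (totient q) * ((\<Sum>\<eta>\<in>?S. norm (bilinear_sum g f V N \<eta>)) + (\<Sum>\<eta>\<in>?L. norm (bilinear_sum g f V N \<eta>)))"
    unfolding eq .
qed

text \<open>The bound E/m + \<tau> unites the two ranges of \<open>k\<close>: E/m is of the strength
  of (ii) at length x/m, and \<tau> is the trivial bound on the initial segment. The factor 4 is the
  2 of partial summation for each of the two sums with a short variable.\<close>

lemma sum_max_prime_decomposition:
  assumes f: "f \<in> class_C" and g: "g \<in> class_C" and fg: "dirichlet_inverses f g" and \<Xi>: "finite \<Xi>"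
    and x: "N = nat \<lfloor>x\<rfloor>" "N \<ge> 1" and V: "0 < V" "V \<le> N" and M: "M > 0" and E: "E \<ge> 0" "\<tau> \<ge> 0"
    and typeI: "\<And>h m k. h \<in> {f, g} \<Longrightarrow> m \<in> {1..V} \<Longrightarrow> k \<le> N div m \<Longrightarrow>
      sum_max M (\<lambda>q a. norm (Delta \<Xi> h (real k) q a)) \<le> E / real m + \<tau>"
  shows "sum_max M (\<lambda>q a. norm (Delta \<Xi> (on_primes f) x q a))
    \<le> 4 * (E * (1 + ln (real V)) + real V * \<tau>)
    + sum_max M (\<lambda>q a. norm (\<Sum>m\<in>{V<..N}. \<Sum>k\<in>{V<..N div m}. g m * f k * of_real (log_weight m k) * kappa \<Xi> q a (m * k)))
    + sqrt (real N) * (2 * ln (real N)) * (real M + real (card \<Xi>) * (4 * (1 + ln (real M))))"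
proof -
  define T1 where "T1 = (\<lambda>q a. \<Sum>m = 1..V. g m * (\<Sum>k\<in>{0<..N div m}. of_real (log_weight m k) * f k * kappa \<Xi> q a (m * k)))"
  define T2 where "T2 = (\<lambda>q a. \<Sum>k = 1..V. f k * (\<Sum>m\<in>{V<..N div k}. of_real (log_weight m k) * g m * kappa \<Xi> q a (k * m)))"
  define T3 where "T3 = (\<lambda>q a. \<Sum>m\<in>{V<..N}. \<Sum>k\<in>{V<..N div m}. g m * f k * of_real (log_weight m k) * kappa \<Xi> q a (m * k))"
  define T4 where "T4 = (\<lambda>q a. \<Sum>n = 1..N. (if prime n then 0 else Lambda_of f n / of_real (ln (real n))) * kappa \<Xi> q a n)"
  have VB: "(\<Sum>m = 1..V. 2 * (E / real m + \<tau>)) \<le> 2 * (E * (1 + ln (real V)) + real V * \<tau>)"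
  proof -
    have "(\<Sum>m = 1..V. 2 * (E / real m + \<tau>)) = 2 * (E * (\<Sum>m = 1..V. 1 / real m) + real V * \<tau>)"
      by (simp add: sum_distrib_left sum.distrib)
    also have "\<dots> \<le> 2 * (E * (1 + ln (real V)) + real V * \<tau>)"
      using E V by (intro mult_left_mono add_right_mono harmonic_sum_le) auto
    finally show ?thesis .
  qed
  have I1: "sum_max M (\<lambda>q a. norm (T1 q a)) \<le> 2 * (E * (1 + ln (real V)) + real V * \<tau>)"
  proof -
    have "sum_max M (\<lambda>q a. norm (T1 q a)) \<le> sum_max M (\<lambda>q a. \<Sum>m = 1..V. norm (\<Sum>k\<in>{0<..N div m}. of_real (log_weight m k) * f k * kappa \<Xi> q a (m * k)))"
      unfolding T1_def
    proof (intro sum_max_mono sum_norm_le)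
      fix q a m assume "m \<in> {1..V}"
      thus "norm (g m * (\<Sum>k\<in>{0<..N div m}. of_real (log_weight m k) * f k * kappa \<Xi> q a (m * k)))
        \<le> norm (\<Sum>k\<in>{0<..N div m}. of_real (log_weight m k) * f k * kappa \<Xi> q a (m * k))"
        unfolding norm_mult using class_C_norm_le_1[OF g, of m] by (intro mult_left_le_one_le) auto
    qed
    also have "\<dots> \<le> (\<Sum>m = 1..V. sum_max M (\<lambda>q a. norm (\<Sum>k\<in>{0<..N div m}. of_real (log_weight m k) * f k * kappa \<Xi> q a (m * k))))"
      by (rule sum_max_sum)
    also have "\<dots> \<le> (\<Sum>m = 1..V. 2 * (E / real m + \<tau>))"
    proof (intro sum_mono type_I_bound)
      fix m assume m: "m \<in> {1..V}"
      show "mono_on {0<..N div m} (log_weight m) \<or> antimono_on {0<..N div m} (log_weight m)"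
        using m by (intro disjI1 log_weight_mono) auto
      show "0 \<le> log_weight m n \<and> log_weight m n \<le> 1" if "0 < n" for n using m that by (intro log_weight_bounds) auto
      show "sum_max M (\<lambda>q r. norm (Delta \<Xi> f (real k) q r)) \<le> E / real m + \<tau>" if "k \<le> N div m" for k
        using m that by (intro typeI) auto
    qed (use E in auto)
    finally show ?thesis using VB by simp
  qed
  have I2: "sum_max M (\<lambda>q a. norm (T2 q a)) \<le> 2 * (E * (1 + ln (real V)) + real V * \<tau>)"
  proof -
    have "sum_max M (\<lambda>q a. norm (T2 q a)) \<le> sum_max M (\<lambda>q a. \<Sum>k = 1..V. norm (\<Sum>m\<in>{V<..N div k}. of_real (log_weight m k) * g m * kappa \<Xi> q a (k * m)))"
      unfolding T2_def
    proof (intro sum_max_mono sum_norm_le)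
      fix q a k assume "k \<in> {1..V}"
      thus "norm (f k * (\<Sum>m\<in>{V<..N div k}. of_real (log_weight m k) * g m * kappa \<Xi> q a (k * m)))
        \<le> norm (\<Sum>m\<in>{V<..N div k}. of_real (log_weight m k) * g m * kappa \<Xi> q a (k * m))"
        unfolding norm_mult using class_C_norm_le_1[OF f, of k] by (intro mult_left_le_one_le) auto
    qed
    also have "\<dots> \<le> (\<Sum>k = 1..V. sum_max M (\<lambda>q a. norm (\<Sum>m\<in>{V<..N div k}. of_real (log_weight m k) * g m * kappa \<Xi> q a (k * m))))"
      by (rule sum_max_sum)
    also have "\<dots> \<le> (\<Sum>k = 1..V. 2 * (E / real k + \<tau>))"
    proof (intro sum_mono type_I_bound)
      fix k assume k: "k \<in> {1..V}"
      show "mono_on {V<..N div k} (\<lambda>m. log_weight m k) \<or> antimono_on {V<..N div k} (\<lambda>m. log_weight m k)"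
        using k by (intro disjI2 log_weight_antimono) auto
      show "0 \<le> log_weight n k \<and> log_weight n k \<le> 1" if "V < n" for n using k that by (intro log_weight_bounds) auto
      show "sum_max M (\<lambda>q r. norm (Delta \<Xi> g (real m) q r)) \<le> E / real k + \<tau>" if "m \<le> N div k" for m
        using k that by (intro typeI) auto
    qed (use E in auto)
    finally show ?thesis using VB by simp
  qed
  have "sum_max M (\<lambda>q a. norm (Delta \<Xi> (on_primes f) x q a)) \<le> sum_max M (\<lambda>q a. norm (T1 q a) + (norm (T2 q a) + (norm (T3 q a) + norm (T4 q a))))"
  proof (rule sum_max_mono)
    fix q a
    have "Delta \<Xi> (on_primes f) x q a = T1 q a + T2 q a + T3 q a - T4 q a"
      unfolding Delta_eq_kappa_sum x(1)[symmetric] T1_def T2_def T3_def T4_def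
      by (rule on_primes_decomposition[OF class_C_one[OF f] fg V(2)])
    also have "norm \<dots> \<le> norm (T1 q a) + norm (T2 q a) + norm (T3 q a) + norm (T4 q a)"
      by (intro order.trans[OF norm_triangle_ineq4] add_right_mono order.trans[OF norm_triangle_ineq] norm_triangle_ineq)
    finally show "norm (Delta \<Xi> (on_primes f) x q a) \<le> norm (T1 q a) + (norm (T2 q a) + (norm (T3 q a) + norm (T4 q a)))" by simp
  qed
  also have "\<dots> \<le> sum_max M (\<lambda>q a. norm (T1 q a)) + (sum_max M (\<lambda>q a. norm (T2 q a)) + (sum_max M (\<lambda>q a. norm (T3 q a)) + sum_max M (\<lambda>q a. norm (T4 q a))))"
    by (intro order.trans[OF sum_max_add] add_left_mono sum_max_add)
  finally show ?thesis
    using I1 I2 prime_power_part_bound[OF f \<Xi> x(2) M] unfolding T3_def T4_def by simp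
qed

section \<open>Bookkeeping of powers of the logarithm\<close>

text \<open>The accounting rule for all error terms: a loss y^a against a saving y^b leaves a saving
  y^c as soon as a + c \<le> b.\<close>

lemma powr_absorb:
  fixes x y a b c :: real
  assumes "y \<ge> 1" "x \<ge> 0" "a + c \<le> b"
  shows "y powr a * (x / y powr b) \<le> x / y powr c"
proof -
  have "y powr a * (x / y powr b) = x * y powr (a - b)" using assms by (simp add: powr_diff)
  also have "\<dots> \<le> x * y powr (- c)" using assms by (intro mult_left_mono powr_mono) auto
  also have "\<dots> = x / y powr c" using assms by (simp add: powr_minus_divide)
  finally show ?thesis .
qed

lemma powr_nat_floor_bounds:
  fixes y a :: real
  assumes "y \<ge> 1" "a \<ge> 0" "n = nat \<lfloor>y powr a\<rfloor>"
  shows "real n \<le> y powr a" "y powr a \<le> 2 * real n" "n \<ge> 1"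
proof -
  have 1: "y powr a \<ge> 1" using assms by (intro ge_one_powr_ge_zero)
  show "real n \<le> y powr a" using 1 assms(3) by simp
  have "y powr a < real n + 1" using 1 assms(3) by linarith
  moreover show "n \<ge> 1" using 1 assms(3) by (simp add: le_nat_iff)
  ultimately show "y powr a \<le> 2 * real n" by linarith
qed

text \<open>The factor 1 + ln V, of size log log x, is absorbed by y^\<epsilon>. The trivial range
  balances exactly, (5A+9) + (C+1) + A = 6A+C+10. In the constant, 65 is 1 for the product of V and
  M plus 4 times 16 for the trivial range.\<close>

lemma type_I_asymptotics:
  fixes x y A C \<epsilon> k2 :: real
  assumes y: "y = ln x" "y \<ge> 1" and x: "x \<ge> 1" and A: "A \<ge> 0" and k2: "k2 \<ge> 0"
    and V: "real V \<le> y powr (5 * A + 9)" "V \<ge> 1" and M: "real M \<le> sqrt x" "M \<ge> 1" and cd: "cd \<ge> 0" "cd \<le> y powr C" "C \<ge> 0"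
    and ev: "1 + (5 * A + 9) * ln y \<le> y powr \<epsilon>" "4 * y powr (6 * A + 9) \<le> sqrt x"
  shows "4 * ((k2 * (x / y powr (A + \<epsilon>))) * (1 + ln (real V)) +
      real V * (real M + x / y powr (6 * A + C + 10) * (4 * (cd + 1) * (1 + ln (real M)))))
    \<le> (4 * k2 + 65) * (x / y powr A)"
proof -
  have "ln (real V) \<le> ln (y powr (5 * A + 9))" using V y(2) by (subst ln_le_cancel_iff) auto
  hence "1 + ln (real V) \<le> y powr \<epsilon>" using ev(1) y(2) by (simp add: ln_powr)
  hence "(k2 * (x / y powr (A + \<epsilon>))) * (1 + ln (real V)) \<le> (k2 * (x / y powr (A + \<epsilon>))) * y powr \<epsilon>"
    using k2 x by (intro mult_left_mono) auto
  also have "\<dots> = k2 * (y powr \<epsilon> * (x / y powr (A + \<epsilon>)))" by (simp add: mult_ac)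
  also have "\<dots> \<le> k2 * (x / y powr A)" using k2 x y(2) by (intro mult_left_mono powr_absorb) auto
  finally have 1: "(k2 * (x / y powr (A + \<epsilon>))) * (1 + ln (real V)) \<le> k2 * (x / y powr A)" .
  have "4 * (real V * real M) \<le> 4 * (y powr (5 * A + 9) * sqrt x)" using V M by (intro mult_left_mono mult_mono) auto
  also have "y powr (5 * A + 9) = y powr (6 * A + 9) / y powr A" using y(2) by (simp flip: powr_diff)
  also have "4 * (y powr (6 * A + 9) / y powr A * sqrt x) = (4 * y powr (6 * A + 9)) * sqrt x / y powr A" by simp
  also have "\<dots> \<le> sqrt x * sqrt x / y powr A" using ev(2) x by (intro divide_right_mono mult_right_mono) auto
  finally have 2: "4 * (real V * real M) \<le> x / y powr A" using x by simp
  have lnM: "1 + ln (real M) \<le> 2 * y"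
  proof -
    have "sqrt x \<le> x" using x by (intro real_le_lsqrt) (auto simp: power2_eq_square)
    hence "real M \<le> x" using M by linarith
    hence "ln (real M) \<le> y" unfolding y(1) using M x by simp
    thus ?thesis using y(2) by simp
  qed
  have y1: "y powr C \<ge> 1" using y(2) cd by (intro ge_one_powr_ge_zero) auto
  have "4 * (cd + 1) * (1 + ln (real M)) \<le> (4 * (2 * y powr C)) * (2 * y)"
    using lnM cd y1 y(2) M by (intro mult_mono) auto
  also have "\<dots> = 16 * y powr (C + 1)" using y(2) by (simp add: powr_add)
  finally have cdM: "4 * (cd + 1) * (1 + ln (real M)) \<le> 16 * y powr (C + 1)" .
  have "x / y powr (6 * A + C + 10) * (4 * (cd + 1) * (1 + ln (real M))) \<le> x / y powr (6 * A + C + 10) * (16 * y powr (C + 1))"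
    by (rule mult_left_mono[OF cdM]) (use x in auto)
  hence "real V * (x / y powr (6 * A + C + 10) * (4 * (cd + 1) * (1 + ln (real M))))
      \<le> y powr (5 * A + 9) * (x / y powr (6 * A + C + 10) * (16 * y powr (C + 1)))"
    by (rule mult_mono[OF V(1)]) (use x cd M in auto)
  also have "\<dots> = 16 * (y powr (5 * A + 9 + (C + 1)) * (x / y powr (6 * A + C + 10)))"
    unfolding powr_add[of y "5 * A + 9" "C + 1"] by (simp only: mult_ac times_divide_eq_right times_divide_eq_left)
  also have "\<dots> \<le> 16 * (x / y powr A)" using x y(2) by (intro mult_left_mono powr_absorb) auto
  finally have 3: "real V * (x / y powr (6 * A + C + 10) * (4 * (cd + 1) * (1 + ln (real M)))) \<le> 16 * (x / y powr A)" .
  have dist: "4 * (p + v * (m + z)) = 4 * p + 4 * (v * m) + 4 * (v * z)" "(4 * k2 + 65) * p = 4 * (k2 * p) + 65 * p"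
    for p v m z :: real by (simp_all add: algebra_simps)
  show ?thesis unfolding dist using 1 2 3 by linarith
qed

text \<open>The root of x^0.4 / sqrt x is x^(-0.05); against the x^0.02 from the prime factors of
  the modulus it leaves x^(-0.03), which beats every power of y. In the other term the losses
  y^(2A+10), y^(A+4) and y make y^(3A+15).\<close>

lemma small_conductor_asymptotics:
  fixes x y A k1 K4 :: real
  assumes y: "y = ln x" "y \<ge> 1" and x: "x \<ge> 1" and A: "A \<ge> 0" and k1: "k1 \<ge> 0" and K4: "K4 \<ge> 0"
    and R: "real R \<le> y powr (A + 4)" and M: "real M \<le> x" "M \<ge> 1"
    and ev: "64 * y powr (3 * A + 10) \<le> x powr (3/100)"
  shows "4 * (1 + ln (real M)) * (real R)\<^sup>2 * (4 * x * (1 + ln x) *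
      (real R * (k1 / y powr (14 * A + 28)) * (1 + ln x) + sqrt (x powr 0.4 / sqrt x) * (K4 * x powr 0.02)))
    \<le> (128 * k1 + K4) * (x / y powr A)"
proof -
  have "ln (real M) \<le> y" unfolding y(1) using M x by simp
  hence lnM: "1 + ln (real M) \<le> 2 * y" using y(2) by simp
  have lnM0: "0 \<le> ln (real M)" using M by simp
  have lx: "1 + ln x \<le> 2 * y" using y by simp
  have R2: "(real R)\<^sup>2 \<le> y powr (2 * A + 8)"
  proof -
    have "(real R)\<^sup>2 \<le> (y powr (A + 4))\<^sup>2" using R by (intro power_mono) auto
    also have "\<dots> = y powr (2 * A + 8)" by (simp add: power2_eq_square flip: powr_add)
    finally show ?thesis .
  qed
  have sq: "sqrt (x powr 0.4 / sqrt x) * (K4 * x powr 0.02) = K4 * (1 / x powr (3/100))"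
  proof -
    have "sqrt (x powr 0.4 / sqrt x) = x powr (- 1 / 20)"
      using x by (simp add: powr_half_sqrt[symmetric] powr_powr flip: powr_diff)
    hence "sqrt (x powr 0.4 / sqrt x) * (K4 * x powr 0.02) = K4 * x powr (- (3/100))"
      by (simp flip: powr_add)
    thus ?thesis using x by (simp add: powr_minus_divide)
  qed
  define a where "a = y powr (A + 4) * (k1 / y powr (14 * A + 28)) * (2 * y)"
  define b where "b = K4 * (1 / x powr (3/100))"
  have a0: "a \<ge> 0" "b \<ge> 0" using k1 K4 y(2) by (auto simp: a_def b_def)
  have "4 * (1 + ln (real M)) * (real R)\<^sup>2 * (4 * x * (1 + ln x) *
      (real R * (k1 / y powr (14 * A + 28)) * (1 + ln x) + sqrt (x powr 0.4 / sqrt x) * (K4 * x powr 0.02)))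
    \<le> 4 * (2 * y) * y powr (2 * A + 8) * (4 * x * (2 * y) * (a + b))"
    unfolding sq a_def b_def using lnM lnM0 lx R R2 k1 K4 x y(2)
    by (intro mult_mono add_mono mult_nonneg_nonneg add_nonneg_nonneg order_refl) (auto simp: y(1)[symmetric])
  also have "\<dots> = 64 * x * y powr (2 * A + 10) * (a + b)"
  proof -
    have "y powr (2 * A + 10) = y powr (2 * A + 8) * y powr 2"
      by (simp only: powr_add[symmetric]) (simp add: algebra_simps)
    hence "y powr (2 * A + 10) = y powr (2 * A + 8) * (y * y)" using y(2) by (simp add: power2_eq_square)
    thus ?thesis by simp
  qed
  also have "\<dots> = 64 * x * y powr (2 * A + 10) * a + x * (64 * y powr (2 * A + 10) * b)" by (simp add: algebra_simps)
  also have "64 * x * y powr (2 * A + 10) * a \<le> 128 * k1 * (x / y powr A)"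
  proof -
    have "y powr (3 * A + 15) = y powr (2 * A + 10) * y powr (A + 4) * y powr 1"
      by (simp only: powr_add[symmetric]) (simp add: algebra_simps)
    hence "64 * x * y powr (2 * A + 10) * a = 128 * k1 * (y powr (3 * A + 15) * (x / y powr (14 * A + 28)))"
      using y(2) by (simp add: a_def)
    also have "\<dots> \<le> 128 * k1 * (x / y powr A)" using k1 x y(2) A by (intro mult_left_mono powr_absorb) auto
    finally show ?thesis .
  qed
  also have "x * (64 * y powr (2 * A + 10) * b) \<le> x * (K4 * (1 / y powr A))"
  proof (rule mult_left_mono)
    have "y powr (3 * A + 10) = y powr (2 * A + 10) * y powr A"
      by (simp only: powr_add[symmetric]) (simp add: algebra_simps)
    hence "64 * y powr (2 * A + 10) = 64 * y powr (3 * A + 10) / y powr A" using y(2) by simp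
    also have "\<dots> \<le> x powr (3/100) / y powr A" using ev by (intro divide_right_mono) auto
    finally have "64 * y powr (2 * A + 10) * b \<le> x powr (3/100) / y powr A * b" using a0 by (intro mult_right_mono) auto
    also have "\<dots> = K4 * (1 / y powr A)" using x by (simp add: b_def)
    finally show "64 * y powr (2 * A + 10) * b \<le> K4 * (1 / y powr A)" .
  qed (use x in auto)
  finally show ?thesis by (simp add: algebra_simps)
qed

text \<open>The constant is 2016 times 176, with 2016 = 3 * 14 * 3 * 16 from the outer factors and
  176 = 64 + 96 + 16 from the terms with R, V and M. The first two of these lose y^4, the last only
  y^3.\<close>

lemma large_conductor_asymptotics:
  fixes x y A C :: real
  assumes y: "y = ln x" "y \<ge> 1" and x: "x \<ge> 1" and A: "A \<ge> 0" and C: "C \<ge> 0"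
    and R: "y powr (A + 4) \<le> 2 * real R" and V: "y powr (5 * A + 9) \<le> 2 * real V"
    and M: "real M \<le> x powr (1/2) / y powr (5 * A / 2 + C / 4 + 7 / 2)"
  shows "(1 + 2 * ln x) * ((10 + 4 * ln x) * ((1 + 2 * ln x) * (16 * sqrt x *
        ((4 * sqrt x / real R + 8 * sqrt (x / real V)) * (4 * (1 + ln x)) + 16 * real M))))
    \<le> 354816 * (x / y powr A)"
proof -
  define s where "s = sqrt x"
  have s: "s \<ge> 0" "s * s = x" using x by (auto simp: s_def)
  have l: "1 + 2 * ln x \<le> 3 * y" "10 + 4 * ln x \<le> 14 * y" "4 * (1 + ln x) \<le> 8 * y" using y by simp_all
  have pw: "y powr (A + 4) > 0" "y powr (5 * A + 9) > 0" using y(2) by simp_all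
  have Rb: "4 * sqrt x / real R \<le> 8 * (s / y powr (A + 4))"
  proof -
    have "0 < real R * (y powr (A + 4) / 2)" using R pw by (intro mult_pos_pos) linarith+
    hence "4 * s / real R \<le> 4 * s / (y powr (A + 4) / 2)" using R s by (intro divide_left_mono) auto
    thus ?thesis by (simp add: s_def)
  qed
  have Vb: "8 * sqrt (x / real V) \<le> 12 * (s / y powr (5 * A / 2 + 9 / 2))"
  proof -
    have "0 < real V * (y powr (5 * A + 9) / 2)" using V pw by (intro mult_pos_pos) linarith+
    hence "x / real V \<le> x / (y powr (5 * A + 9) / 2)" using V x by (intro divide_left_mono) auto
    also have "\<dots> = 2 * (s / y powr (5 * A / 2 + 9 / 2))\<^sup>2"
      using s by (simp add: power_divide power2_eq_square flip: powr_add)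
    \<comment> \<open>Here sqrt 2 is rounded up to 3/2, which gives the 12 = 8 * 3/2 of
      \<open>Vb\<close>.\<close>
    also have "\<dots> \<le> (3 / 2 * (s / y powr (5 * A / 2 + 9 / 2)))\<^sup>2"
      unfolding power_mult_distrib by (intro mult_right_mono) (auto simp: power2_eq_square)
    finally have "sqrt (x / real V) \<le> 3 / 2 * (s / y powr (5 * A / 2 + 9 / 2))"
      using s by (intro real_le_lsqrt) auto
    thus ?thesis by simp
  qed
  have Mb: "real M \<le> s / y powr (5 * A / 2 + C / 4 + 7 / 2)" using M x by (simp add: s_def powr_half_sqrt)
  define X where "X = (8 * (s / y powr (A + 4)) + 12 * (s / y powr (5 * A / 2 + 9 / 2))) * (8 * y) + 16 * (s / y powr (5 * A / 2 + C / 4 + 7 / 2))"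
  have X0: "X \<ge> 0" unfolding X_def using s y(2) by (intro add_nonneg_nonneg mult_nonneg_nonneg) auto
  have lx0: "ln x \<ge> 0" using x by simp
  have "(4 * sqrt x / real R + 8 * sqrt (x / real V)) * (4 * (1 + ln x)) + 16 * real M \<le> X"
  proof -
    have "(4 * sqrt x / real R + 8 * sqrt (x / real V)) * (4 * (1 + ln x))
        \<le> (8 * (s / y powr (A + 4)) + 12 * (s / y powr (5 * A / 2 + 9 / 2))) * (8 * y)"
      by (rule mult_mono[OF add_mono[OF Rb Vb] l(3)]) (use s y(2) lx0 in auto)
    thus ?thesis unfolding X_def using Mb by linarith
  qed
  from this have "(1 + 2 * ln x) * ((10 + 4 * ln x) * ((1 + 2 * ln x) * (16 * sqrt x *
        ((4 * sqrt x / real R + 8 * sqrt (x / real V)) * (4 * (1 + ln x)) + 16 * real M))))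
    \<le> (3 * y) * ((14 * y) * ((3 * y) * (16 * s * X)))"
  proof -
    let ?Y = "(4 * sqrt x / real R + 8 * sqrt (x / real V)) * (4 * (1 + ln x)) + 16 * real M"
    assume YX: "?Y \<le> X"
    have Y0: "?Y \<ge> 0" using lx0 x by (intro add_nonneg_nonneg mult_nonneg_nonneg) auto
    have "16 * sqrt x * ?Y \<le> 16 * s * X" unfolding s_def using YX x by (intro mult_left_mono) auto
    hence "(1 + 2 * ln x) * (16 * sqrt x * ?Y) \<le> (3 * y) * (16 * s * X)"
      using l(1) lx0 y(2) Y0 x by (intro mult_mono[OF l(1)]) auto
    hence "(10 + 4 * ln x) * ((1 + 2 * ln x) * (16 * sqrt x * ?Y)) \<le> (14 * y) * ((3 * y) * (16 * s * X))"
      using lx0 y(2) Y0 x by (intro mult_mono[OF l(2)]) auto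
    thus ?thesis using lx0 y(2) Y0 x by (intro mult_mono[OF l(1)]) auto
  qed
  also have "\<dots> = 2016 * (y powr 3 * (s * X))" using y(2) by (simp add: power3_eq_cube)
  also have "y powr 3 * (s * X) = 64 * (y powr 4 * (x / y powr (A + 4))) + 96 * (y powr 4 * (x / y powr (5 * A / 2 + 9 / 2)))
     + 16 * (y powr 3 * (x / y powr (5 * A / 2 + C / 4 + 7 / 2)))"
  proof -
    have "y powr 4 = y powr 3 * y" using powr_add[of y 3 1] y(2) by simp
    thus ?thesis unfolding X_def s(2)[symmetric] by (simp add: algebra_simps add_divide_distrib)
  qed
  also have "\<dots> \<le> 64 * (x / y powr A) + 96 * (x / y powr A) + 16 * (x / y powr A)"
  proof -
    have "y powr 4 * (x / y powr (A + 4)) \<le> x / y powr A"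
      by (rule powr_absorb[OF y(2)]) (use x in auto)
    moreover have "y powr 4 * (x / y powr (5 * A / 2 + 9 / 2)) \<le> x / y powr A"
      by (rule powr_absorb[OF y(2)]) (use x A in auto)
    moreover have "y powr 3 * (x / y powr (5 * A / 2 + C / 4 + 7 / 2)) \<le> x / y powr A"
      by (rule powr_absorb[OF y(2)]) (use x A C in auto)
    ultimately show ?thesis by linarith
  qed
  finally show ?thesis by simp
qed

lemma prime_power_asymptotics:
  fixes x y A C :: real
  assumes y: "y = ln x" "y \<ge> 1" and x: "x \<ge> 1" and A: "A \<ge> 0" and C: "C \<ge> 0"
    and N: "real N \<le> x" "N \<ge> 1" and cd: "cd \<ge> 0" "cd \<le> y powr C"
    and M: "real M \<le> x powr (1/2) / y powr (5 * A / 2 + C / 4 + 7 / 2)" "real M \<le> x" "M \<ge> 1"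
    and ev: "16 * y powr (A + C + 2) \<le> sqrt x"
  shows "sqrt (real N) * (2 * ln (real N)) * (real M + cd * (4 * (1 + ln (real M)))) \<le> 3 * (x / y powr A)"
proof -
  have "ln (real M) \<le> y" unfolding y(1) using M x by simp
  hence lnM: "4 * (1 + ln (real M)) \<le> 8 * y" using y(2) by simp
  have lnN: "ln (real N) \<le> y" unfolding y(1) using N x by simp
  have c: "cd * (4 * (1 + ln (real M))) \<le> y powr C * (8 * y)"
    by (rule mult_mono) (use cd lnM M in auto)
  have c0: "0 \<le> cd * (4 * (1 + ln (real M)))" using cd M by (intro mult_nonneg_nonneg) auto
  have "sqrt (real N) * (2 * ln (real N)) * (real M + cd * (4 * (1 + ln (real M))))
      \<le> sqrt x * (2 * y) * (sqrt x / y powr (5 * A / 2 + C / 4 + 7 / 2) + y powr C * (8 * y))"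
  proof (rule mult_mono)
    show "sqrt (real N) * (2 * ln (real N)) \<le> sqrt x * (2 * y)"
      using N lnN by (intro mult_mono) auto
    show "real M + cd * (4 * (1 + ln (real M))) \<le> sqrt x / y powr (5 * A / 2 + C / 4 + 7 / 2) + y powr C * (8 * y)"
      using M(1) c x by (intro add_mono) (auto simp: powr_half_sqrt)
  qed (use x y(2) c0 in auto)
  also have "\<dots> = 2 * (y powr 1 * (x / y powr (5 * A / 2 + C / 4 + 7 / 2))) + sqrt x * (16 * y powr (C + 2))"
    using x y(2) by (simp add: powr_add power2_eq_square algebra_simps)
  also have "\<dots> \<le> 2 * (x / y powr A) + sqrt x * (sqrt x / y powr A)"
  proof (rule add_mono)
    show "2 * (y powr 1 * (x / y powr (5 * A / 2 + C / 4 + 7 / 2))) \<le> 2 * (x / y powr A)"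
      using x y(2) A C by (intro mult_left_mono powr_absorb) (linarith | simp)+
    have "y powr (A + C + 2) = y powr (C + 2) * y powr A"
      by (simp only: powr_add[symmetric]) (simp add: algebra_simps)
    hence "16 * y powr (C + 2) = 16 * y powr (A + C + 2) / y powr A" using y(2) by simp
    also have "\<dots> \<le> sqrt x / y powr A" using ev by (intro divide_right_mono) auto
    finally have "16 * y powr (C + 2) \<le> sqrt x / y powr A" .
    thus "sqrt x * (16 * y powr (C + 2)) \<le> sqrt x * (sqrt x / y powr A)"
      by (rule mult_left_mono) (use x in simp)
  qed
  also have "\<dots> = 3 * (x / y powr A)" using x by simp
  finally show ?thesis .
qed

text \<open>The threshold and \<open>K4\<close> depend on A, C and \<epsilon> alone and are fixed
  before \<open>k1\<close> and \<open>k2\<close>, which enter the final constant linearly. This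
  order of quantifiers is the uniformity demanded by the theorem.\<close>

lemma prime_sum_bound:
  fixes A C \<epsilon> :: real
  assumes A: "A \<ge> 0" and C: "C \<ge> 0" and \<epsilon>: "\<epsilon> > 0"
  obtains x\<^sub>0 K4 where "K4 \<ge> 0"
    "\<And>f g x Q \<Xi> k1 k2. f \<in> class_C \<Longrightarrow> g \<in> class_C \<Longrightarrow> dirichlet_inverses f g \<Longrightarrow> x \<ge> x\<^sub>0 \<Longrightarrow> 2 \<le> Q \<Longrightarrow>
      Q \<le> x powr (1/2) / ln x powr (5 * A / 2 + C / 4 + 7 / 2) \<Longrightarrow> finite \<Xi> \<Longrightarrow> real (card \<Xi>) \<le> ln x powr C \<Longrightarrow>
      k1 \<ge> 0 \<Longrightarrow> k2 \<ge> 0 \<Longrightarrow>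
      (\<And>h X q a. h \<in> {f, g} \<Longrightarrow> x powr 0.4 \<le> X \<Longrightarrow> X \<le> x \<Longrightarrow> 1 \<le> q \<Longrightarrow> coprime a q \<Longrightarrow>
        norm (Delta \<Xi> h X q a) \<le> k1 * (X / ln x powr (14 * A + 28))) \<Longrightarrow>
      (\<And>h X. h \<in> {f, g} \<Longrightarrow> x / ln x powr (6 * A + C + 10) \<le> X \<Longrightarrow> X \<le> x \<Longrightarrow>
        sum_max_Delta \<Xi> h X Q \<le> k2 * (X / ln x powr (A + \<epsilon>))) \<Longrightarrow>
      sum_max_Delta \<Xi> (on_primes f) x Q \<le> (4 * k2 + 65 + (128 * k1 + K4) + 354816 + 3) * (x / ln x powr A)"
proof -
  \<comment> \<open>The exponent 0.04 becomes 0.02 in x because the moduli are at most sqrt x; it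
    has to stay below the 0.05 gained from x^0.4 / sqrt x.\<close>
  obtain K4 where K4: "K4 > 0" "\<And>s::nat. s > 0 \<Longrightarrow> 4 ^ card (prime_factors s) \<le> K4 * real s powr 0.04"
    using four_power_omega_le[of "0.04"] by auto
  have "eventually (\<lambda>x::real. 1 + (5 * A + 9) * ln (ln x) \<le> ln x powr \<epsilon>) at_top"
    using A \<epsilon> by real_asymp
  moreover have "eventually (\<lambda>x::real. 4 * ln x powr (6 * A + 9) \<le> sqrt x) at_top" by real_asymp
  moreover have "eventually (\<lambda>x::real. 64 * ln x powr (3 * A + 10) \<le> x powr (3/100)) at_top" by real_asymp
  moreover have "eventually (\<lambda>x::real. 16 * ln x powr (A + C + 2) \<le> sqrt x) at_top" by real_asymp
  moreover have "eventually (\<lambda>x::real. ln x powr (5 * A + 9) \<le> x - 1) at_top" by real_asymp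
  moreover have "eventually (\<lambda>x::real. x \<ge> exp 1) at_top" by (rule eventually_ge_at_top)
  ultimately have "eventually (\<lambda>x::real. 1 + (5 * A + 9) * ln (ln x) \<le> ln x powr \<epsilon> \<and>
      4 * ln x powr (6 * A + 9) \<le> sqrt x \<and> 64 * ln x powr (3 * A + 10) \<le> x powr (3/100) \<and>
      16 * ln x powr (A + C + 2) \<le> sqrt x \<and> ln x powr (5 * A + 9) \<le> x - 1 \<and> x \<ge> exp 1) at_top"
    by eventually_elim blast
  then obtain x0 where x0: "\<And>x. x \<ge> x0 \<Longrightarrow> 1 + (5 * A + 9) * ln (ln x) \<le> ln x powr \<epsilon> \<and>
      4 * ln x powr (6 * A + 9) \<le> sqrt x \<and> 64 * ln x powr (3 * A + 10) \<le> x powr (3/100) \<and>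
      16 * ln x powr (A + C + 2) \<le> sqrt x \<and> ln x powr (5 * A + 9) \<le> x - 1 \<and> x \<ge> exp 1"
    by (auto simp: eventually_at_top_linorder)
  show thesis
  proof (rule that[of K4 x0])
    show "K4 \<ge> 0" using K4 by simp
    fix f g :: "nat \<Rightarrow> complex" and x Q k1 k2 :: real and \<Xi> :: "(nat \<Rightarrow> complex) set"
    assume f: "f \<in> class_C" and g: "g \<in> class_C" and fg: "dirichlet_inverses f g" and x: "x \<ge> x0" and Q: "2 \<le> Q"
      "Q \<le> x powr (1/2) / ln x powr (5 * A / 2 + C / 4 + 7 / 2)" and \<Xi>: "finite \<Xi>" "real (card \<Xi>) \<le> ln x powr C"
      and k: "k1 \<ge> 0" "k2 \<ge> 0"
      and i: "\<And>h X q a. h \<in> {f, g} \<Longrightarrow> x powr 0.4 \<le> X \<Longrightarrow> X \<le> x \<Longrightarrow> 1 \<le> q \<Longrightarrow> coprime a q \<Longrightarrow>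
        norm (Delta \<Xi> h X q a) \<le> k1 * (X / ln x powr (14 * A + 28))"
      and ii: "\<And>h X. h \<in> {f, g} \<Longrightarrow> x / ln x powr (6 * A + C + 10) \<le> X \<Longrightarrow> X \<le> x \<Longrightarrow>
        sum_max_Delta \<Xi> h X Q \<le> k2 * (X / ln x powr (A + \<epsilon>))"
    define y where "y = ln x"
    note ev = x0[OF x, folded y_def]
    have x1: "x \<ge> 1" using ev exp_ge_add_one_self[of 1] by linarith
    have y: "y = ln x" "y \<ge> 1" using ev x1 unfolding y_def by (simp_all add: ln_ge_iff)
    define N where "N = nat \<lfloor>x\<rfloor>"
    define M where "M = nat \<lfloor>Q\<rfloor>"
    define V where "V = nat \<lfloor>y powr (5 * A + 9)\<rfloor>"
    define R where "R = nat \<lfloor>y powr (A + 4)\<rfloor>"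
    have V: "real V \<le> y powr (5 * A + 9)" "y powr (5 * A + 9) \<le> 2 * real V" "V \<ge> 1"
      using powr_nat_floor_bounds[OF y(2) _ V_def] A by auto
    have R: "real R \<le> y powr (A + 4)" "y powr (A + 4) \<le> 2 * real R" "R \<ge> 1"
      using powr_nat_floor_bounds[OF y(2) _ R_def] A by auto
    have N: "real N \<le> x" "x < real N + 1" "N \<ge> 1" unfolding N_def using x1 by (simp_all add: le_nat_iff)
    have VN: "V \<le> N" using V(1) ev N(2) by linarith
    have MQ: "real M \<le> Q" "M \<ge> 1" unfolding M_def using Q(1) by (simp_all add: le_nat_iff)
    hence M1: "real M \<le> x powr (1/2) / y powr (5 * A / 2 + C / 4 + 7 / 2)" using Q(2) unfolding y_def by linarith
    have "1 \<le> y powr (5 * A / 2 + C / 4 + 7 / 2)" using y(2) A C by (intro ge_one_powr_ge_zero) auto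
    hence "x powr (1/2) / y powr (5 * A / 2 + C / 4 + 7 / 2) \<le> x powr (1/2) / 1" by (intro divide_left_mono) auto
    hence M2: "real M \<le> sqrt x" using M1 x1 by (simp add: powr_half_sqrt)
    have "sqrt x \<le> x" using x1 by (intro real_le_lsqrt) (auto simp: power2_eq_square)
    hence M3: "real M \<le> x" using M2 by linarith
    define cd where "cd = real (card \<Xi>)"
    have cd: "cd \<ge> 0" "cd \<le> y powr C" using \<Xi>(2) by (simp_all add: cd_def y_def)
    define E where "E = k2 * (x / y powr (A + \<epsilon>))"
    define \<tau> where "\<tau> = real M + x / y powr (6 * A + C + 10) * (4 * (cd + 1) * (1 + ln (real M)))"
    have E0: "E \<ge> 0" unfolding E_def using k x1 by simp
    have lnM0: "ln (real M) \<ge> 0" using MQ(2) by simp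
    have \<tau>0: "\<tau> \<ge> 0" unfolding \<tau>_def using x1 cd lnM0 by (intro add_nonneg_nonneg mult_nonneg_nonneg) auto
    have "sum_max_Delta \<Xi> (on_primes f) x Q = sum_max M (\<lambda>q a. norm (Delta \<Xi> (on_primes f) x q a))"
      unfolding sum_max_Delta_eq M_def ..
    also have "\<dots> \<le> 4 * (E * (1 + ln (real V)) + real V * \<tau>)
      + sum_max M (\<lambda>q a. norm (\<Sum>m\<in>{V<..N}. \<Sum>k\<in>{V<..N div m}. g m * f k * of_real (log_weight m k) * kappa \<Xi> q a (m * k)))
      + sqrt (real N) * (2 * ln (real N)) * (real M + real (card \<Xi>) * (4 * (1 + ln (real M))))"
    proof (rule sum_max_prime_decomposition[OF f g fg \<Xi>(1) N_def N(3) _ VN _ E0 \<tau>0])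
      fix h m k assume h: "h \<in> {f, g}" and m: "m \<in> {1..V}" and kN: "k \<le> N div m"
      have hC: "h \<in> class_C" using h f g by auto
      have Em: "0 \<le> E / real m" using E0 by simp
      have "real k \<le> real (N div m)" using kN by simp
      also have "\<dots> \<le> real N / real m" by (rule of_nat_div_le_of_nat)
      also have "\<dots> \<le> x / real m" using N(1) by (intro divide_right_mono) auto
      finally have kx: "real k \<le> x / real m" .
      also have "\<dots> \<le> x" using m x1 by (simp add: field_simps)
      finally have kx': "real k \<le> x" .
      show "sum_max M (\<lambda>q a. norm (Delta \<Xi> h (real k) q a)) \<le> E / real m + \<tau>"
      \<comment> \<open>Hypothesis (ii) is available only from this length on; shorter segments are
        bounded trivially and charged to \<tau>.\<close>
      proof (cases "x / y powr (6 * A + C + 10) \<le> real k")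
        case True
        have "sum_max_Delta \<Xi> h (real k) Q \<le> k2 * (real k / y powr (A + \<epsilon>))"
          using ii[OF h, of "real k"] True kx' by (simp add: y_def)
        also have "\<dots> \<le> k2 * ((x / real m) / y powr (A + \<epsilon>))" using kx k by (intro mult_left_mono divide_right_mono) auto
        also have "\<dots> = E / real m" by (simp add: E_def)
        finally show ?thesis using \<tau>0 by (simp add: sum_max_Delta_eq M_def)
      next
        case False
        have "sum_max M (\<lambda>q a. norm (Delta \<Xi> h (real k) q a)) \<le> real M + real k * (4 * (cd + 1) * (1 + ln (real M)))"
          unfolding cd_def using MQ(2) class_C_norm_le_1[OF hC] by (intro sum_max_Delta_trivial \<Xi>) auto
        also have "\<dots> \<le> \<tau>" unfolding \<tau>_def using False cd lnM0 by (intro add_left_mono mult_right_mono) auto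
        finally show ?thesis using Em by linarith
      qed
    qed (use V(3) MQ(2) in auto)
    also have "4 * (E * (1 + ln (real V)) + real V * \<tau>) \<le> (4 * k2 + 65) * (x / y powr A)"
      unfolding E_def \<tau>_def using ev by (intro type_I_asymptotics[OF y x1 A k(2) V(1,3) M2 MQ(2) cd C]) auto
    also have "sqrt (real N) * (2 * ln (real N)) * (real M + real (card \<Xi>) * (4 * (1 + ln (real M)))) \<le> 3 * (x / y powr A)"
      unfolding cd_def[symmetric] using ev by (intro prime_power_asymptotics[OF y x1 A C N(1,3) cd M1 M3 MQ(2)]) auto
    also have "sum_max M (\<lambda>q a. norm (\<Sum>m\<in>{V<..N}. \<Sum>k\<in>{V<..N div m}. g m * f k * of_real (log_weight m k) * kappa \<Xi> q a (m * k)))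
      \<le> (128 * k1 + K4) * (x / y powr A) + 354816 * (x / y powr A)"
    proof -
      have \<Omega>: "4 ^ card (prime_factors q) \<le> K4 * x powr 0.02" if q: "q \<in> {1..M}" for q
      proof -
        have "4 ^ card (prime_factors q) \<le> K4 * real q powr 0.04" using q by (intro K4) auto
        also have "real q \<le> sqrt x" using q M2 by (meson atLeastAtMost_iff of_nat_le_iff order_trans)
        hence "K4 * real q powr 0.04 \<le> K4 * sqrt x powr 0.04" using K4 by (intro mult_left_mono powr_mono2) auto
        also have "sqrt x powr 0.04 = x powr 0.02" using x1 by (simp add: powr_half_sqrt[symmetric] powr_powr)
        finally show ?thesis .
      qed
      have small: "(\<Sum>q = 1..M. 1 / real (totient q) * (\<Sum>\<eta> | \<eta> \<in> chars q - induced_chars \<Xi> q \<and> conductor q \<eta> \<le> R. norm (bilinear_sum g f V N \<eta>)))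
        \<le> 4 * (1 + ln (real M)) * (real R)\<^sup>2 * (4 * x * (1 + ln x) *
          (real R * (k1 / y powr (14 * A + 28)) * (1 + ln x) + sqrt (x powr 0.4 / sqrt x) * (K4 * x powr 0.02)))"
      proof (rule small_conductor_bound[OF f g fg _ _ N(1)])
        show "norm (Delta \<Xi> h X r a) \<le> k1 / y powr (14 * A + 28) * X"
          if "h \<in> {f, g}" "x powr 0.4 \<le> X" "X \<le> x" "1 \<le> r" "coprime a r" for h X r a
          using i[OF that] by (simp add: y_def)
      qed (use N(3) x1 k(1) MQ(2) \<Omega> in auto)
      have large: "(\<Sum>q = 1..M. 1 / real (totient q) * (\<Sum>\<eta> | \<eta> \<in> chars q \<and> conductor q \<eta> > R. norm (bilinear_sum g f V N \<eta>)))
        \<le> (1 + 2 * ln x) * ((10 + 4 * ln x) * ((1 + 2 * ln x) * (16 * sqrt x *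
          ((4 * sqrt x / real R + 8 * sqrt (x / real V)) * (4 * (1 + ln x)) + 16 * real M))))"
        using V(3) MQ(2) class_C_norm_le_1[OF f] class_C_norm_le_1[OF g]
        by (intro large_conductor_bound N x1 R M3) auto
      show ?thesis
        using type_II_bound[where M = M and V = V and N = N and g = g and f = f and \<Xi> = \<Xi> and R = R] MQ(2) small large
          small_conductor_asymptotics[OF y x1 A k(1) less_imp_le[OF K4(1)] R(1) M3 MQ(2)]
          large_conductor_asymptotics[OF y x1 A C R(2) V(2) M1] ev by linarith
    qed
    finally show "sum_max_Delta \<Xi> (on_primes f) x Q \<le> (4 * k2 + 65 + (128 * k1 + K4) + 354816 + 3) * (x / ln x powr A)"
      unfolding y_def by (simp add: algebra_simps)
  qed
qed

lemma sum_max_Delta_uminus: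
  assumes "\<And>n. h' n = - h n"
  shows "sum_max_Delta \<Xi> h' X Q = sum_max_Delta \<Xi> h X Q"
proof -
  have "Delta \<Xi> h' X q a = - Delta \<Xi> h X q a" for q a
    unfolding Delta_eq_kappa_sum by (simp add: assms sum_negf)
  thus ?thesis by (simp add: sum_max_Delta_def)
qed

theorem theorem2p3:
  fixes A C \<epsilon> :: real
  assumes "A \<ge> 0" and "C \<ge> 0" and "\<epsilon> > 0"
  shows "\<exists>x\<^sub>0::real. \<forall>K\<^sub>1 K\<^sub>2 :: real. \<exists>K::real.
    \<forall>(f :: nat \<Rightarrow> complex) (g :: nat \<Rightarrow> complex) (x::real) (Q::real) (\<Xi> :: (nat \<Rightarrow> complex) set).
      f \<in> class_C \<longrightarrow>
      g \<in> class_C \<longrightarrow>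
      (\<forall>s. Re s > 1 \<longrightarrow> dirichlet_series f s * dirichlet_series g s = 1) \<longrightarrow>
      x \<ge> x\<^sub>0 \<longrightarrow>
      2 \<le> Q \<longrightarrow>
      Q \<le> x powr (1/2) / ln x powr (5 * A / 2 + C / 4 + 7 / 2) \<longrightarrow>
      finite \<Xi> \<longrightarrow>
      (\<forall>\<psi>\<in>\<Xi>. \<exists>d. primitive_char d \<psi>) \<longrightarrow>
      real (card \<Xi>) \<le> ln x powr C \<longrightarrow>
      (\<forall>h\<in>{f, g}.
        (\<forall>X q a. x powr 0.4 \<le> X \<longrightarrow> X \<le> x \<longrightarrow> 1 \<le> q \<longrightarrow> coprime a q \<longrightarrow>
           norm (Delta \<Xi> h X q a) \<le> K\<^sub>1 * (X / ln x powr (14 * A + 28))) \<and>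
        (\<forall>X. x / ln x powr (6 * A + C + 10) \<le> X \<longrightarrow> X \<le> x \<longrightarrow>
           sum_max_Delta \<Xi> h X Q \<le> K\<^sub>2 * (X / ln x powr (A + \<epsilon>)))) \<longrightarrow>
      sum_max_Delta \<Xi> (on_primes f) x Q \<le> K * (x / ln x powr A) \<and>
      sum_max_Delta \<Xi> (on_primes g) x Q \<le> K * (x / ln x powr A)"
proof -
  obtain x0 K4 where K4: "K4 \<ge> 0" and bound: "\<And>f g x Q \<Xi> k1 k2. f \<in> class_C \<Longrightarrow> g \<in> class_C \<Longrightarrow> dirichlet_inverses f g \<Longrightarrow> x \<ge> x0 \<Longrightarrow> 2 \<le> Q \<Longrightarrow>
      Q \<le> x powr (1/2) / ln x powr (5 * A / 2 + C / 4 + 7 / 2) \<Longrightarrow> finite \<Xi> \<Longrightarrow> real (card \<Xi>) \<le> ln x powr C \<Longrightarrow>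
      k1 \<ge> 0 \<Longrightarrow> k2 \<ge> 0 \<Longrightarrow>
      (\<And>h X q a. h \<in> {f, g} \<Longrightarrow> x powr 0.4 \<le> X \<Longrightarrow> X \<le> x \<Longrightarrow> 1 \<le> q \<Longrightarrow> coprime a q \<Longrightarrow>
        norm (Delta \<Xi> h X q a) \<le> k1 * (X / ln x powr (14 * A + 28))) \<Longrightarrow>
      (\<And>h X. h \<in> {f, g} \<Longrightarrow> x / ln x powr (6 * A + C + 10) \<le> X \<Longrightarrow> X \<le> x \<Longrightarrow>
        sum_max_Delta \<Xi> h X Q \<le> k2 * (X / ln x powr (A + \<epsilon>))) \<Longrightarrow>
      sum_max_Delta \<Xi> (on_primes f) x Q \<le> (4 * k2 + 65 + (128 * k1 + K4) + 354816 + 3) * (x / ln x powr A)"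
    by (rule prime_sum_bound[OF assms]) blast
  show ?thesis
  proof (rule exI[of _ "max x0 0"], intro allI, rule exI, intro allI impI)
    fix K\<^sub>1 K\<^sub>2 :: real and f g :: "nat \<Rightarrow> complex" and x Q :: real and \<Xi> :: "(nat \<Rightarrow> complex) set"
    assume f: "f \<in> class_C" and g: "g \<in> class_C" and FG: "\<forall>s. Re s > 1 \<longrightarrow> dirichlet_series f s * dirichlet_series g s = 1"
      and x: "x \<ge> max x0 0" and Q: "2 \<le> Q" "Q \<le> x powr (1/2) / ln x powr (5 * A / 2 + C / 4 + 7 / 2)"
      and \<Xi>: "finite \<Xi>" "\<forall>\<psi>\<in>\<Xi>. \<exists>d. primitive_char d \<psi>" "real (card \<Xi>) \<le> ln x powr C"
      and hyp: "\<forall>h\<in>{f, g}.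
        (\<forall>X q a. x powr 0.4 \<le> X \<longrightarrow> X \<le> x \<longrightarrow> 1 \<le> q \<longrightarrow> coprime a q \<longrightarrow>
           norm (Delta \<Xi> h X q a) \<le> K\<^sub>1 * (X / ln x powr (14 * A + 28))) \<and>
        (\<forall>X. x / ln x powr (6 * A + C + 10) \<le> X \<longrightarrow> X \<le> x \<longrightarrow>
           sum_max_Delta \<Xi> h X Q \<le> K\<^sub>2 * (X / ln x powr (A + \<epsilon>)))"
    have fg: "dirichlet_inverses f g"
      using class_C_norm_le_1[OF f] class_C_norm_le_1[OF g] FG by (intro dirichlet_series_inverse_imp) auto
    \<comment> \<open>The given constants are arbitrary reals; absolute values supply the
      nonnegative ones that \<open>bound\<close> expects.\<close>
    have main: "sum_max_Delta \<Xi> (on_primes f) x Q \<le> (4 * \<bar>K\<^sub>2\<bar> + 65 + (128 * \<bar>K\<^sub>1\<bar> + K4) + 354816 + 3) * (x / ln x powr A)"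
    proof (rule bound[OF f g fg _ Q \<Xi>(1,3)])
      fix h X q a assume h: "h \<in> {f, g}" and X: "x powr 0.4 \<le> X" "X \<le> x" and q: "1 \<le> (q::nat)" "coprime a q"
      have "X \<ge> 0" using X(1) powr_ge_zero[of x "0.4"] by linarith
      hence "K\<^sub>1 * (X / ln x powr (14 * A + 28)) \<le> \<bar>K\<^sub>1\<bar> * (X / ln x powr (14 * A + 28))" by (intro mult_right_mono) auto
      moreover have "norm (Delta \<Xi> h X q a) \<le> K\<^sub>1 * (X / ln x powr (14 * A + 28))" using hyp h X q by blast
      ultimately show "norm (Delta \<Xi> h X q a) \<le> \<bar>K\<^sub>1\<bar> * (X / ln x powr (14 * A + 28))" by linarith
    next
      fix h X assume h: "h \<in> {f, g}" and X: "x / ln x powr (6 * A + C + 10) \<le> X" "X \<le> x"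
      have "0 \<le> x / ln x powr (6 * A + C + 10)" using x by simp
      hence "X \<ge> 0" using X(1) by linarith
      hence "K\<^sub>2 * (X / ln x powr (A + \<epsilon>)) \<le> \<bar>K\<^sub>2\<bar> * (X / ln x powr (A + \<epsilon>))" by (intro mult_right_mono) auto
      moreover have "sum_max_Delta \<Xi> h X Q \<le> K\<^sub>2 * (X / ln x powr (A + \<epsilon>))" using hyp h X by blast
      ultimately show "sum_max_Delta \<Xi> h X Q \<le> \<bar>K\<^sub>2\<bar> * (X / ln x powr (A + \<epsilon>))" by linarith
    qed (use x in auto)
    have "on_primes g n = - on_primes f n" for n
      using dirichlet_inverses_prime[where f = f and g = g and p = n, OF class_C_one[OF f] class_C_one[OF g] fg]
      by (simp add: on_primes_def)
    hence "sum_max_Delta \<Xi> (on_primes g) x Q = sum_max_Delta \<Xi> (on_primes f) x Q" by (rule sum_max_Delta_uminus)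
    thus "sum_max_Delta \<Xi> (on_primes f) x Q \<le> (4 * \<bar>K\<^sub>2\<bar> + 65 + (128 * \<bar>K\<^sub>1\<bar> + K4) + 354816 + 3) * (x / ln x powr A) \<and>
        sum_max_Delta \<Xi> (on_primes g) x Q \<le> (4 * \<bar>K\<^sub>2\<bar> + 65 + (128 * \<bar>K\<^sub>1\<bar> + K4) + 354816 + 3) * (x / ln x powr A)"
      using main by simp
  qed
qed

end
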